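(* If $K$ is a finite h-regular CW-complex, then its face poset $\mathcal{X}(K)$ is a finite model of $K$; that is, the finite space $\mathcal{X}(K)$ is weak homotopy equivalent to $K$.
   Context: For an (open) cell $e^n$ of a CW-complex, $\overline{e^n}$ denotes its closure and $\dot{e}^n$ its boundary, i.e. the image of the attaching map $S^{n-1}\to K$. A CW-complex $K$ is h-regular if the attaching map of each cell is a homotopy equivalence onto its image and the closed cells $\overline{e^n}$ are subcomplexes of $K$. The face poset (or associated finite space) $\mathcal{X}(K)$ of an h-regular complex $K$ is the set of cells of $K$ ordered by the face relation: $e\le e'$ if and only if $e\subseteq\overline{e'}$. Finite posets are identified with finite $T_0$-spaces: the open sets are the down-sets, so the minimal open set containing $y$ is $U_y=\{x: x\le y\}$. A finite model of a CW-complex $K$ is a finite space which is weak homotopy equivalent to $K$. A weak homotopy equivalence is a continuous map inducing isomorphisms in all homotopy groups (a bijection on path components and isomorphisms on all homotopy groups at every base point), and two spaces are weak homotopy equivalent if they are connected by a chain of weak homotopy equivalences. *)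

theory Defs
  imports "HOL-Analysis.Analysis" "HOL-Algebra.Group"
begin

section \<open>Disks, spheres and CW-complexes\<close>

text \<open>
  All disks live in \<^const>\<open>Euclidean_space\<close>, so that the dimension is a natural number. The
  topspace of \<open>disk_boundary n\<close> is the sphere of dimension \<open>n - 1\<close>; it is empty for \<open>n = 0\<close>.
\<close>

definition closed_disk :: "nat \<Rightarrow> (nat \<Rightarrow> real) topology" where
  "closed_disk n = subtopology (Euclidean_space n) {x. (\<Sum>i<n. (x i)\<^sup>2) \<le> 1}"

definition open_disk :: "nat \<Rightarrow> (nat \<Rightarrow> real) topology" where
  "open_disk n = subtopology (Euclidean_space n) {x. (\<Sum>i<n. (x i)\<^sup>2) < 1}"

definition disk_boundary :: "nat \<Rightarrow> (nat \<Rightarrow> real) topology" where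
  "disk_boundary n = subtopology (Euclidean_space n) {x. (\<Sum>i<n. (x i)\<^sup>2) = 1}"

lemma disk_boundary_Suc: "disk_boundary (Suc n) = nsphere n"
  by (simp add: disk_boundary_def nsphere_def lessThan_Suc_atMost)

lemma topspace_disk_boundary_0: "topspace (disk_boundary 0) = {}"
  by (simp add: disk_boundary_def)

text \<open>
  A CW-complex is given by its space \<open>X\<close>, the set \<open>C\<close> of its open cells, their dimensions \<open>d\<close> and
  their characteristic maps \<open>\<Phi>\<close>. The attaching map of the cell \<open>e\<close> is the restriction of \<open>\<Phi> e\<close> to
  \<open>disk_boundary (d e)\<close>.
\<close>

locale cw_complex =
  fixes X :: "'a topology"
    and C :: "'a set set"
    and d :: "'a set \<Rightarrow> nat"
    and \<Phi> :: "'a set \<Rightarrow> (nat \<Rightarrow> real) \<Rightarrow> 'a"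
  assumes hausdorff: "Hausdorff_space X"
    and cells_cover: "\<Union>C = topspace X"
    and cells_disjoint: "disjoint C"
    and char_map_continuous: "e \<in> C \<Longrightarrow> continuous_map (closed_disk (d e)) X (\<Phi> e)"
    and char_map_interior:
      "e \<in> C \<Longrightarrow> homeomorphic_map (open_disk (d e)) (subtopology X e) (\<Phi> e)"
    and closure_finite:
      "e \<in> C \<Longrightarrow> \<exists>F. finite F \<and> F \<subseteq> C \<and> (\<forall>e'\<in>F. d e' < d e)
                     \<and> \<Phi> e ` topspace (disk_boundary (d e)) \<subseteq> \<Union>F"
    and weak_topology:
      "A \<subseteq> topspace X \<Longrightarrow> (\<And>e. e \<in> C \<Longrightarrow> closedin X (A \<inter> X closure_of e)) \<Longrightarrow> closedin X A"

definition subcomplex :: "'a topology \<Rightarrow> 'a set set \<Rightarrow> 'a set \<Rightarrow> bool" where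
  "subcomplex X C A \<longleftrightarrow> closedin X A \<and> (\<exists>D\<subseteq>C. A = \<Union>D)"

definition homotopy_equivalence_map :: "'a topology \<Rightarrow> 'b topology \<Rightarrow> ('a \<Rightarrow> 'b) \<Rightarrow> bool" where
  "homotopy_equivalence_map X Y f \<longleftrightarrow>
     continuous_map X Y f \<and>
     (\<exists>g. continuous_map Y X g
        \<and> homotopic_with (\<lambda>_. True) X X (g \<circ> f) id
        \<and> homotopic_with (\<lambda>_. True) Y Y (f \<circ> g) id)"

definition h_regular ::
  "'a topology \<Rightarrow> 'a set set \<Rightarrow> ('a set \<Rightarrow> nat) \<Rightarrow> ('a set \<Rightarrow> (nat \<Rightarrow> real) \<Rightarrow> 'a) \<Rightarrow> bool" where
  "h_regular X C d \<Phi> \<longleftrightarrow>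
     (\<forall>e\<in>C. homotopy_equivalence_map (disk_boundary (d e))
              (subtopology X (\<Phi> e ` topspace (disk_boundary (d e)))) (\<Phi> e)
          \<and> subcomplex X C (X closure_of e))"


section \<open>Posets as finite spaces, the face poset\<close>

definition poset_topology :: "'b set \<Rightarrow> ('b \<Rightarrow> 'b \<Rightarrow> bool) \<Rightarrow> 'b topology" where
  "poset_topology P r = topology (\<lambda>U. U \<subseteq> P \<and> (\<forall>y\<in>U. \<forall>x\<in>P. r x y \<longrightarrow> x \<in> U))"

lemma openin_poset_topology:
  "openin (poset_topology P r) U \<longleftrightarrow> U \<subseteq> P \<and> (\<forall>y\<in>U. \<forall>x\<in>P. r x y \<longrightarrow> x \<in> U)"
proof -
  have "istopology (\<lambda>U. U \<subseteq> P \<and> (\<forall>y\<in>U. \<forall>x\<in>P. r x y \<longrightarrow> x \<in> U))"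
    unfolding istopology_def by blast
  then show ?thesis
    by (simp add: poset_topology_def topology_inverse')
qed

lemma topspace_poset_topology [simp]: "topspace (poset_topology P r) = P"
  unfolding topspace_def openin_poset_topology by blast

definition face_le :: "'a topology \<Rightarrow> 'a set \<Rightarrow> 'a set \<Rightarrow> bool" where
  "face_le X e e' \<longleftrightarrow> e \<subseteq> X closure_of e'"

definition face_poset :: "'a topology \<Rightarrow> 'a set set \<Rightarrow> 'a set topology" where
  "face_poset X C = poset_topology C (face_le X)"

lemma compact_space_closed_disk: "compact_space (closed_disk n)"
proof -
  let ?S = "{x. \<forall>i\<ge>n. x i = 0} \<inter> {x::nat \<Rightarrow> real. (\<Sum>i<n. (x i)\<^sup>2) \<le> 1}"
  have "compactin (powertop_real UNIV) (\<Pi>\<^sub>E i\<in>UNIV. {-1..1})"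
    by (simp add: compactin_PiE)
  moreover have "?S \<subseteq> (\<Pi>\<^sub>E i\<in>UNIV. {-1..1})"
  proof
    fix x assume x: "x \<in> ?S"
    have "\<bar>x i\<bar> \<le> 1" for i
    proof (cases "i < n")
      case True
      then have "(x i)\<^sup>2 \<le> (\<Sum>i<n. (x i)\<^sup>2)"
        by (intro member_le_sum) auto
      with x have "(x i)\<^sup>2 \<le> 1"
        by simp
      then show ?thesis
        by (simp add: abs_square_le_1)
    next
      case False
      with x show ?thesis by simp
    qed
    then show "x \<in> (\<Pi>\<^sub>E i\<in>UNIV. {-1..1})"
      by (auto simp: abs_le_iff minus_le_iff)
  qed
  moreover have "closedin (powertop_real UNIV) ?S"
  proof (rule closedin_Int)
    show "closedin (powertop_real UNIV) {x. \<forall>i\<ge>n. x i = 0}"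
      using closedin_Euclidean_space topspace_Euclidean_space by metis
    have "continuous_map (powertop_real UNIV) euclideanreal (\<lambda>x. \<Sum>i<n. (x i)\<^sup>2)"
      by (intro continuous_intros continuous_map_product_projection) auto
    from closedin_continuous_map_preimage[OF this, of "{..1}"]
    show "closedin (powertop_real UNIV) {x::nat \<Rightarrow> real. (\<Sum>i<n. (x i)\<^sup>2) \<le> 1}"
      by simp
  qed
  ultimately have "compactin (powertop_real UNIV) ?S"
    using closed_compactin by blast
  then show ?thesis
    by (simp add: closed_disk_def Euclidean_space_def subtopology_subtopology
        compact_space_subtopology)
qed

context cw_complex
begin

lemma char_map_image_open_disk:
  assumes "e \<in> C"
  shows "\<Phi> e ` topspace (open_disk (d e)) = e"
  using homeomorphic_imp_surjective_map[OF char_map_interior[OF assms]] cells_cover assms by auto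

lemma cell_nonempty:
  assumes "e \<in> C"
  shows "e \<noteq> {}"
proof -
  have "(\<lambda>_. 0) \<in> topspace (open_disk (d e))"
    by (simp add: open_disk_def topspace_Euclidean_space)
  then show ?thesis
    using char_map_image_open_disk[OF assms] by blast
qed

lemma closure_of_cell_subset:
  assumes "e \<in> C"
  shows "X closure_of e \<subseteq> e \<union> \<Phi> e ` topspace (disk_boundary (d e))"
proof -
  have disk: "topspace (closed_disk n) = topspace (open_disk n) \<union> topspace (disk_boundary n)" for n
    by (auto simp: closed_disk_def open_disk_def disk_boundary_def)
  have "closedin X (\<Phi> e ` topspace (closed_disk (d e)))"
    using compact_space_closed_disk char_map_continuous[OF assms] hausdorff
    by (meson compact_space_def compactin_imp_closedin image_compactin)
  moreover have "\<Phi> e ` topspace (closed_disk (d e)) = e \<union> \<Phi> e ` topspace (disk_boundary (d e))"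
    by (simp add: disk image_Un char_map_image_open_disk[OF assms])
  ultimately show ?thesis
    by (metis closure_of_minimal Un_upper1)
qed

lemma face_le_imp_eq_or_less:
  assumes "e \<in> C" "e' \<in> C" "face_le X e e'"
  shows "e = e' \<or> d e < d e'"
proof -
  obtain x where x: "x \<in> e" "x \<in> X closure_of e'"
    using cell_nonempty[OF assms(1)] assms(3) by (auto simp: face_le_def)
  obtain F where F: "F \<subseteq> C" "\<forall>e''\<in>F. d e'' < d e'"
      "\<Phi> e' ` topspace (disk_boundary (d e')) \<subseteq> \<Union>F"
    using closure_finite[OF assms(2)] by blast
  have "x \<in> e' \<or> (\<exists>e''\<in>F. x \<in> e'')"
    using x closure_of_cell_subset[OF assms(2)] F(3) by blast
  then show ?thesis
    using x(1) assms(1,2) F(1,2) cells_disjoint by (metis disjointD disjoint_iff subsetD)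
qed

lemma face_le_refl: "e \<in> C \<Longrightarrow> face_le X e e"
  using cells_cover by (auto simp: face_le_def intro!: closure_of_subset)

lemma face_le_trans: "face_le X e1 e2 \<Longrightarrow> face_le X e2 e3 \<Longrightarrow> face_le X e1 e3"
  unfolding face_le_def by (meson closedin_closure_of closure_of_minimal subset_trans)

lemma face_le_antisym:
  "e \<in> C \<Longrightarrow> e' \<in> C \<Longrightarrow> face_le X e e' \<Longrightarrow> face_le X e' e \<Longrightarrow> e = e'"
  using face_le_imp_eq_or_less[of e e'] face_le_imp_eq_or_less[of e' e] by auto

end


section \<open>Homotopy groups and weak homotopy equivalences\<close>

definition unit_cube :: "nat \<Rightarrow> (nat \<Rightarrow> real) topology" where
  "unit_cube n = subtopology (Euclidean_space n) {x. \<forall>i<n. 0 \<le> x i \<and> x i \<le> 1}"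

definition cube_boundary :: "nat \<Rightarrow> (nat \<Rightarrow> real) set" where
  "cube_boundary n = {x \<in> topspace (unit_cube n). \<exists>i<n. x i = 0 \<or> x i = 1}"

definition gen_loops :: "nat \<Rightarrow> 'a topology \<Rightarrow> 'a \<Rightarrow> ((nat \<Rightarrow> real) \<Rightarrow> 'a) set" where
  "gen_loops n X x0 =
     {f. continuous_map (unit_cube n) X f \<and> (\<forall>x\<in>cube_boundary n. f x = x0)}"

definition loop_homotopic ::
  "nat \<Rightarrow> 'a topology \<Rightarrow> 'a \<Rightarrow> ((nat \<Rightarrow> real) \<Rightarrow> 'a) \<Rightarrow> ((nat \<Rightarrow> real) \<Rightarrow> 'a) \<Rightarrow> bool" where
  "loop_homotopic n X x0 =
     homotopic_with (\<lambda>h. \<forall>x\<in>cube_boundary n. h x = x0) (unit_cube n) X"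

definition loop_concat ::
  "((nat \<Rightarrow> real) \<Rightarrow> 'a) \<Rightarrow> ((nat \<Rightarrow> real) \<Rightarrow> 'a) \<Rightarrow> (nat \<Rightarrow> real) \<Rightarrow> 'a" where
  "loop_concat f g x =
     (if x 0 \<le> 1 / 2 then f (x(0 := 2 * x 0)) else g (x(0 := 2 * x 0 - 1)))"

text \<open>
  The carrier consists of the homotopy classes relative to the boundary of the cube; products,
  units and induced maps are formed by saturating under homotopy, so that no choice of
  representatives is involved. This is the homotopy group for \<open>n \<ge> 1\<close> and \<open>x0 \<in> topspace X\<close>.
\<close>

definition homotopy_group ::
  "nat \<Rightarrow> 'a topology \<Rightarrow> 'a \<Rightarrow> ((nat \<Rightarrow> real) \<Rightarrow> 'a) set monoid" where
  "homotopy_group n X x0 =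
     \<lparr>carrier = (\<lambda>f. Collect (loop_homotopic n X x0 f)) ` gen_loops n X x0,
      mult = (\<lambda>A B. {h. \<exists>f\<in>A. \<exists>g\<in>B. loop_homotopic n X x0 (loop_concat f g) h}),
      one = Collect (loop_homotopic n X x0 (\<lambda>_. x0))\<rparr>"

definition homotopy_group_map ::
  "nat \<Rightarrow> 'b topology \<Rightarrow> ('a \<Rightarrow> 'b) \<Rightarrow> 'a
    \<Rightarrow> ((nat \<Rightarrow> real) \<Rightarrow> 'a) set \<Rightarrow> ((nat \<Rightarrow> real) \<Rightarrow> 'b) set" where
  "homotopy_group_map n Y f x0 A = {h. \<exists>g\<in>A. loop_homotopic n Y (f x0) (f \<circ> g) h}"

definition path_components_map ::
  "'b topology \<Rightarrow> ('a \<Rightarrow> 'b) \<Rightarrow> 'a set \<Rightarrow> 'b set" where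
  "path_components_map Y f A = (\<Union>a\<in>A. path_component_of_set Y (f a))"

definition weak_homotopy_equivalence :: "'a topology \<Rightarrow> 'b topology \<Rightarrow> ('a \<Rightarrow> 'b) \<Rightarrow> bool" where
  "weak_homotopy_equivalence X Y f \<longleftrightarrow>
     continuous_map X Y f \<and>
     bij_betw (path_components_map Y f) (path_components_of X) (path_components_of Y) \<and>
     (\<forall>n\<ge>1. \<forall>x0\<in>topspace X.
        homotopy_group_map n Y f x0 \<in> iso (homotopy_group n X x0) (homotopy_group n Y (f x0)))"

text \<open>
  Two spaces are weak homotopy equivalent if a chain of weak homotopy equivalences (in either
  direction) connects them. Types cannot be quantified over, so all spaces strictly between the
  two ends have their points in the type \<open>real \<Rightarrow> 'a + 'b\<close>. Nothing is lost: the geometric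
  realizations of the singular complexes of \<open>X\<close> and \<open>Y\<close> have at most as many points as this type
  has elements, and if \<open>X\<close> and \<open>Y\<close> are connected by any chain at all, then these realizations
  are homotopy equivalent. The two end links below are no restriction either, since \<open>X\<close> and \<open>Y\<close>
  have homeomorphic copies in this type.
\<close>

definition weak_homotopy_equivalent_space :: "'a topology \<Rightarrow> 'b topology \<Rightarrow> bool" where
  "weak_homotopy_equivalent_space X Y \<longleftrightarrow>
     (\<exists>X' Y' :: (real \<Rightarrow> 'a + 'b) topology.
        (\<exists>f. weak_homotopy_equivalence X X' f) \<and>
        (\<exists>g. weak_homotopy_equivalence Y Y' g) \<and>
        equivclp (\<lambda>Z W. \<exists>h. weak_homotopy_equivalence Z W h) X' Y')"

definition finite_model :: "'b topology \<Rightarrow> 'a topology \<Rightarrow> bool" where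
  "finite_model F X \<longleftrightarrow> finite (topspace F) \<and> weak_homotopy_equivalent_space F X"

end

theory Submission
  imports Defs
begin

text \<open>
  A single continuous map from the complex to its face poset is a weak homotopy equivalence. The
  obvious candidate, sending a point to the open cell that contains it, is continuous only for the
  opposite order, and the preimages of its minimal open sets are the open stars of the cells, which
  need not be contractible in an h-regular complex. Instead only the inner half of each cell is sent
  to that cell, and a point of the outer half is sent to wherever its radial projection to the
  boundary of the disk is sent, which is determined by recursion on the dimension
  (\<open>radial_cell_map\<close>). The points sent to faces of a cell \<open>e\<close> then form an open set that arises from
  the closed cell by adding collars, and which therefore can be pushed back radially to the closed
  cell without changing the homotopy type (\<open>radial_neighbourhood\<close>).

  The closed cell is contractible, because it arises by attaching a disk along a homotopy equivalence
  (\<open>contractible_cell_attachment\<close>): the mapping cylinder of the attaching map can be deformed into its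
  inner end, which is a sphere in the disk, and by the homotopy extension property of the disk the
  identity of the closed cell is homotopic to a map that factors through the disk. So the map to the
  face poset has contractible preimages of all minimal open sets.

  By McCord's theorem (\<open>weak_homotopy_equivalence_to_finite_poset\<close>) every such map is a weak homotopy
  equivalence. Given a map \<open>\<beta>\<close> from a cube to the poset and a lift on the boundary of the cube,
  compactness yields a fine grid and a monotone labelling of its cells by elements of the poset, such
  that \<open>\<beta>\<close> maps each cell below its label (\<open>label_small_sets\<close>). The preimages of the sets below the
  labels are contractible, so there is no obstruction to extending the lift one cell at a time; and
  the sets below the labels are themselves contractible, so the same procedure on the cylinder yields
  a homotopy from the image of the lift to \<open>\<beta>\<close> relative to the boundary (\<open>lift_up_to_homotopy\<close>).
  Applied to cubes of dimension \<open>n\<close> and \<open>n + 1\<close> this gives surjectivity and injectivity on the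
  homotopy groups of dimension \<open>n\<close>.
\<close>

section \<open>Labelling small sets by elements of a finite poset\<close>

locale finite_poset =
  fixes P :: "'b set" and r :: "'b \<Rightarrow> 'b \<Rightarrow> bool"
  assumes finite: "finite P"
    and refl: "x \<in> P \<Longrightarrow> r x x"
    and antisym: "\<lbrakk>x \<in> P; y \<in> P; r x y; r y x\<rbrakk> \<Longrightarrow> x = y"
    and trans: "\<lbrakk>x \<in> P; y \<in> P; z \<in> P; r x y; r y z\<rbrakk> \<Longrightarrow> r x z"

lemma (in finite_poset) maximal_element:
  assumes "P \<noteq> {}"
  obtains e where "e \<in> P" "\<And>x. \<lbrakk>x \<in> P; r e x\<rbrakk> \<Longrightarrow> x = e"
proof -
  define R where "R x y \<longleftrightarrow> r x y \<and> x \<noteq> y" for x y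
  have "asymp_on P R"
    unfolding R_def by (rule asymp_onI) (use antisym in blast)
  moreover have "transp_on P R"
    unfolding R_def by (rule transp_onI) (use antisym trans in blast)
  ultimately obtain e where "e \<in> P" "\<forall>x\<in>P. x \<noteq> e \<longrightarrow> \<not> R e x"
    using Finite_Set.bex_max_element[of P R] finite assms by blast
  then show ?thesis
    using that unfolding R_def by metis
qed

text \<open>
  The labels \<open>l S\<close> are upper bounds of \<open>\<beta>\<close> on small sets, chosen monotonically in \<open>S\<close>. The clause
  with \<open>\<eta>\<close>, saying that a label is a value of \<open>\<beta>\<close> close to \<open>S\<close>, makes labels at different
  scales comparable.
\<close>
definition small_set_labelling ::
  "'b set \<Rightarrow> ('b \<Rightarrow> 'b \<Rightarrow> bool) \<Rightarrow> 'q::metric_space set \<Rightarrow> ('q \<Rightarrow> 'b) \<Rightarrow> real \<Rightarrow> real \<Rightarrow> ('q set \<Rightarrow> 'b) \<Rightarrow> bool"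
where
  "small_set_labelling P r Q \<beta> \<eta> \<delta> l \<longleftrightarrow>
     (\<forall>S\<subseteq>Q. S \<noteq> {} \<longrightarrow> (\<forall>x\<in>S. \<forall>y\<in>S. dist x y < \<delta>) \<longrightarrow>
        l S \<in> P \<and> (\<forall>x\<in>S. r (\<beta> x) (l S)) \<and> (\<exists>x\<in>S. \<exists>y\<in>Q. dist x y < \<eta> \<and> \<beta> y = l S)
        \<and> (\<forall>S'\<subseteq>S. S' \<noteq> {} \<longrightarrow> r (l S') (l S)))"

lemma small_set_labellingD:
  assumes "small_set_labelling P r Q \<beta> \<eta> \<delta> l" "S \<subseteq> Q" "S \<noteq> {}" "\<And>x y. \<lbrakk>x \<in> S; y \<in> S\<rbrakk> \<Longrightarrow> dist x y < \<delta>"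
  shows "l S \<in> P" "x \<in> S \<Longrightarrow> r (\<beta> x) (l S)" "\<exists>x\<in>S. \<exists>y\<in>Q. dist x y < \<eta> \<and> \<beta> y = l S"
    "\<lbrakk>S' \<subseteq> S; S' \<noteq> {}\<rbrakk> \<Longrightarrow> r (l S') (l S)"
  using assms unfolding small_set_labelling_def by blast+

text \<open>
  Continuity bounds \<open>\<beta>\<close> near each point, and compactness makes this uniform, but a bound chosen for each
  small set separately is not monotone. Monotonicity comes from working at several scales, by
  induction on the poset. For a maximal element \<open>e\<close> the set \<open>F\<close> where \<open>\<beta>\<close> takes the value \<open>e\<close> is
  compact, so \<open>\<beta>\<close> is bounded by \<open>e\<close> on a whole neighbourhood of \<open>F\<close>. Sets coming close to \<open>F\<close> get
  the label \<open>e\<close>; the others lie in a compact set \<open>Q'\<close> on which \<open>\<beta>\<close> avoids \<open>e\<close>, and the induction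
  hypothesis labels them at a scale \<open>\<epsilon>\<close> that is small compared to the neighbourhood.
\<close>
lemma label_small_sets:
  fixes Q :: "'q::metric_space set" and r :: "'b \<Rightarrow> 'b \<Rightarrow> bool"
  assumes "finite_poset P r" "compact Q"
    and "continuous_map (top_of_set Q) (poset_topology P r) \<beta>" "\<eta> > 0"
  shows "\<exists>\<delta>>0. \<exists>l. small_set_labelling P r Q \<beta> \<eta> \<delta> l"
  using finite_poset.finite[OF assms(1)] assms
proof (induction P arbitrary: Q \<eta> rule: finite_psubset_induct)
  case (psubset P Q \<eta>)
  interpret finite_poset P r by (fact psubset.prems(1))
  have \<beta>P: "\<beta> x \<in> P" if "x \<in> Q" for x
    using psubset.prems(3) that by (auto simp: continuous_map_def)
  show ?case
  proof (cases "P = {}")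
    case True
    then have "Q = {}" using \<beta>P by auto
    then show ?thesis by (intro exI[of _ 1]) (auto simp: small_set_labelling_def)
  next
    case False
    obtain e where e: "e \<in> P" and emax: "\<And>x. \<lbrakk>x \<in> P; r e x\<rbrakk> \<Longrightarrow> x = e"
      using maximal_element[OF False] by metis
    have open_pre: "openin (top_of_set Q) {x \<in> Q. \<beta> x \<in> U}" if "openin (poset_topology P r) U" for U
      using psubset.prems(3) that by (auto simp: continuous_map_def)
    define F where "F = {x \<in> Q. \<beta> x = e}"
    have "openin (poset_topology P r) (P - {e})"
      unfolding openin_poset_topology using emax by auto
    then have "openin (top_of_set Q) {x \<in> Q. \<beta> x \<in> P - {e}}"
      by (rule open_pre)
    moreover have "Q - F = {x \<in> Q. \<beta> x \<in> P - {e}}"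
      using \<beta>P by (auto simp: F_def)
    ultimately have "closedin (top_of_set Q) F"
      unfolding closedin_def by (auto simp: F_def)
    then have compF: "compact F"
      using psubset.prems(2) closedin_compact_eq by blast
    have "openin (poset_topology P r) {x \<in> P. r x e}"
      unfolding openin_poset_topology using trans e by blast
    then have "openin (top_of_set Q) {x \<in> Q. \<beta> x \<in> {x \<in> P. r x e}}"
      by (rule open_pre)
    then obtain W where W: "open W" "{x \<in> Q. \<beta> x \<in> {x \<in> P. r x e}} = Q \<inter> W"
      by (auto simp: openin_open)
    have "F \<subseteq> W"
      using W(2) e refl by (auto simp: F_def)
    then obtain \<epsilon>0 where \<epsilon>0: "\<epsilon>0 > 0" "(\<Union>x\<in>F. ball x \<epsilon>0) \<subseteq> W"
      using compact_subset_open_imp_ball_epsilon_subset[OF compF W(1)] by metis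
    define \<epsilon> where "\<epsilon> = min (\<epsilon>0 / 4) \<eta>"
    have \<epsilon>: "\<epsilon> > 0" "\<epsilon> \<le> \<eta>" "4 * \<epsilon> \<le> \<epsilon>0"
      using \<epsilon>0(1) psubset.prems(4) by (auto simp: \<epsilon>_def)
    have near: "r (\<beta> x) e" if "y \<in> F" "x \<in> Q" "dist y x < 4 * \<epsilon>" for x y
    proof -
      have "x \<in> ball y \<epsilon>0" using that(3) \<epsilon>(3) by simp
      then have "x \<in> W" using that(1) \<epsilon>0(2) by blast
      then show ?thesis using that(2) W(2) by blast
    qed
    \<comment> \<open>A factor 4: a point at distance at most \<open>\<epsilon>\<close> from a set of diameter at most \<open>\<epsilon>\<close> that itself
      comes \<open>\<epsilon>\<close>-close to \<open>F\<close> is still covered by \<open>near\<close>.\<close>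
    define Q' where "Q' = Q - (\<Union>y\<in>F. ball y \<epsilon>)"
    have compQ': "compact Q'"
      unfolding Q'_def using psubset.prems(2) by (intro compact_diff) auto
    have "continuous_map (top_of_set Q') (poset_topology (P - {e}) r) \<beta>"
      unfolding continuous_map_def
    proof (intro conjI allI impI)
      show "\<beta> \<in> topspace (top_of_set Q') \<rightarrow> topspace (poset_topology (P - {e}) r)"
        using \<beta>P \<epsilon>(1) by (auto simp: Q'_def F_def)
      fix U assume "openin (poset_topology (P - {e}) r) U"
      then have "openin (poset_topology P r) U"
        unfolding openin_poset_topology using emax by blast
      then have "openin (top_of_set Q) {x \<in> Q. \<beta> x \<in> U}"
        by (rule open_pre)
      then have "openin (top_of_set Q') (Q' \<inter> {x \<in> Q. \<beta> x \<in> U})"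
        by (metis Diff_subset Q'_def inf_commute openin_subset_trans subset_refl openin_subtopology_Int
              subtopology_subtopology inf.absorb_iff2)
      moreover have "Q' \<inter> {x \<in> Q. \<beta> x \<in> U} = {x \<in> topspace (top_of_set Q'). \<beta> x \<in> U}"
        by (auto simp: Q'_def)
      ultimately show "openin (top_of_set Q') {x \<in> topspace (top_of_set Q'). \<beta> x \<in> U}"
        by simp
    qed
    moreover have "P - {e} \<subset> P" using e by blast
    moreover have "finite_poset (P - {e}) r"
      using finite refl antisym trans unfolding finite_poset_def by blast
    ultimately have "\<exists>\<delta>>0. \<exists>l. small_set_labelling (P - {e}) r Q' \<beta> \<epsilon> \<delta> l"
      using compQ' \<epsilon>(1) by (intro psubset.IH)
    then obtain \<delta>' l' where \<delta>': "\<delta>' > 0" and l': "small_set_labelling (P - {e}) r Q' \<beta> \<epsilon> \<delta>' l'"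
      by blast
    define \<delta> where "\<delta> = min \<delta>' \<epsilon>"
    have \<delta>: "\<delta> > 0" "\<delta> \<le> \<delta>'" "\<delta> \<le> \<epsilon>"
      using \<delta>' \<epsilon> by (auto simp: \<delta>_def)
    define l where "l S = (if S \<subseteq> Q' then l' S else e)" for S
    have "small_set_labelling P r Q \<beta> \<eta> \<delta> l"
      unfolding small_set_labelling_def
    proof (intro allI impI)
      fix S assume S: "S \<subseteq> Q" "S \<noteq> {}" "\<forall>x\<in>S. \<forall>y\<in>S. dist x y < \<delta>"
      have small: "dist x y < \<delta>'" if "x \<in> S" "y \<in> S" for x y
        using that S(3) \<delta>(2) by force
      have l'': "l' S' \<in> P - {e}" "\<And>x. x \<in> S' \<Longrightarrow> r (\<beta> x) (l' S')" 
          "\<exists>x\<in>S'. \<exists>y\<in>Q'. dist x y < \<epsilon> \<and> \<beta> y = l' S'" "\<And>S''. \<lbrakk>S'' \<subseteq> S'; S'' \<noteq> {}\<rbrakk> \<Longrightarrow> r (l' S'') (l' S')"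
        if "S' \<subseteq> Q'" "S' \<noteq> {}" "S' \<subseteq> S" for S'
        using small_set_labellingD[OF l' that(1,2)] small that(3) by (blast)+
      show "l S \<in> P \<and> (\<forall>x\<in>S. r (\<beta> x) (l S)) \<and> (\<exists>x\<in>S. \<exists>y\<in>Q. dist x y < \<eta> \<and> \<beta> y = l S)
        \<and> (\<forall>S'\<subseteq>S. S' \<noteq> {} \<longrightarrow> r (l S') (l S))"
      proof (cases "S \<subseteq> Q'")
        case True
        note lS = l''[OF True S(2) order_refl]
        obtain x y where "x \<in> S" "y \<in> Q'" "dist x y < \<epsilon>" "\<beta> y = l' S"
          using lS(3) by blast
        then have "\<exists>x\<in>S. \<exists>y\<in>Q. dist x y < \<eta> \<and> \<beta> y = l' S"
          using \<epsilon>(2) by (intro bexI[of _ x] bexI[of _ y]) (auto simp: Q'_def)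
        moreover have "r (l S') (l S)" if "S' \<subseteq> S" "S' \<noteq> {}" for S'
          using lS(4) that True by (auto simp: l_def)
        ultimately show ?thesis
          using True lS(1,2) by (auto simp: l_def)
      next
        case False
        then obtain p y where p: "p \<in> S" "y \<in> F" "dist y p < \<epsilon>"
          using S(1) by (auto simp: Q'_def)
        have le_e: "r (\<beta> z) e" if "x \<in> S" "z \<in> Q" "dist x z < \<epsilon>" for x z
        proof (rule near[OF p(2) that(2)])
          have "dist y z \<le> dist y p + (dist p x + dist x z)"
            by (meson dist_triangle dist_triangle_le add_left_mono order_trans)
          moreover have "dist p x < \<epsilon>"
            using S(3) p(1) that(1) \<delta>(3) by fastforce
          ultimately show "dist y z < 4 * \<epsilon>"
            using p(3) that(3) \<epsilon>(1) by linarith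
        qed
        \<comment> \<open>Here the \<open>\<epsilon>\<close> of the induction hypothesis matters: the label of \<open>S'\<close> is attained near \<open>S'\<close>,
          hence near \<open>F\<close>, where all values are at most \<open>e\<close>.\<close>
        have "r (l S') e" if S': "S' \<subseteq> S" "S' \<noteq> {}" for S'
        proof (cases "S' \<subseteq> Q'")
          case True
          obtain x y where "x \<in> S'" "y \<in> Q'" "dist x y < \<epsilon>" "\<beta> y = l' S'"
            using l''(3)[OF True S'(2) S'(1)] by blast
          then show ?thesis
            using le_e[of x y] S' True by (auto simp: l_def Q'_def)
        next
          case False then show ?thesis using refl e by (simp add: l_def)
        qed
        moreover have "\<exists>x\<in>S. \<exists>y\<in>Q. dist x y < \<eta> \<and> \<beta> y = e"
          using p \<epsilon>(2) by (intro bexI[of _ p] bexI[of _ y]) (auto simp: F_def dist_commute)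
        ultimately show ?thesis
          using False e le_e S(1) \<epsilon>(1) by (auto simp: l_def subset_iff)
      qed
    qed
    with \<delta>(1) show ?thesis by blast
  qed
qed

section \<open>Extending maps cell by cell\<close>

lemma continuous_map_if_closed:
  assumes "closedin X A" "closedin X B" "topspace X \<subseteq> A \<union> B"
    and "continuous_map (subtopology X A) Y f" "continuous_map (subtopology X B) Y g"
    and "\<And>x. \<lbrakk>x \<in> A; x \<in> B\<rbrakk> \<Longrightarrow> f x = g x"
  shows "continuous_map X Y (\<lambda>x. if x \<in> A then f x else g x)"
proof (rule pasting_lemma_closed[of "{True, False}" X "\<lambda>b. if b then A else B" Y "\<lambda>b. if b then f else g"])
qed (use assms in \<open>auto split: if_splits\<close>)

lemma homotopic_with_TrueE:
  assumes "homotopic_with (\<lambda>_. True) X Y f g"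
  obtains h where "continuous_map (prod_topology (top_of_set {0..1::real}) X) Y h"
    "\<And>x. h (0, x) = f x" "\<And>x. h (1, x) = g x"
  using assms unfolding homotopic_with_def by metis

text \<open>
  The level set \<open>g = 1\<close> plays the role of the boundary of a cell and \<open>b\<close> that of the radial
  projection, which exists away from the centre. The outer half of the cell is filled by the
  contraction of \<open>Z\<close> and the inner half is sent to the point to which \<open>Z\<close> contracts, so that the
  singularity of \<open>b\<close> at the centre does no harm.
\<close>
lemma contractible_space_cone_extension:
  assumes Z: "contractible_space Z" "topspace Z \<noteq> {}"
    and g: "continuous_map W euclideanreal g" "\<And>x. x \<in> topspace W \<Longrightarrow> g x \<le> 1"
    and b: "continuous_map (subtopology W {x. 1 / 2 \<le> g x}) (subtopology W {x. g x = 1}) b"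
      "\<And>x. \<lbrakk>x \<in> topspace W; g x = 1\<rbrakk> \<Longrightarrow> b x = x"
    and f: "continuous_map (subtopology W {x. g x = 1}) Z f"
  shows "\<exists>h. continuous_map W Z h \<and> (\<forall>x\<in>topspace W. g x = 1 \<longrightarrow> h x = f x)"
proof -
  obtain z where z: "z \<in> topspace Z" "homotopic_with (\<lambda>_. True) Z Z id (\<lambda>_. z)"
    using Z contractible_space_alt by fastforce
  obtain H where H: "continuous_map (prod_topology (top_of_set {0..1::real}) Z) Z H"
      "\<And>x. H (0, x) = id x" "\<And>x. H (1, x) = z"
    by (rule homotopic_with_TrueE[OF z(2)], rule that)
  define h where "h x = (if g x \<le> 1 / 2 then z else H (2 - 2 * g x, f (b x)))" for x
  have "continuous_map W Z h"
    unfolding h_def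
  proof (rule continuous_map_cases_le)
    let ?V = "subtopology W {x \<in> topspace W. 1 / 2 \<le> g x}"
    have V: "?V = subtopology W {x. 1 / 2 \<le> g x}"
      using subtopology_restrict[of W "{x. 1 / 2 \<le> g x}"] by (simp add: Int_def)
    have "continuous_map ?V (top_of_set {0..1}) (\<lambda>x. 2 - 2 * g x)"
      using g by (auto simp: continuous_map_in_subtopology Pi_iff
          intro!: continuous_intros continuous_map_from_subtopology)
    moreover have "continuous_map ?V Z (\<lambda>x. f (b x))"
      using continuous_map_compose[OF b(1) f] unfolding V by (simp add: o_def)
    ultimately have "continuous_map ?V (prod_topology (top_of_set {0..1}) Z) (\<lambda>x. (2 - 2 * g x, f (b x)))"
      by (simp add: continuous_map_pairedI)
    from continuous_map_compose[OF this H(1)]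
    show "continuous_map ?V Z (\<lambda>x. H (2 - 2 * g x, f (b x)))"
      by (simp add: o_def)
    show "z = H (2 - 2 * g x, f (b x))" if "x \<in> topspace W" "g x = 1 / 2" for x
      unfolding that(2) using H(3) by simp
  qed (use g z in auto)
  moreover have "h x = f x" if "x \<in> topspace W" "g x = 1" for x
    using that b(2) H(2) by (simp add: h_def)
  ultimately show ?thesis by blast
qed

text \<open>
  Cells are added in order of dimension, so that the boundary of the next cell \<open>s\<close> is covered by \<open>L\<close>
  and by cells already treated. By the monotonicity of \<open>T\<close> the map constructed so far sends this
  boundary into \<open>T s\<close>, where it extends over \<open>s\<close>.
\<close>
lemma extend_over_cells:
  fixes cell bd :: "'i \<Rightarrow> 'w set" and dm :: "'i \<Rightarrow> nat"
  assumes "finite F" and L: "closedin W L"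
    and "\<And>s. s \<in> F \<Longrightarrow> closedin W (cell s)"
    and "\<And>s. s \<in> F \<Longrightarrow> bd s \<subseteq> cell s"
    and "\<And>s x. \<lbrakk>s \<in> F; x \<in> bd s\<rbrakk> \<Longrightarrow> x \<in> L \<or> (\<exists>t\<in>F. dm t < dm s \<and> cell t \<subseteq> cell s \<and> x \<in> cell t)"
    and "\<And>s t. \<lbrakk>s \<in> F; t \<in> F; s \<noteq> t; dm t \<le> dm s\<rbrakk> \<Longrightarrow> cell s \<inter> cell t \<subseteq> bd s"
    and "\<And>s. s \<in> F \<Longrightarrow> cell s \<inter> L \<subseteq> bd s"
    and "\<And>s t. \<lbrakk>s \<in> F; t \<in> F; cell t \<subseteq> cell s\<rbrakk> \<Longrightarrow> T t \<subseteq> T s"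
    and f: "continuous_map (subtopology W L) Y f"
    and "\<And>s x. \<lbrakk>s \<in> F; x \<in> L; x \<in> cell s\<rbrakk> \<Longrightarrow> f x \<in> T s"
    and "\<And>s g. \<lbrakk>s \<in> F; continuous_map (subtopology W (bd s)) (subtopology Y (T s)) g\<rbrakk> \<Longrightarrow>
           \<exists>h. continuous_map (subtopology W (cell s)) (subtopology Y (T s)) h \<and> (\<forall>x\<in>bd s. h x = g x)"
  shows "\<exists>h. continuous_map (subtopology W (L \<union> \<Union>(cell ` F))) Y h \<and> (\<forall>x\<in>L. h x = f x)
            \<and> (\<forall>s\<in>F. \<forall>x\<in>cell s. h x \<in> T s)"
  using assms(1,3-8,10-)
proof (induction "card F" arbitrary: F rule: less_induct)
  case (less F)
  note closed = less.prems(2) and bd_cell = less.prems(3) and bd = less.prems(4)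
    and inter = less.prems(5) and inter_L = less.prems(6) and mono = less.prems(7)
    and fT = less.prems(8) and ext = less.prems(9)
  show ?case
  proof (cases "F = {}")
    case True
    then show ?thesis using f by auto
  next
    case False
    then have "Max (dm ` F) \<in> dm ` F"
      using less.prems(1) by (intro Max_in) auto
    then obtain s where s: "s \<in> F" "dm s = Max (dm ` F)" by auto
    have smax: "dm t \<le> dm s" if "t \<in> F" for t
      using s(2) that less.prems(1) by simp
    define G where "G = F - {s}"
    have G: "G \<subseteq> F" "s \<notin> G" "F = insert s G" "card G < card F" "finite G"
      using s(1) less.prems(1) card_Diff1_less[of F s] unfolding G_def by (auto simp del: card_Diff_singleton)
    have G': "t \<in> F" if "t \<in> G" for t using that G by auto
    define B where "B = L \<union> \<Union>(cell ` G)"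
    have "\<exists>h. continuous_map (subtopology W (L \<union> \<Union>(cell ` G))) Y h \<and> (\<forall>x\<in>L. h x = f x)
            \<and> (\<forall>s\<in>G. \<forall>x\<in>cell s. h x \<in> T s)"
    proof (rule less.hyps[OF G(4,5)])
      show "x \<in> L \<or> (\<exists>t\<in>G. dm t < dm u \<and> cell t \<subseteq> cell u \<and> x \<in> cell t)" if "u \<in> G" "x \<in> bd u" for u x
      proof -
        have "dm t \<noteq> dm s" if "dm t < dm u" for t using smax[OF G'[OF \<open>u \<in> G\<close>]] that by simp
        then show ?thesis using bd[OF G'[OF that(1)] that(2)] G(3) by auto
      qed
      show "\<And>u. u \<in> G \<Longrightarrow> closedin W (cell u)" by (rule closed[OF G'])
      show "\<And>u. u \<in> G \<Longrightarrow> bd u \<subseteq> cell u" by (rule bd_cell[OF G'])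
      show "\<And>u t. \<lbrakk>u \<in> G; t \<in> G; u \<noteq> t; dm t \<le> dm u\<rbrakk> \<Longrightarrow> cell u \<inter> cell t \<subseteq> bd u"
        by (rule inter[OF G' G'])
      show "\<And>u. u \<in> G \<Longrightarrow> cell u \<inter> L \<subseteq> bd u" by (rule inter_L[OF G'])
      show "\<And>u t. \<lbrakk>u \<in> G; t \<in> G; cell t \<subseteq> cell u\<rbrakk> \<Longrightarrow> T t \<subseteq> T u" by (rule mono[OF G' G'])
      show "\<And>u x. \<lbrakk>u \<in> G; x \<in> L; x \<in> cell u\<rbrakk> \<Longrightarrow> f x \<in> T u" by (rule fT[OF G'])
      show "\<And>u g. \<lbrakk>u \<in> G; continuous_map (subtopology W (bd u)) (subtopology Y (T u)) g\<rbrakk> \<Longrightarrow>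
           \<exists>h. continuous_map (subtopology W (cell u)) (subtopology Y (T u)) h \<and> (\<forall>x\<in>bd u. h x = g x)"
        by (rule ext[OF G'])
    qed
    then obtain h where h: "continuous_map (subtopology W B) Y h" "\<And>x. x \<in> L \<Longrightarrow> h x = f x"
        "\<And>s x. \<lbrakk>s \<in> G; x \<in> cell s\<rbrakk> \<Longrightarrow> h x \<in> T s"
      unfolding B_def by blast
    have closedB: "closedin W B"
      unfolding B_def using closed G L by (intro closedin_Un closedin_Union) auto
    have bdB: "bd s \<subseteq> B"
      using bd[OF s(1)] G by (auto simp: B_def)
    have hT: "h x \<in> T s" if "x \<in> bd s" for x
      using bd[OF s(1) that]
    proof
      assume "x \<in> L" then show ?thesis
        using fT[OF s(1)] bd_cell[OF s(1)] that h(2) by auto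
    next
      assume "\<exists>t\<in>F. dm t < dm s \<and> cell t \<subseteq> cell s \<and> x \<in> cell t"
      then obtain t where t: "t \<in> F" "dm t < dm s" "cell t \<subseteq> cell s" "x \<in> cell t" by blast
      then have "t \<in> G" using G by auto
      then show ?thesis using h(3) t mono[OF s(1)] by blast
    qed
    have "continuous_map (subtopology W (bd s)) (subtopology Y (T s)) h"
      using continuous_map_from_subtopology_mono[OF h(1) bdB] hT
      by (auto simp: continuous_map_in_subtopology)
    from ext[OF s(1) this] obtain k where
      k: "continuous_map (subtopology W (cell s)) (subtopology Y (T s)) k" "\<And>x. x \<in> bd s \<Longrightarrow> k x = h x"
      by blast
    have overlap: "cell s \<inter> B \<subseteq> bd s"
    proof -
      have "cell s \<inter> cell t \<subseteq> bd s" if "t \<in> G" for t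
        using inter[OF s(1) G'[OF that]] smax[OF G'[OF that]] that G(2) by blast
      then show ?thesis using inter_L[OF s(1)] unfolding B_def by blast
    qed
    define h' where "h' x = (if x \<in> cell s then k x else h x)" for x
    let ?W = "subtopology W (cell s \<union> B)"
    have c1: "continuous_map ?W Y h'"
      unfolding h'_def
    proof (rule continuous_map_if_closed)
      show "closedin ?W (cell s)" "closedin ?W B"
        using closed[OF s(1)] closedB by (auto intro: closedin_subset_topspace)
      show "continuous_map (subtopology ?W (cell s)) Y k"
        using k(1) by (auto simp: subtopology_subtopology continuous_map_in_subtopology Int_absorb1)
      show "continuous_map (subtopology ?W B) Y h"
        using h(1) by (auto simp: subtopology_subtopology Int_absorb1)
    qed (use k overlap in auto)
    have c2: "cell s \<union> B = L \<union> \<Union>(cell ` F)"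
      using G by (auto simp: B_def)
    have c3: "h' x = f x" if "x \<in> L" for x
      using that h(2) inter_L[OF s(1)] k(2) by (auto simp: h'_def)
    have c4: "h' x \<in> T t" if "t \<in> F" "x \<in> cell t" for t x
    proof (cases "x \<in> cell s")
      case True
      then have kx: "k x \<in> T s"
        using continuous_map_image_subset_topspace[OF k(1)] closedin_subset[OF closed[OF s(1)]] by auto
      show ?thesis
      proof (cases "t = s")
        case False
        then have "x \<in> bd s" using inter[OF s(1) that(1)] smax that True by auto
        then show ?thesis using True k(2) h(3) False that G by (auto simp: h'_def)
      qed (use kx True in \<open>auto simp: h'_def\<close>)
    next
      case False
      then show ?thesis using that h(3) G by (auto simp: h'_def)
    qed
    show ?thesis
      using c1 c3 c4 unfolding c2 by blast
  qed
qed

section \<open>The cubical grid\<close>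

lemma topspace_unit_cube:
  "topspace (unit_cube n) = {x. (\<forall>i\<ge>n. x i = 0) \<and> (\<forall>i<n. 0 \<le> x i \<and> x i \<le> 1)}"
  by (auto simp: unit_cube_def topspace_Euclidean_space)

lemma Euclidean_space_eq_top_of_set: "Euclidean_space n = top_of_set {x. \<forall>i\<ge>n. x i = 0}"
  by (simp add: Euclidean_space_def euclidean_product_topology)

lemma unit_cube_eq_top_of_set: "unit_cube n = top_of_set (topspace (unit_cube n))"
  unfolding unit_cube_def Euclidean_space_eq_top_of_set by (simp add: subtopology_subtopology)

lemma continuous_on_coordinate [continuous_intros]:
  fixes S :: "(nat \<Rightarrow> real) set"
  shows "continuous_on S (\<lambda>x. x i)"
  by (rule continuous_on_product_then_coordinatewise) (rule continuous_on_id)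

lemma closed_unit_cube: "closed (topspace (unit_cube n))"
  unfolding topspace_unit_cube
  by (intro closed_Collect_conj closed_Collect_all closed_Collect_imp open_Collect_const
      closed_Collect_eq closed_Collect_le continuous_intros continuous_on_id)

lemma compact_unit_cube: "compact (topspace (unit_cube n))"
proof -
  have "compactin (powertop_real UNIV) (\<Pi>\<^sub>E i\<in>UNIV. {0..1})"
    by (simp add: compactin_PiE)
  then have "compact (\<Pi>\<^sub>E i\<in>(UNIV::nat set). {0..1::real})"
    by (simp add: euclidean_product_topology)
  moreover have "topspace (unit_cube n) \<subseteq> (\<Pi>\<^sub>E i\<in>UNIV. {0..1})"
    unfolding topspace_unit_cube by (auto simp: PiE_UNIV_domain) (metis le_less_linear zero_le_one order_refl)+
  ultimately show ?thesis
    using closed_unit_cube compact_Int_closed by (metis inf.absorb2)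
qed

text \<open>
  The grid of mesh \<open>1 / N\<close>: in direction \<open>i\<close> the cell \<open>(a, J)\<close> is an interval starting at \<open>a i / N\<close>
  if \<open>i \<in> J\<close>, and the point \<open>a i / N\<close> otherwise. Its dimension is the cardinality of \<open>J\<close>.
\<close>
definition grid_cell :: "nat \<Rightarrow> (nat \<Rightarrow> nat) \<times> nat set \<Rightarrow> (nat \<Rightarrow> real) set" where
  "grid_cell N = (\<lambda>(a, J). {x. \<forall>i. if i \<in> J then real (a i) \<le> N * x i \<and> N * x i \<le> real (a i) + 1
                                      else N * x i = a i})"

definition grid_cell_boundary :: "nat \<Rightarrow> (nat \<Rightarrow> nat) \<times> nat set \<Rightarrow> (nat \<Rightarrow> real) set" where
  "grid_cell_boundary N = (\<lambda>(a, J). {x \<in> grid_cell N (a, J). \<exists>i\<in>J. N * x i = a i \<or> N * x i = real (a i) + 1})"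

definition grid :: "nat \<Rightarrow> nat \<Rightarrow> ((nat \<Rightarrow> nat) \<times> nat set) set" where
  "grid n N = {(a, J). J \<subseteq> {..<n} \<and> (\<forall>i\<in>J. a i < N) \<and> (\<forall>i. a i \<le> N) \<and> (\<forall>i\<ge>n. a i = 0)}"

lemma finite_grid: "finite (grid n N)"
proof (rule finite_subset)
  show "grid n N \<subseteq> {a. \<forall>i. (i \<in> {..<n} \<longrightarrow> a i \<in> {..N}) \<and> (i \<notin> {..<n} \<longrightarrow> a i = 0)} \<times> Pow {..<n}"
    by (auto simp: grid_def)
  show "finite ({a. \<forall>i. (i \<in> {..<n} \<longrightarrow> a i \<in> {..N}) \<and> (i \<notin> {..<n} \<longrightarrow> a i = (0::nat))} \<times> Pow {..<n})"
    by (intro finite_cartesian_product finite_set_of_finite_funs) auto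
qed

lemma closed_grid_cell: "closed (grid_cell N s)"
proof (cases s)
  case (Pair a J)
  have "grid_cell N s = (\<Inter>i. if i \<in> J then {x::nat \<Rightarrow> real. real (a i) \<le> real N * x i} \<inter> {x::nat \<Rightarrow> real. real N * x i \<le> real (a i) + 1}
          else {x::nat \<Rightarrow> real. real N * x i = real (a i)})"
    unfolding grid_cell_def Pair by (auto split: if_splits)
  moreover have "closed ..."
  proof (intro closed_INT ballI)
    fix i
    have "closed ({x::nat \<Rightarrow> real. real (a i) \<le> real N * x i} \<inter> {x::nat \<Rightarrow> real. real N * x i \<le> real (a i) + 1})"
        "closed {x::nat \<Rightarrow> real. real N * x i = real (a i)}"
      by (auto intro!: closed_Int closed_Collect_eq closed_Collect_le continuous_on_mult)
    then show "closed (if i \<in> J then {x::nat \<Rightarrow> real. real (a i) \<le> real N * x i} \<inter> {x::nat \<Rightarrow> real. real N * x i \<le> real (a i) + 1}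
          else {x::nat \<Rightarrow> real. real N * x i = real (a i)})" by simp
  qed
  ultimately show ?thesis by simp
qed

lemma grid_cell_subset:
  assumes "s \<in> grid n N" "N > 0"
  shows "grid_cell N s \<subseteq> topspace (unit_cube n)"
proof
  fix x assume x: "x \<in> grid_cell N s"
  obtain a J where s: "s = (a, J)" by (cases s)
  have *: "if i \<in> J then real (a i) \<le> N * x i \<and> N * x i \<le> real (a i) + 1 else N * x i = a i" for i
    using x by (auto simp: grid_cell_def s)
  have J: "J \<subseteq> {..<n}" "\<And>i. i \<in> J \<Longrightarrow> a i < N" "\<And>i. a i \<le> N" "\<And>i. i \<ge> n \<Longrightarrow> a i = 0"
    using assms(1) by (auto simp: grid_def s)
  have "x i = 0" if "i \<ge> n" for i
    using *[of i] J(1) J(4)[OF that] that assms(2) by (auto split: if_splits)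
  moreover have "0 \<le> x i \<and> x i \<le> 1" for i
  proof -
    have "0 \<le> N * x i" using *[of i] by (auto split: if_splits)
    moreover have "N * x i \<le> N"
    proof (cases "i \<in> J")
      case True
      then have "real N * x i \<le> real (a i) + 1" "real (a i) + 1 \<le> real N"
        using *[of i] J(2)[OF True] by auto
      then show ?thesis by linarith
    next
      case False
      then have "real N * x i = real (a i)" using *[of i] by simp
      then show ?thesis using J(3)[of i] by linarith
    qed
    ultimately show ?thesis
      using assms(2) mult_le_cancel_left_pos[of "real N" "x i" 1] by (simp add: zero_le_mult_iff)
  qed
  ultimately show "x \<in> topspace (unit_cube n)" by (simp add: topspace_unit_cube)
qed

lemma grid_cell_boundary_subset: "grid_cell_boundary N s \<subseteq> grid_cell N s"
  by (auto simp: grid_cell_boundary_def split: prod.splits)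

lemma grid_cells_cover:
  assumes "x \<in> topspace (unit_cube n)" "N > 0"
  obtains s where "s \<in> grid n N" "x \<in> grid_cell N s"
proof -
  define a where "a i = (if i < n then min (N - 1) (nat \<lfloor>N * x i\<rfloor>) else 0)" for i
  have x: "\<And>i. i \<ge> n \<Longrightarrow> x i = 0" "\<And>i. i < n \<Longrightarrow> 0 \<le> x i" "\<And>i. i < n \<Longrightarrow> x i \<le> 1"
    using assms(1) by (auto simp: topspace_unit_cube)
  have "(a, {..<n}) \<in> grid n N"
    using assms(2) by (auto simp: grid_def a_def)
  moreover have "real (a i) \<le> N * x i \<and> N * x i \<le> real (a i) + 1" if "i < n" for i
  proof -
    have 1: "0 \<le> N * x i" "N * x i \<le> N"
      using x(2,3)[OF that] assms(2) by (auto simp: mult_le_cancel_left1)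
    show ?thesis
    proof (cases "nat \<lfloor>N * x i\<rfloor> \<le> N - 1")
      case True
      then have "a i = nat \<lfloor>N * x i\<rfloor>" using that by (simp add: a_def)
      then show ?thesis using 1 by (simp add: of_nat_nat)
    next
      case False
      then have "a i = N - 1" using that by (simp add: a_def)
      moreover have "int N \<le> \<lfloor>N * x i\<rfloor>" using False by linarith
      then have "real N \<le> N * x i" by (simp add: le_floor_iff)
      ultimately show ?thesis using 1 assms(2) by (simp add: of_nat_diff)
    qed
  qed
  then have "x \<in> grid_cell N (a, {..<n})"
    using x(1) by (auto simp: grid_cell_def a_def)
  ultimately show ?thesis using that by blast
qed

lemma grid_cell_boundary_faces:
  assumes "s \<in> grid n N" "x \<in> grid_cell_boundary N s"
  shows "\<exists>t\<in>grid n N. card (snd t) < card (snd s) \<and> grid_cell N t \<subseteq> grid_cell N s \<and> x \<in> grid_cell N t"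
proof -
  obtain a J where s: "s = (a, J)" by (cases s)
  obtain i where i: "i \<in> J" "N * x i = a i \<or> N * x i = real (a i) + 1"
    using assms(2) by (auto simp: grid_cell_boundary_def s)
  have xs: "x \<in> grid_cell N s" using assms(2) grid_cell_boundary_subset by blast
  define a' where "a' = (if N * x i = a i then a else a(i := a i + 1))"
  define t where "t = (a', J - {i})"
  have J: "J \<subseteq> {..<n}" "\<And>i. i \<in> J \<Longrightarrow> a i < N" "\<And>i. a i \<le> N" "\<And>i. i \<ge> n \<Longrightarrow> a i = 0"
    using assms(1) by (auto simp: grid_def s)
  have "t \<in> grid n N"
    using J i by (auto simp: grid_def t_def a'_def Suc_leI)
  moreover have "card (snd t) < card (snd s)"
    unfolding t_def s snd_conv using i(1) J(1) by (meson card_Diff1_less finite_lessThan finite_subset)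
  moreover have "grid_cell N t \<subseteq> grid_cell N s"
  proof
    fix y assume y: "y \<in> grid_cell N t"
    have "if j \<in> J then real (a j) \<le> N * y j \<and> N * y j \<le> real (a j) + 1 else N * y j = a j" for j
    proof -
      have yj: "if j \<in> J - {i} then real (a' j) \<le> N * y j \<and> N * y j \<le> real (a' j) + 1 else N * y j = a' j"
        using y by (auto simp: grid_cell_def t_def)
      show ?thesis
      proof (cases "j = i")
        case True
        then show ?thesis using yj i(1) by (auto simp: a'_def split: if_splits)
      next
        case False
        then have "a' j = a j" by (simp add: a'_def)
        then show ?thesis using yj False by auto
      qed
    qed
    then show "y \<in> grid_cell N s" by (auto simp: grid_cell_def s)
  qed
  moreover have "x \<in> grid_cell N t"
    using xs i unfolding grid_cell_def t_def s a'_def by (auto split: if_splits)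
  ultimately show ?thesis by blast
qed

text \<open>
  A point in the relative interior of a cell determines the cell among all cells of at most the same
  dimension: its coordinates in the interval directions are not multiples of \<open>1 / N\<close>.
\<close>
lemma grid_cells_inter:
  assumes "s \<in> grid n N" "t \<in> grid n N" "s \<noteq> t" "card (snd t) \<le> card (snd s)"
  shows "grid_cell N s \<inter> grid_cell N t \<subseteq> grid_cell_boundary N s"
proof
  fix x assume x: "x \<in> grid_cell N s \<inter> grid_cell N t"
  obtain a J b K where s: "s = (a, J)" and t: "t = (b, K)" by (cases s, cases t)
  have xs: "if i \<in> J then real (a i) \<le> N * x i \<and> N * x i \<le> real (a i) + 1 else N * x i = a i" 
   and xt: "if i \<in> K then real (b i) \<le> N * x i \<and> N * x i \<le> real (b i) + 1 else N * x i = b i" for i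
    using x by (auto simp: grid_cell_def s t)
  show "x \<in> grid_cell_boundary N s"
  proof (rule ccontr)
    assume "x \<notin> grid_cell_boundary N s"
    then have J: "real (a i) < N * x i \<and> N * x i < real (a i) + 1" if "i \<in> J" for i
      using x xs[of i] that by (force simp: grid_cell_boundary_def s)
    have JK: "J \<subseteq> K"
    proof
      fix i assume "i \<in> J" then show "i \<in> K"
        using J[of i] xt[of i] by (auto split: if_splits)
    qed
    have "finite K" using assms(2) by (auto simp: grid_def t intro: finite_subset)
    then have "J = K" using JK assms(4) by (simp add: card_seteq s t)
    moreover have "a i = b i" for i
      using xs[of i] xt[of i] J[of i] \<open>J = K\<close> by (auto split: if_splits)
    ultimately show False using assms(3) by (auto simp: s t)
  qed
qed

lemma grid_cell_inter_cube_boundary: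
  assumes "s \<in> grid n N" "\<not> grid_cell N s \<subseteq> cube_boundary n" "N > 0"
  shows "grid_cell N s \<inter> cube_boundary n \<subseteq> grid_cell_boundary N s"
proof
  fix x assume x: "x \<in> grid_cell N s \<inter> cube_boundary n"
  obtain a J where s: "s = (a, J)" by (cases s)
  have xs: "if i \<in> J then real (a i) \<le> N * x i \<and> N * x i \<le> real (a i) + 1 else N * x i = a i" for i
    using x by (auto simp: grid_cell_def s)
  obtain i where i: "i < n" "x i = 0 \<or> x i = 1"
    using x by (auto simp: cube_boundary_def)
  have aN: "i \<in> J \<Longrightarrow> a i < N" using assms(1) by (auto simp: grid_def s)
  show "x \<in> grid_cell_boundary N s"
  proof (cases "i \<in> J")
    case True
    then have "N * x i = a i \<or> N * x i = real (a i) + 1"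
      using xs[of i] aN i(2) by auto
    then show ?thesis using True x by (auto simp: grid_cell_boundary_def s)
  next
    case False
    then have ai: "real N * x i = a i" using xs[of i] by simp
    have "grid_cell N s \<subseteq> cube_boundary n"
    proof
      fix y assume y: "y \<in> grid_cell N s"
      then have "real N * y i = a i" using False by (force simp: grid_cell_def s)
      then have "real N * y i = real N * x i" using ai by simp
      then have "y i = x i" using assms(3) by simp
      then show "y \<in> cube_boundary n"
        using i y grid_cell_subset[OF assms(1,3)] by (auto simp: cube_boundary_def)
    qed
    then show ?thesis using assms(2) by blast
  qed
qed

lemma continuous_on_Max_image:
  fixes f :: "'i \<Rightarrow> 'q::topological_space \<Rightarrow> real"
  assumes "finite J" "J \<noteq> {}" "\<And>i. i \<in> J \<Longrightarrow> continuous_on S (f i)"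
  shows "continuous_on S (\<lambda>x. Max ((\<lambda>i. f i x) ` J))"
  using assms by (induction J rule: finite_ne_induct) (auto intro!: continuous_on_max)

text \<open>
  Radial projection of a box to its boundary is taken with respect to the maximum norm of the
  coordinates \<open>u i x\<close>, rescaled so that the box becomes \<open>[-1, 1]^J\<close>.
\<close>
lemma grid_cell_extension:
  assumes s: "s \<in> grid n N" "N > 0"
    and Z: "contractible_space Z" "topspace Z \<noteq> {}"
    and f: "continuous_map (top_of_set (grid_cell_boundary N s)) Z f"
  shows "\<exists>h. continuous_map (top_of_set (grid_cell N s)) Z h \<and> (\<forall>x\<in>grid_cell_boundary N s. h x = f x)"
proof -
  obtain a J where sJ: "s = (a, J)" by (cases s)
  show ?thesis
  proof (cases "J = {}")
    case True
    then have "grid_cell_boundary N s = {}" by (auto simp: grid_cell_boundary_def sJ)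
    moreover obtain z where "z \<in> topspace Z" using Z(2) by blast
    ultimately show ?thesis by (intro exI[of _ "\<lambda>_. z"]) auto
  next
    case False
    have finJ: "finite J" using s(1) by (auto simp: grid_def sJ intro: finite_subset)
    define u where "u i x = 2 * (N * x i - real (a i)) - 1" for i and x :: "nat \<Rightarrow> real"
    define g where "g x = Max ((\<lambda>i. \<bar>u i x\<bar>) ` J)" for x
    define b where "b x = (\<lambda>i. if i \<in> J then (a i + (u i x / g x + 1) / 2) / N else x i)" for x
    let ?S = "grid_cell N s"
    have xS: "x \<in> ?S \<longleftrightarrow> (\<forall>i\<in>J. \<bar>u i x\<bar> \<le> 1) \<and> (\<forall>i. i \<notin> J \<longrightarrow> N * x i = a i)" for x :: "nat \<Rightarrow> real"
      by (force simp: grid_cell_def sJ u_def abs_le_iff)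
    have g_le: "g x \<le> c \<longleftrightarrow> (\<forall>i\<in>J. \<bar>u i x\<bar> \<le> c)" for x c
      unfolding g_def using finJ False by simp
    have g_ex: "\<exists>i\<in>J. g x = \<bar>u i x\<bar>" for x
    proof -
      have "g x \<in> (\<lambda>i. \<bar>u i x\<bar>) ` J"
        unfolding g_def by (rule Max_in) (use finJ False in auto)
      then show ?thesis by blast
    qed
    have bd: "grid_cell_boundary N s = {x \<in> ?S. g x = 1}"
    proof -
      have "(\<exists>i\<in>J. N * x i = a i \<or> N * x i = real (a i) + 1) \<longleftrightarrow> (\<exists>i\<in>J. \<bar>u i x\<bar> = 1)" for x :: "nat \<Rightarrow> real"
        by (rule bex_cong) (auto simp: u_def abs_if field_simps)
      moreover have "(\<exists>i\<in>J. \<bar>u i x\<bar> = 1) \<longleftrightarrow> g x = 1" if "x \<in> ?S" for x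
        using that g_ex[of x] g_le[of x "g x"] g_le[of x 1] unfolding xS by (metis order_antisym order_refl)
      ultimately show ?thesis by (auto simp: grid_cell_boundary_def sJ)
    qed
    have cont_u: "continuous_on A (u i)" for A i
      unfolding u_def by (intro continuous_intros continuous_on_id)
    have cont_g: "continuous_on A g" for A
      unfolding g_def using finJ False
      by (intro continuous_on_Max_image continuous_intros cont_u) auto
    have "\<exists>h. continuous_map (top_of_set ?S) Z h \<and> (\<forall>x\<in>topspace (top_of_set ?S). g x = 1 \<longrightarrow> h x = f x)"
    proof (rule contractible_space_cone_extension[OF Z])
      show "continuous_map (top_of_set ?S) euclideanreal g"
        using cont_g by simp
      show "\<And>x. x \<in> topspace (top_of_set ?S) \<Longrightarrow> g x \<le> 1"
        by (simp add: xS g_le)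
      show "continuous_map (subtopology (top_of_set ?S) {x. g x = 1}) Z f"
        using f by (simp add: bd subtopology_subtopology Int_def)
      show "b x = x" if "x \<in> topspace (top_of_set ?S)" "g x = 1" for x
        using that(2) s(2) by (intro ext) (auto simp: b_def u_def field_simps)
      have cont_b: "continuous_on {x \<in> ?S. 1 / 2 \<le> g x} b"
        unfolding b_def
      proof (rule continuous_on_coordinatewise_then_product)
        fix i
        have "continuous_on {x \<in> ?S. 1 / 2 \<le> g x} (\<lambda>x. (a i + (u i x / g x + 1) / 2) / N)"
          using s(2) by (intro continuous_intros cont_u cont_g) auto
        moreover have "continuous_on {x \<in> ?S. 1 / 2 \<le> g x} (\<lambda>x. x i)"
          by (rule continuous_on_coordinate)
        ultimately show "continuous_on {x \<in> ?S. 1 / 2 \<le> g x}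
            (\<lambda>x. if i \<in> J then (a i + (u i x / g x + 1) / 2) / N else x i)"
          by (cases "i \<in> J") simp_all
      qed
      have "b x \<in> ?S \<and> g (b x) = 1" if x: "x \<in> ?S" "1 / 2 \<le> g x" for x
      proof -
        have ub: "u i (b x) = u i x / g x" if "i \<in> J" for i
        proof -
          have *: "real N * b x i = a i + (u i x / g x + 1) / 2"
            using that s(2) by (simp add: b_def)
          have "u i (b x) = 2 * (real N * b x i - real (a i)) - 1"
            by (simp only: u_def)
          then show ?thesis
            unfolding * by (simp add: add_divide_distrib)
        qed
        have le: "\<bar>u i (b x)\<bar> \<le> 1" if "i \<in> J" for i
          using g_le[of x "g x"] that x(2) by (simp add: ub divide_le_eq)
        obtain i where "i \<in> J" "g x = \<bar>u i x\<bar>" using g_ex by blast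
        then have "\<bar>u i (b x)\<bar> = 1" using x(2) by (simp add: ub)
        then have "g (b x) = 1"
          using le g_le[of "b x" 1] g_le[of "b x" "g (b x)"] \<open>i \<in> J\<close> by (metis order_antisym order_refl)
        moreover have "b x \<in> ?S"
          using le x(1) unfolding xS by (auto simp: b_def)
        ultimately show ?thesis by blast
      qed
      with cont_b show "continuous_map (subtopology (top_of_set ?S) {x. 1 / 2 \<le> g x})
          (subtopology (top_of_set ?S) {x. g x = 1}) b"
        by (auto simp: subtopology_subtopology Int_def continuous_map_in_subtopology)
    qed
    then show ?thesis by (auto simp: bd)
  qed
qed

lemma cube_boundary_subset: "cube_boundary n \<subseteq> topspace (unit_cube n)"
  by (auto simp: cube_boundary_def)

lemma closed_cube_boundary: "closed (cube_boundary n)"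
proof -
  have "cube_boundary n = (\<Union>i<n. topspace (unit_cube n) \<inter> ({x. x i = 0} \<union> {x. x i = 1}))"
    by (auto simp: cube_boundary_def)
  moreover have "closed {x::nat \<Rightarrow> real. x i = c}" for i c
    by (auto intro!: closed_Collect_eq)
  ultimately show ?thesis
    by (auto intro!: closed_UN closed_Int closed_Un closed_unit_cube)
qed

lemma subtopology_unit_cube:
  "A \<subseteq> topspace (unit_cube n) \<Longrightarrow> subtopology (unit_cube n) A = top_of_set A"
  by (subst unit_cube_eq_top_of_set) (simp add: subtopology_subtopology Int_absorb1)

text \<open>
  Cells inside the boundary of the cube are not extended over, since the map is prescribed there;
  their condition on \<open>T\<close> is a hypothesis on the prescribed map.
\<close>
lemma extend_from_cube_boundary:
  assumes N: "N > 0"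
    and T: "\<And>s. s \<in> grid n N \<Longrightarrow> T s \<subseteq> topspace Y" "\<And>s. s \<in> grid n N \<Longrightarrow> T s \<noteq> {}"
      "\<And>s. s \<in> grid n N \<Longrightarrow> contractible_space (subtopology Y (T s))"
    and mono: "\<And>s t. \<lbrakk>s \<in> grid n N; t \<in> grid n N; grid_cell N t \<subseteq> grid_cell N s\<rbrakk> \<Longrightarrow> T t \<subseteq> T s"
    and f: "continuous_map (top_of_set (cube_boundary n)) Y f"
      "\<And>s x. \<lbrakk>s \<in> grid n N; x \<in> grid_cell N s; x \<in> cube_boundary n\<rbrakk> \<Longrightarrow> f x \<in> T s"
  shows "\<exists>h. continuous_map (unit_cube n) Y h \<and> (\<forall>x\<in>cube_boundary n. h x = f x)
           \<and> (\<forall>s\<in>grid n N. \<forall>x\<in>grid_cell N s. h x \<in> T s)"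
proof -
  let ?W = "unit_cube n" and ?L = "cube_boundary n"
  define F where "F = {s \<in> grid n N. \<not> grid_cell N s \<subseteq> ?L}"
  have F: "s \<in> grid n N" "\<not> grid_cell N s \<subseteq> ?L" if "s \<in> F" for s
    using that by (auto simp: F_def)
  note sub = grid_cell_subset[OF _ N]
  have "\<exists>h. continuous_map (subtopology ?W (?L \<union> \<Union>(grid_cell N ` F))) Y h \<and> (\<forall>x\<in>?L. h x = f x)
            \<and> (\<forall>s\<in>F. \<forall>x\<in>grid_cell N s. h x \<in> T s)"
  proof (rule extend_over_cells[where bd = "grid_cell_boundary N" and dm = "\<lambda>s. card (snd s)"])
    show "finite F" unfolding F_def using finite_grid by simp
    show "closedin ?W ?L"
      using closed_subset[OF cube_boundary_subset closed_cube_boundary] unit_cube_eq_top_of_set by metis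
    show "closedin ?W (grid_cell N s)" if "s \<in> F" for s
      using closed_subset[OF sub[OF F(1)[OF that]] closed_grid_cell] unit_cube_eq_top_of_set by metis
    show "grid_cell_boundary N s \<subseteq> grid_cell N s" for s
      by (rule grid_cell_boundary_subset)
    show "x \<in> ?L \<or> (\<exists>t\<in>F. card (snd t) < card (snd s) \<and> grid_cell N t \<subseteq> grid_cell N s \<and> x \<in> grid_cell N t)"
      if "s \<in> F" "x \<in> grid_cell_boundary N s" for s x
      using grid_cell_boundary_faces[OF F(1)[OF that(1)] that(2)] unfolding F_def by blast
    show "grid_cell N s \<inter> grid_cell N t \<subseteq> grid_cell_boundary N s"
      if "s \<in> F" "t \<in> F" "s \<noteq> t" "card (snd t) \<le> card (snd s)" for s t
      by (rule grid_cells_inter[OF F(1)[OF that(1)] F(1)[OF that(2)] that(3,4)])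
    show "grid_cell N s \<inter> ?L \<subseteq> grid_cell_boundary N s" if "s \<in> F" for s
      using grid_cell_inter_cube_boundary[OF F[OF that] N] .
    show "T t \<subseteq> T s" if "s \<in> F" "t \<in> F" "grid_cell N t \<subseteq> grid_cell N s" for s t
      by (rule mono[OF F(1)[OF that(1)] F(1)[OF that(2)] that(3)])
    show "continuous_map (subtopology ?W ?L) Y f"
      using f(1) subtopology_unit_cube[OF cube_boundary_subset] by simp
    show "f x \<in> T s" if "s \<in> F" "x \<in> ?L" "x \<in> grid_cell N s" for s x
      by (rule f(2)[OF F(1)[OF that(1)] that(3,2)])
    show "\<exists>h. continuous_map (subtopology ?W (grid_cell N s)) (subtopology Y (T s)) h
              \<and> (\<forall>x\<in>grid_cell_boundary N s. h x = g x)"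
      if "s \<in> F" "continuous_map (subtopology ?W (grid_cell_boundary N s)) (subtopology Y (T s)) g" for s g
    proof -
      note s = F(1)[OF that(1)]
      have "grid_cell_boundary N s \<subseteq> topspace ?W"
        using grid_cell_boundary_subset sub[OF s] by blast
      moreover have "topspace (subtopology Y (T s)) \<noteq> {}"
        using T(1,2)[OF s] by auto
      ultimately show ?thesis
        using grid_cell_extension[OF s N T(3)[OF s]] that(2) by (simp add: subtopology_unit_cube sub[OF s])
    qed
  qed
  then obtain h where h: "continuous_map (subtopology ?W (?L \<union> \<Union>(grid_cell N ` F))) Y h"
      "\<And>x. x \<in> ?L \<Longrightarrow> h x = f x" "\<And>s x. \<lbrakk>s \<in> F; x \<in> grid_cell N s\<rbrakk> \<Longrightarrow> h x \<in> T s"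
    by blast
  have "topspace ?W \<subseteq> ?L \<union> \<Union>(grid_cell N ` F)"
  proof
    fix x assume "x \<in> topspace ?W"
    then obtain s where "s \<in> grid n N" "x \<in> grid_cell N s" using grid_cells_cover N by metis
    then show "x \<in> ?L \<union> \<Union>(grid_cell N ` F)" unfolding F_def by blast
  qed
  then have "subtopology ?W (?L \<union> \<Union>(grid_cell N ` F)) = ?W"
    by (rule subtopology_superset)
  then have "continuous_map ?W Y h" using h(1) by simp
  moreover have "h x \<in> T s" if "s \<in> grid n N" "x \<in> grid_cell N s" for s x
  proof (cases "s \<in> F")
    case False
    then have "x \<in> ?L" using that unfolding F_def by blast
    then show ?thesis using h(2) f(2)[OF that] by simp
  qed (use h(3) that in blast)
  ultimately show ?thesis using h(2) by blast
qed

text \<open>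
  The metric of the function space is the sum of the truncated coordinate distances with weights
  \<open>1, 1 / 2, 1 / 4, \<dots>\<close>, which add up to 2.
\<close>
lemma dist_grid_cell:
  assumes "x \<in> grid_cell N s" "y \<in> grid_cell N s" "N > 0"
  shows "dist x y \<le> 2 / N"
proof -
  obtain a J where s: "s = (a, J)" by (cases s)
  have *: "dist (x i) (y i) \<le> 1 / N" for i
  proof -
    have "if i \<in> J then real (a i) \<le> N * x i \<and> N * x i \<le> real (a i) + 1 else N * x i = a i"
     "if i \<in> J then real (a i) \<le> N * y i \<and> N * y i \<le> real (a i) + 1 else N * y i = a i"
      using assms(1,2) by (auto simp: grid_cell_def s)
    then have "\<bar>N * x i - N * y i\<bar> \<le> 1" by (auto split: if_splits)
    then have "N * \<bar>x i - y i\<bar> \<le> 1"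
      by (simp flip: right_diff_distrib add: abs_mult)
    then show ?thesis using assms(3) by (simp add: dist_real_def field_simps)
  qed
  have "dist x y = (\<Sum>n. (1/2)^n * min (dist (x (from_nat n)) (y (from_nat n))) 1)"
    by (simp add: dist_fun_def)
  also have "\<dots> \<le> (\<Sum>n. (1/2)^n * (1 / real N))"
  proof (rule suminf_le)
    show "(1/2)^n * min (dist (x (from_nat n)) (y (from_nat n))) 1 \<le> (1/2)^n * (1 / real N)" for n
      using *[of "from_nat n"] by (intro mult_left_mono) auto
    show "summable (\<lambda>n. (1/2)^n * (1 / real N))"
      by (intro summable_mult2) simp
    show "summable (\<lambda>n. (1/2)^n * min (dist (x (from_nat n)) (y (from_nat n))) 1)"
      by (rule summable_comparison_test'[of "\<lambda>n. (1/2)^n"]) (auto simp: abs_mult mult_le_cancel_left1)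
  qed
  also have "\<dots> = 2 * (1 / real N)"
    by (subst suminf_mult2[symmetric]) (simp_all add: suminf_geometric)
  finally show ?thesis by simp
qed

lemma grid_cell_nonempty: "grid_cell N s \<noteq> {}" if "N > 0"
proof -
  obtain a J where s: "s = (a, J)" by (cases s)
  have "(\<lambda>i. a i / N) \<in> grid_cell N s" using that by (auto simp: grid_cell_def s)
  then show ?thesis by blast
qed

text \<open>
  The projection of an \<open>n + 1\<close>-dimensional grid to the first \<open>n\<close> coordinates is cellular; it is used
  to carry labels of cells of a cube over to cells of the cylinder on that cube.
\<close>
definition drop_coordinate :: "nat \<Rightarrow> (nat \<Rightarrow> nat) \<times> nat set \<Rightarrow> (nat \<Rightarrow> nat) \<times> nat set" where
  "drop_coordinate n = (\<lambda>(a, J). (a(n := 0), J - {n}))"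

lemma drop_coordinate_grid: "s \<in> grid (Suc n) N \<Longrightarrow> drop_coordinate n s \<in> grid n N"
proof -
  assume "s \<in> grid (Suc n) N"
  moreover obtain a J where "s = (a, J)" by (cases s)
  ultimately have J: "J \<subseteq> {..<Suc n}" "\<And>i. i \<in> J \<Longrightarrow> a i < N" "\<And>i. a i \<le> N" "\<And>i. i \<ge> Suc n \<Longrightarrow> a i = 0"
    and s: "s = (a, J)"
    by (auto simp: grid_def)
  have "(a(n := 0)) i = 0" if "i \<ge> n" for i
    using J(4)[of i] that by (cases "i = n") auto
  moreover have "J - {n} \<subseteq> {..<n}"
    using J(1) by (auto simp: less_Suc_eq)
  ultimately show ?thesis
    using J(2,3) by (simp add: grid_def drop_coordinate_def s)
qed

lemma drop_coordinate_cell: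
  "x \<in> grid_cell N s \<Longrightarrow> x(n := 0) \<in> grid_cell N (drop_coordinate n s)"
  by (auto simp: grid_cell_def drop_coordinate_def split: prod.splits)

lemma drop_coordinate_mono:
  assumes "grid_cell N t \<subseteq> grid_cell N s" "N > 0"
  shows "grid_cell N (drop_coordinate n t) \<subseteq> grid_cell N (drop_coordinate n s)"
proof
  fix y assume y: "y \<in> grid_cell N (drop_coordinate n t)"
  obtain a J where t: "t = (a, J)" by (cases t)
  have yi: "if i \<in> J - {n} then real ((a(n := 0)) i) \<le> N * y i \<and> N * y i \<le> real ((a(n := 0)) i) + 1
      else N * y i = (a(n := 0)) i" for i
    using y unfolding t drop_coordinate_def grid_cell_def prod.case mem_Collect_eq by (rule spec)
  have "(if i \<in> J then real (a i) \<le> N * (y(n := a n / N)) i \<and> N * (y(n := a n / N)) i \<le> real (a i) + 1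
      else N * (y(n := a n / N)) i = a i)" for i
    using yi[of i] assms(2) by (cases "i = n") auto
  then have "y(n := a n / N) \<in> grid_cell N t"
    unfolding t grid_cell_def prod.case mem_Collect_eq by blast
  then have "(y(n := a n / N))(n := 0) \<in> grid_cell N (drop_coordinate n s)"
    using assms(1) drop_coordinate_cell by blast
  moreover have "y n = 0" using yi[of n] assms(2) by simp
  ultimately show "y \<in> grid_cell N (drop_coordinate n s)" by (simp add: fun_upd_idem)
qed

section \<open>Lifting maps of cubes through a map to a finite poset\<close>

text \<open>
  The contraction stays at the identity until the last moment and then jumps: this is continuous,
  as every open set containing the target is everything.
\<close>
lemma contractible_space_focal_point:
  assumes e: "e \<in> topspace U" and focal: "\<And>W. \<lbrakk>openin U W; e \<in> W\<rbrakk> \<Longrightarrow> W = topspace U"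
  shows "contractible_space U"
proof -
  define h where "h z = (if fst z < 1 then snd z else e)" for z :: "real \<times> 'a"
  let ?IU = "prod_topology (top_of_set {0..1::real}) U"
  have "continuous_map ?IU U h"
    unfolding continuous_map_def
  proof (intro conjI allI impI)
    show "h \<in> topspace ?IU \<rightarrow> topspace U"
      using e by (auto simp: h_def)
    fix W assume W: "openin U W"
    show "openin ?IU {z \<in> topspace ?IU. h z \<in> W}"
    proof (cases "e \<in> W")
      case True
      then have "W = topspace U" by (rule focal[OF W])
      then have "{z \<in> topspace ?IU. h z \<in> W} = topspace ?IU"
        using e by (auto simp: h_def)
      then show ?thesis by (metis openin_topspace)
    next
      case False
      then have "{z \<in> topspace ?IU. h z \<in> W} = {0..<1} \<times> W"
        using openin_subset[OF W] by (auto simp: h_def split: if_splits)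
      moreover have "openin (top_of_set {0..1}) {0..<1::real}"
      proof -
        have "{0..<1} = {0..1} \<inter> {..<1::real}" by auto
        then show ?thesis using openin_open_Int by (metis open_lessThan)
      qed
      ultimately show ?thesis
        using W by (simp add: openin_prod_Times_iff)
    qed
  qed
  then show ?thesis
    unfolding contractible_space_def homotopic_with_def
    by (intro exI[of _ e] exI[of _ h]) (auto simp: h_def)
qed

lemma contractible_poset_down_set:
  assumes "e \<in> P" "r e e"
  shows "contractible_space (subtopology (poset_topology P r) {x \<in> P. r x e})"
proof (rule contractible_space_focal_point)
  show "e \<in> topspace (subtopology (poset_topology P r) {x \<in> P. r x e})"
    using assms by simp
  fix W assume W: "openin (subtopology (poset_topology P r) {x \<in> P. r x e}) W" "e \<in> W"
  then obtain V where V: "openin (poset_topology P r) V" "W = V \<inter> {x \<in> P. r x e}"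
    unfolding openin_subtopology by blast
  have "{x \<in> P. r x e} \<subseteq> V"
    using V(1) W(2) unfolding V(2) openin_poset_topology by blast
  then show "W = topspace (subtopology (poset_topology P r) {x \<in> P. r x e})"
    using V(2) by auto
qed

lemma prod_interval_unit_cube:
  "prod_topology (top_of_set {0..1::real}) (unit_cube n) = top_of_set ({0..1} \<times> topspace (unit_cube n))"
  by (metis prod_topology_subtopology_eu unit_cube_eq_top_of_set)

lemma continuous_map_unit_cube_Suc:
  "continuous_map (prod_topology (top_of_set {0..1::real}) (unit_cube n)) (unit_cube (Suc n)) (\<lambda>z. (snd z)(n := fst z))"
proof -
  let ?IQ = "{0..1::real} \<times> topspace (unit_cube n)"
  have "continuous_on ?IQ (\<lambda>z. (snd z)(n := fst z))"
  proof (rule continuous_on_coordinatewise_then_product)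
    show "continuous_on ?IQ (\<lambda>z. ((snd z)(n := fst z)) i)" for i
      using continuous_on_product_then_coordinatewise[OF continuous_on_snd[OF continuous_on_id], of ?IQ i]
      by (cases "i = n") (auto intro!: continuous_on_fst continuous_on_id)
  qed
  moreover have "(snd z)(n := fst z) \<in> topspace (unit_cube (Suc n))" if "z \<in> ?IQ" for z
    using that by (auto simp: topspace_unit_cube less_Suc_eq)
  ultimately show ?thesis
    unfolding prod_interval_unit_cube
    by (subst unit_cube_eq_top_of_set) (auto simp: continuous_map_in_subtopology)
qed

text \<open>
  The heart of the matter: a relative lifting property. On a fine grid let \<open>c s\<close> be the label of the
  cell \<open>s\<close>. The lift \<open>\<alpha>'\<close> is constructed cell by cell, mapping \<open>s\<close> to the points \<open>x\<close> with \<open>m x\<close> below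
  \<open>c s\<close>, a contractible set. Then both \<open>m \<circ> \<alpha>'\<close> and \<open>\<beta>\<close> map \<open>s\<close> to the elements below \<open>c s\<close>, and these
  also form a contractible set, so that a homotopy between the two maps can be constructed in the
  same way over the grid of the cylinder.
\<close>
lemma lift_up_to_homotopy:
  assumes "finite_poset P r"
    and m: "continuous_map X (poset_topology P r) m"
    and down: "\<forall>e\<in>P. contractible_space (subtopology X {x \<in> topspace X. r (m x) e})"
      "\<forall>e\<in>P. {x \<in> topspace X. r (m x) e} \<noteq> {}"
    and \<alpha>: "continuous_map (top_of_set (cube_boundary n)) X \<alpha>"
    and \<beta>: "continuous_map (unit_cube n) (poset_topology P r) \<beta>"
    and \<alpha>\<beta>: "\<And>x. x \<in> cube_boundary n \<Longrightarrow> m (\<alpha> x) = \<beta> x"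
  obtains \<alpha>' h where "continuous_map (unit_cube n) X \<alpha>'" "\<And>x. x \<in> cube_boundary n \<Longrightarrow> \<alpha>' x = \<alpha> x"
    "continuous_map (prod_topology (top_of_set {0..1::real}) (unit_cube n)) (poset_topology P r) h"
    "\<And>x. x \<in> topspace (unit_cube n) \<Longrightarrow> h (0, x) = m (\<alpha>' x)"
    "\<And>x. x \<in> topspace (unit_cube n) \<Longrightarrow> h (1, x) = \<beta> x"
    "\<And>t x. \<lbrakk>0 \<le> t; t \<le> 1; x \<in> cube_boundary n\<rbrakk> \<Longrightarrow> h (t, x) = \<beta> x"
proof -
  interpret finite_poset P r by fact
  let ?Q = "topspace (unit_cube n)" and ?B = "cube_boundary n" and ?B' = "cube_boundary (Suc n)"
  have mP: "m x \<in> P" if "x \<in> topspace X" for x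
    using m that by (auto simp: continuous_map_def)
  have \<beta>P: "\<beta> x \<in> P" if "x \<in> ?Q" for x
    using \<beta> that by (auto simp: continuous_map_def)
  have BQ: "?B \<subseteq> ?Q" by (rule cube_boundary_subset)
  have \<alpha>X: "\<alpha> x \<in> topspace X" if "x \<in> ?B" for x
    using \<alpha> that by (auto simp: continuous_map_def)
  have "continuous_map (top_of_set ?Q) (poset_topology P r) \<beta>"
    using \<beta> unit_cube_eq_top_of_set by metis
  then obtain \<delta> l where \<delta>: "\<delta> > 0" and l: "small_set_labelling P r ?Q \<beta> 1 \<delta> l"
    using label_small_sets[OF assms(1) compact_unit_cube, of n \<beta> 1] by auto
  obtain N :: nat where N: "N > 0" "2 / N < \<delta>"
  proof -
    obtain N :: nat where "2 / \<delta> < N" using reals_Archimedean2 by blast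
    moreover from this have "N > 0"
      using \<delta> by (metis divide_nonneg_pos not_gr_zero not_less of_nat_0 zero_le_numeral)
    ultimately show ?thesis using that[of N] \<delta> by (simp add: field_simps)
  qed
  have small: "dist x y < \<delta>" if "x \<in> grid_cell N s" "y \<in> grid_cell N s" for x y s
    using dist_grid_cell[OF that N(1)] N(2) by linarith
  define c where "c s = l (grid_cell N s)" for s
  have cP: "c s \<in> P" and \<beta>c: "\<And>x. x \<in> grid_cell N s \<Longrightarrow> r (\<beta> x) (c s)"
    and c_mono: "\<And>t. grid_cell N t \<subseteq> grid_cell N s \<Longrightarrow> r (c t) (c s)"
    if "s \<in> grid n N" for s
    using small_set_labellingD[OF l grid_cell_subset[OF that N(1)] grid_cell_nonempty[OF N(1)] small[where s = s]]
      grid_cell_nonempty[OF N(1)] unfolding c_def by blast+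
  have "\<exists>h. continuous_map (unit_cube n) X h \<and> (\<forall>x\<in>?B. h x = \<alpha> x)
      \<and> (\<forall>s\<in>grid n N. \<forall>x\<in>grid_cell N s. h x \<in> {x \<in> topspace X. r (m x) (c s)})"
  proof (rule extend_from_cube_boundary[OF N(1) _ bspec[OF down(2)] bspec[OF down(1)] _ \<alpha>])
    show "{x \<in> topspace X. r (m x) (c t)} \<subseteq> {x \<in> topspace X. r (m x) (c s)}"
      if "s \<in> grid n N" "t \<in> grid n N" "grid_cell N t \<subseteq> grid_cell N s" for s t
      using trans[OF mP cP[OF that(2)] cP[OF that(1)] _ c_mono[OF that(1,3)]] by blast
    show "\<alpha> x \<in> {x \<in> topspace X. r (m x) (c s)}"
      if "s \<in> grid n N" "x \<in> grid_cell N s" "x \<in> ?B" for s x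
      using \<alpha>X[OF that(3)] \<alpha>\<beta>[OF that(3)] \<beta>c[OF that(1,2)] by simp
  qed (use cP in auto)
  then obtain \<alpha>' where \<alpha>': "continuous_map (unit_cube n) X \<alpha>'" "\<And>x. x \<in> ?B \<Longrightarrow> \<alpha>' x = \<alpha> x"
      "\<And>s x. \<lbrakk>s \<in> grid n N; x \<in> grid_cell N s\<rbrakk> \<Longrightarrow> r (m (\<alpha>' x)) (c s)"
    by blast
  \<comment> \<open>The cylinder on the cube is the cube of the next dimension, its last coordinate being time. On
    the boundary the homotopy is prescribed: \<open>m \<circ> \<alpha>'\<close> on the bottom \<open>A\<close>, and \<open>\<beta>\<close> on the top and
    the sides \<open>A'\<close>.\<close>
  define A where "A = ?B' \<inter> {y. y n = 0}"
  define A' where "A' = ?B' \<inter> ({y. y n = 1} \<union> (\<Union>i<n. {y. y i = 0} \<union> {y. y i = 1}))"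
  define f where "f y = (if y \<in> A then m (\<alpha>' y) else \<beta> (y(n := 0)))" for y
  have Q': "y(n := 0) \<in> ?Q" if "y \<in> topspace (unit_cube (Suc n))" for y
    using that by (auto simp: topspace_unit_cube)
  have B'Q': "?B' \<subseteq> topspace (unit_cube (Suc n))" by (rule cube_boundary_subset)
  have AA': "?B' = A \<union> A'"
    unfolding A_def A'_def by (auto simp: cube_boundary_def less_Suc_eq)
  have n0: "y(n := 0) = y" if "y \<in> A" for y
    using that by (auto simp: A_def)
  have AQ: "A \<subseteq> ?Q"
  proof
    fix y assume y: "y \<in> A"
    then have "y(n := 0) \<in> ?Q" using Q' B'Q' by (auto simp: A_def)
    then show "y \<in> ?Q" using n0[OF y] by simp
  qed
  have A'Q': "A' \<subseteq> topspace (unit_cube (Suc n))" using B'Q' by (auto simp: A'_def)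
  have cont_drop: "continuous_on S (\<lambda>y. y(n := 0))" for S :: "(nat \<Rightarrow> real) set"
  proof (rule continuous_on_coordinatewise_then_product)
    show "continuous_on S (\<lambda>y. (y(n := 0)) i)" for i
      by (cases "i = n") (auto intro!: continuous_on_coordinate)
  qed
  have cl: "closed {y::nat \<Rightarrow> real. y i = b}" for i b
    by (auto intro!: closed_Collect_eq)
  have "closed A" "closed A'"
    unfolding A_def A'_def by (intro closed_Int closed_Un closed_UN closed_cube_boundary cl ballI finite_lessThan)+
  have "continuous_map (top_of_set ?B') (poset_topology P r) f"
    unfolding f_def
  proof (rule continuous_map_if_closed)
    show "closedin (top_of_set ?B') A" "closedin (top_of_set ?B') A'"
      using \<open>closed A\<close> \<open>closed A'\<close> AA' by (auto intro: closed_subset)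
    have "continuous_map (top_of_set A) (unit_cube n) id"
      using AQ by (subst unit_cube_eq_top_of_set) (auto simp: continuous_map_in_subtopology)
    from continuous_map_compose[OF continuous_map_compose[OF this \<alpha>'(1)] m]
    show "continuous_map (subtopology (top_of_set ?B') A) (poset_topology P r) (\<lambda>y. m (\<alpha>' y))"
      using AA' by (simp add: subtopology_subtopology Int_absorb1 o_def)
    have "continuous_map (top_of_set A') (unit_cube n) (\<lambda>y. y(n := 0))"
      using cont_drop Q' A'Q' by (subst unit_cube_eq_top_of_set) (auto simp: continuous_map_in_subtopology)
    from continuous_map_compose[OF this \<beta>]
    show "continuous_map (subtopology (top_of_set ?B') A') (poset_topology P r) (\<lambda>y. \<beta> (y(n := 0)))"
      using AA' by (simp add: subtopology_subtopology Int_absorb1 o_def)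
    show "m (\<alpha>' y) = \<beta> (y(n := 0))" if "y \<in> A" "y \<in> A'" for y
    proof -
      have "y \<in> ?B" using that AQ by (auto simp: A_def A'_def cube_boundary_def)
      then show ?thesis using \<alpha>'(2) \<alpha>\<beta> n0[OF that(1)] by simp
    qed
  qed (simp add: AA')
  have "\<exists>h. continuous_map (unit_cube (Suc n)) (poset_topology P r) h \<and> (\<forall>x\<in>?B'. h x = f x)
      \<and> (\<forall>s\<in>grid (Suc n) N. \<forall>x\<in>grid_cell N s. h x \<in> {p \<in> P. r p (c (drop_coordinate n s))})"
  proof (rule extend_from_cube_boundary[OF N(1)])
    fix s assume s: "s \<in> grid (Suc n) N"
    note s' = drop_coordinate_grid[OF s]
    show "{p \<in> P. r p (c (drop_coordinate n s))} \<subseteq> topspace (poset_topology P r)" by auto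
    show "{p \<in> P. r p (c (drop_coordinate n s))} \<noteq> {}"
      using cP[OF s'] refl by blast
    show "contractible_space (subtopology (poset_topology P r) {p \<in> P. r p (c (drop_coordinate n s))})"
      using cP[OF s'] refl by (intro contractible_poset_down_set)
    show "{p \<in> P. r p (c (drop_coordinate n t))} \<subseteq> {p \<in> P. r p (c (drop_coordinate n s))}"
      if t: "t \<in> grid (Suc n) N" "grid_cell N t \<subseteq> grid_cell N s" for t
      using trans[OF _ cP[OF drop_coordinate_grid[OF t(1)]] cP[OF s'] _
          c_mono[OF s' drop_coordinate_mono[OF t(2) N(1)]]] by blast
    show "f x \<in> {p \<in> P. r p (c (drop_coordinate n s))}" if x: "x \<in> grid_cell N s" "x \<in> ?B'" for x
    proof -
      note x' = drop_coordinate_cell[OF x(1)]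
      have q: "x(n := 0) \<in> ?Q" using Q' B'Q' x(2) by blast
      have \<alpha>'q: "\<alpha>' (x(n := 0)) \<in> topspace X"
        using \<alpha>'(1) q by (auto simp: continuous_map_def)
      show ?thesis
      proof (cases "x \<in> A")
        case True
        then show ?thesis
          using mP[OF \<alpha>'q] \<alpha>'(3)[OF s' x'] n0[OF True] by (simp add: f_def)
      next
        case False
        then show ?thesis using \<beta>P[OF q] \<beta>c[OF s' x'] by (simp add: f_def)
      qed
    qed
  qed fact
  then obtain h' where h': "continuous_map (unit_cube (Suc n)) (poset_topology P r) h'"
      "\<And>x. x \<in> ?B' \<Longrightarrow> h' x = f x"
    by blast
  let ?I = "{0..1::real}"
  have upd: "x(n := t) \<in> topspace (unit_cube (Suc n))" if "x \<in> ?Q" "t \<in> ?I" for x t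
    using that by (auto simp: topspace_unit_cube less_Suc_eq)
  have upd0: "x(n := t, n := 0) = x" if "x \<in> ?Q" for x t
    using that by (auto simp: topspace_unit_cube fun_upd_idem)
  have "continuous_map (prod_topology (top_of_set ?I) (unit_cube n)) (poset_topology P r)
      (\<lambda>z. h' ((snd z)(n := fst z)))"
    using continuous_map_compose[OF continuous_map_unit_cube_Suc h'(1)] by (simp add: o_def)
  moreover have "h' (x(n := 0)) = m (\<alpha>' x)" if x: "x \<in> ?Q" for x
  proof -
    have "x(n := 0) \<in> A"
      using upd[OF x, of 0] by (auto simp: A_def cube_boundary_def)
    moreover have "x(n := 0) = x" using upd0[OF x, of 0] by simp
    ultimately show ?thesis using h'(2)[of "x(n := 0)"] AA' by (simp add: f_def)
  qed
  moreover have "h' (x(n := 1)) = \<beta> x" if x: "x \<in> ?Q" for x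
  proof -
    have "x(n := 1) \<in> ?B'" "x(n := 1) \<notin> A"
      using upd[OF x, of 1] by (auto simp: A_def cube_boundary_def)
    then show ?thesis using h'(2)[of "x(n := 1)"] upd0[OF x, of 1] by (simp add: f_def del: fun_upd_upd)
  qed
  moreover have "h' (x(n := t)) = \<beta> x" if t: "0 \<le> t" "t \<le> 1" and x: "x \<in> ?B" for t x
  proof -
    have xQ: "x \<in> ?Q" using x BQ by blast
    obtain i where i: "i < n" "x i = 0 \<or> x i = 1" using x by (auto simp: cube_boundary_def)
    have "x(n := t) \<in> ?B'"
      using upd[OF xQ, of t] t i by (auto simp: cube_boundary_def intro!: exI[of _ i])
    then have *: "h' (x(n := t)) = f (x(n := t))" by (rule h'(2))
    show ?thesis
    proof (cases "x(n := t) \<in> A")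
      case True
      then have "x(n := t) = x" using n0[OF True] upd0[OF xQ, of t] by simp
      then show ?thesis using * True \<alpha>'(2)[OF x] \<alpha>\<beta>[OF x] by (simp add: f_def)
    next
      case False
      then show ?thesis using * upd0[OF xQ, of t] by (simp add: f_def del: fun_upd_upd)
    qed
  qed
  ultimately show ?thesis
    using that[of \<alpha>' "\<lambda>z. h' ((snd z)(n := fst z))"] \<alpha>'(1,2) by simp
qed

text \<open>
  A homotopy between maps of cubes is a map on the cube of the next dimension, and its lift is
  prescribed on the boundary of that cube: by \<open>f\<close> on the bottom \<open>A0\<close>, by \<open>g\<close> on the top \<open>A1\<close>, and by
  \<open>b\<close> on the sides \<open>A2\<close>. So homotopies lift by the previous lemma.
\<close>
lemma lift_homotopy:
  assumes "finite_poset P r"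
    and m: "continuous_map X (poset_topology P r) m"
    and down: "\<forall>e\<in>P. contractible_space (subtopology X {x \<in> topspace X. r (m x) e})"
      "\<forall>e\<in>P. {x \<in> topspace X. r (m x) e} \<noteq> {}"
    and f: "continuous_map (unit_cube n) X f" and g: "continuous_map (unit_cube n) X g"
    and fb: "\<And>x. x \<in> cube_boundary n \<Longrightarrow> f x = b" and gb: "\<And>x. x \<in> cube_boundary n \<Longrightarrow> g x = b"
    and b: "b \<in> topspace X"
    and h: "continuous_map (prod_topology (top_of_set {0..1::real}) (unit_cube n)) (poset_topology P r) h"
    and h0: "\<And>x. x \<in> topspace (unit_cube n) \<Longrightarrow> h (0, x) = m (f x)"
    and h1: "\<And>x. x \<in> topspace (unit_cube n) \<Longrightarrow> h (1, x) = m (g x)"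
    and hb: "\<And>t x. \<lbrakk>t \<in> {0..1}; x \<in> cube_boundary n\<rbrakk> \<Longrightarrow> h (t, x) = m b"
  shows "\<exists>k. continuous_map (prod_topology (top_of_set {0..1::real}) (unit_cube n)) X k
         \<and> (\<forall>x\<in>topspace (unit_cube n). k (0, x) = f x) \<and> (\<forall>x\<in>topspace (unit_cube n). k (1, x) = g x)
         \<and> (\<forall>t\<in>{0..1}. \<forall>x\<in>cube_boundary n. k (t, x) = b)"
proof -
  let ?Y = "poset_topology P r"
  note lift = lift_up_to_homotopy[OF assms(1-4)]
  let ?Q = "topspace (unit_cube n)" and ?B = "cube_boundary n" and ?B' = "cube_boundary (Suc n)"
  let ?Q' = "topspace (unit_cube (Suc n))" and ?I = "{0..1::real}"
  have Q': "y(n := 0) \<in> ?Q" "y n \<in> ?I" if "y \<in> ?Q'" for y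
    using that by (auto simp: topspace_unit_cube)
  have B'Q': "?B' \<subseteq> ?Q'" by (rule cube_boundary_subset)
  have cont: "continuous_on S (\<lambda>y. (y n, y(n := 0)))" for S :: "(nat \<Rightarrow> real) set"
  proof (intro continuous_on_Pair continuous_on_coordinate continuous_on_coordinatewise_then_product)
    show "continuous_on S (\<lambda>y. (y(n := 0)) i)" for i
      by (cases "i = n") (auto intro!: continuous_on_coordinate)
  qed
  define \<beta> where "\<beta> y = h (y n, y(n := 0))" for y
  have "continuous_map (unit_cube (Suc n)) (prod_topology (top_of_set {0..1::real}) (unit_cube n)) (\<lambda>y. (y n, y(n := 0)))"
    unfolding prod_interval_unit_cube
    using cont Q' by (subst unit_cube_eq_top_of_set) (auto simp: continuous_map_in_subtopology)
  from continuous_map_compose[OF this h]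
  have \<beta>: "continuous_map (unit_cube (Suc n)) ?Y \<beta>"
    by (simp add: o_def \<beta>_def[abs_def])
  define A0 where "A0 = ?B' \<inter> {y. y n = 0}"
  define A1 where "A1 = ?B' \<inter> {y. y n = 1}"
  define A2 where "A2 = ?B' \<inter> (\<Union>i<n. {y. y i = 0} \<union> {y. y i = 1})"
  have cl: "closed {y::nat \<Rightarrow> real. y i = c}" for i c
    by (auto intro!: closed_Collect_eq)
  have closed: "closed A0" "closed A1" "closed A2"
    unfolding A0_def A1_def A2_def
    by (intro closed_Int closed_Un closed_UN closed_cube_boundary cl ballI finite_lessThan)+
  have cover: "?B' = A0 \<union> A1 \<union> A2"
    unfolding A0_def A1_def A2_def by (auto simp: cube_boundary_def less_Suc_eq)
  have A2B: "y(n := 0) \<in> ?B" if "y \<in> A2" for y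
    using that Q'(1)[of y] B'Q' by (fastforce simp: A2_def cube_boundary_def)
  define \<alpha> where "\<alpha> y = (if y \<in> A0 then f (y(n := 0)) else if y \<in> A1 then g (y(n := 0)) else b)" for y
  have face: "continuous_map (top_of_set A) X (\<lambda>y. u (y(n := 0)))"
    if "A \<subseteq> ?B'" "continuous_map (unit_cube n) X u" for A u
  proof -
    have "continuous_on A (\<lambda>y. snd (y n, y(n := 0)))"
      by (intro continuous_on_snd cont)
    then have "continuous_map (top_of_set A) (unit_cube n) (\<lambda>y. y(n := 0))"
      using that(1) Q' B'Q' by (subst unit_cube_eq_top_of_set) (auto simp: continuous_map_in_subtopology)
    from continuous_map_compose[OF this that(2)] show ?thesis by (simp add: o_def)
  qed
  have sub: "subtopology (top_of_set S) A = top_of_set A" if "A \<subseteq> S" for S A :: "(nat \<Rightarrow> real) set"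
    using that by (simp add: subtopology_subtopology Int_absorb1)
  have A0B: "A0 \<subseteq> ?B'" "A1 \<subseteq> ?B'" "A2 \<subseteq> ?B'"
    using cover by blast+
  have A12: "continuous_map (top_of_set (A1 \<union> A2)) X (\<lambda>y. if y \<in> A1 then g (y(n := 0)) else b)"
  proof (rule continuous_map_if_closed)
    show "closedin (top_of_set (A1 \<union> A2)) A1" "closedin (top_of_set (A1 \<union> A2)) A2"
      using closed by (auto intro: closed_subset)
    show "continuous_map (subtopology (top_of_set (A1 \<union> A2)) A1) X (\<lambda>y. g (y(n := 0)))"
      using face[OF _ g, of A1] by (simp add: sub A0B)
    show "continuous_map (subtopology (top_of_set (A1 \<union> A2)) A2) X (\<lambda>y. b)"
      using b by simp
    show "g (y(n := 0)) = b" if "y \<in> A2" for y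
      using gb[OF A2B[OF that]] .
  qed auto
  have \<alpha>: "continuous_map (top_of_set ?B') X \<alpha>"
    unfolding \<alpha>_def
  proof (rule continuous_map_if_closed)
    show "closedin (top_of_set ?B') A0" "closedin (top_of_set ?B') (A1 \<union> A2)"
      using closed cover by (auto intro: closed_subset)
    show "continuous_map (subtopology (top_of_set ?B') A0) X (\<lambda>y. f (y(n := 0)))"
      using face[OF _ f, of A0] by (simp add: sub A0B)
    show "continuous_map (subtopology (top_of_set ?B') (A1 \<union> A2)) X (\<lambda>y. if y \<in> A1 then g (y(n := 0)) else b)"
      using A12 by (simp add: sub A0B)
    show "f (y(n := 0)) = (if y \<in> A1 then g (y(n := 0)) else b)" if "y \<in> A0" "y \<in> A1 \<union> A2" for y
      using that fb[OF A2B[of y]] by (auto simp: A0_def A1_def)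
  qed (use cover in auto)
  have \<alpha>\<beta>: "m (\<alpha> y) = \<beta> y" if y: "y \<in> ?B'" for y
  proof -
    have yQ: "y(n := 0) \<in> ?Q" "y n \<in> ?I" using Q' B'Q' y by auto
    consider "y \<in> A0" | "y \<in> A1" "y \<notin> A0" | "y \<in> A2" "y \<notin> A0" "y \<notin> A1"
      using y cover by blast
    then show ?thesis
    proof cases
      case 1
      then have "y n = 0" by (simp add: A0_def)
      then show ?thesis using 1 h0[OF yQ(1)] by (simp add: \<alpha>_def \<beta>_def)
    next
      case 2
      then have "y n = 1" by (simp add: A1_def)
      then show ?thesis using 2 h1[OF yQ(1)] by (simp add: \<alpha>_def \<beta>_def)
    next
      case 3
      then show ?thesis using hb[OF yQ(2) A2B] by (simp add: \<alpha>_def \<beta>_def)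
    qed
  qed
  obtain \<alpha>' where \<alpha>': "continuous_map (unit_cube (Suc n)) X \<alpha>'" "\<And>y. y \<in> ?B' \<Longrightarrow> \<alpha>' y = \<alpha> y"
    using lift[OF \<alpha> \<beta> \<alpha>\<beta>] by metis
  have upd: "x(n := t) \<in> ?Q'" if "x \<in> ?Q" "t \<in> ?I" for x t
    using that by (auto simp: topspace_unit_cube less_Suc_eq)
  have upd0: "x(n := t, n := 0) = x" if "x \<in> ?Q" for x t
    using that by (auto simp: topspace_unit_cube fun_upd_idem)
  have k: "continuous_map (prod_topology (top_of_set ?I) (unit_cube n)) X (\<lambda>z. \<alpha>' ((snd z)(n := fst z)))"
    using continuous_map_compose[OF continuous_map_unit_cube_Suc \<alpha>'(1)] by (simp add: o_def)
  have k0: "\<alpha>' (x(n := 0)) = f x" if x: "x \<in> ?Q" for x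
  proof -
    have "x(n := 0) \<in> A0" using upd[OF x, of 0] by (auto simp: A0_def cube_boundary_def)
    then show ?thesis using \<alpha>'(2)[of "x(n := 0)"] cover upd0[OF x, of 0] by (simp add: \<alpha>_def)
  qed
  have k1: "\<alpha>' (x(n := 1)) = g x" if x: "x \<in> ?Q" for x
  proof -
    have "x(n := 1) \<in> A1" "x(n := 1) \<notin> A0"
      using upd[OF x, of 1] by (auto simp: A0_def A1_def cube_boundary_def)
    then show ?thesis using \<alpha>'(2)[of "x(n := 1)"] cover upd0[OF x, of 1] by (simp add: \<alpha>_def del: fun_upd_upd)
  qed
  have kb: "\<alpha>' (x(n := t)) = b" if t: "t \<in> ?I" and x: "x \<in> ?B" for t x
  proof -
    have xQ: "x \<in> ?Q" using x by (simp add: cube_boundary_def)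
    obtain i where i: "i < n" "x i = 0 \<or> x i = 1" using x by (auto simp: cube_boundary_def)
    have "x(n := t) \<in> ?B'"
      using upd[OF xQ t] i by (auto simp: cube_boundary_def intro!: exI[of _ i])
    then show ?thesis
      using \<alpha>'(2)[of "x(n := t)"] upd0[OF xQ, of t] fb[OF x] gb[OF x] by (simp add: \<alpha>_def del: fun_upd_upd)
  qed
  show ?thesis
    by (rule exI[of _ "\<lambda>z. \<alpha>' ((snd z)(n := fst z))"]) (use k k0 k1 kb in simp)
qed

section \<open>Weak homotopy equivalences onto finite posets\<close>

text \<open>
  A homotopy may be changed freely outside the cube, so that agreement with the given maps has to be
  checked on the cube only.
\<close>
lemma loop_homotopic_iff:
  "loop_homotopic n X x0 f g \<longleftrightarrow>
     (\<exists>h. continuous_map (prod_topology (top_of_set {0..1::real}) (unit_cube n)) X h \<and>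
       (\<forall>x\<in>topspace (unit_cube n). h (0, x) = f x) \<and> (\<forall>x\<in>topspace (unit_cube n). h (1, x) = g x) \<and>
       (\<forall>t\<in>{0..1}. \<forall>x\<in>cube_boundary n. h (t, x) = x0))"
  unfolding loop_homotopic_def
  by (subst homotopic_with) (use cube_boundary_subset in \<open>auto simp: subset_iff\<close>)

lemma loop_homotopic_refl: "f \<in> gen_loops n X x0 \<Longrightarrow> loop_homotopic n X x0 f f"
  by (simp add: loop_homotopic_def gen_loops_def)

lemma loop_homotopic_sym: "loop_homotopic n X x0 f g \<Longrightarrow> loop_homotopic n X x0 g f"
  by (simp add: loop_homotopic_def homotopic_with_sym)

lemma loop_homotopic_trans:
  "\<lbrakk>loop_homotopic n X x0 f g; loop_homotopic n X x0 g h\<rbrakk> \<Longrightarrow> loop_homotopic n X x0 f h"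
  unfolding loop_homotopic_def by (rule homotopic_with_trans)

lemma loop_homotopic_imp_gen_loops:
  assumes "loop_homotopic n X x0 f g"
  shows "f \<in> gen_loops n X x0" "g \<in> gen_loops n X x0"
  using homotopic_with_imp_continuous_maps[OF assms[unfolded loop_homotopic_def]]
    homotopic_with_imp_property[OF assms[unfolded loop_homotopic_def]]
  by (auto simp: gen_loops_def)

lemma loop_class_eq_iff:
  assumes "f \<in> gen_loops n X x0"
  shows "Collect (loop_homotopic n X x0 f) = Collect (loop_homotopic n X x0 g) \<longleftrightarrow> loop_homotopic n X x0 f g"
proof
  assume "Collect (loop_homotopic n X x0 f) = Collect (loop_homotopic n X x0 g)"
  then have "loop_homotopic n X x0 g f"
    using loop_homotopic_refl[OF assms] by blast
  then show "loop_homotopic n X x0 f g" by (rule loop_homotopic_sym)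
next
  assume *: "loop_homotopic n X x0 f g"
  show "Collect (loop_homotopic n X x0 f) = Collect (loop_homotopic n X x0 g)"
    by (intro Collect_cong iffI) (fact loop_homotopic_trans[OF loop_homotopic_sym[OF *]], fact loop_homotopic_trans[OF *])
qed

lemma loop_homotopic_compose:
  assumes "loop_homotopic n X x0 f g" "continuous_map X Y m"
  shows "loop_homotopic n Y (m x0) (m \<circ> f) (m \<circ> g)"
  using assms unfolding loop_homotopic_def by (rule homotopic_with_compose_continuous_map_left) auto

lemma loop_homotopic_concat:
  assumes n: "n \<ge> 1" and "loop_homotopic n X x0 f f'" "loop_homotopic n X x0 g g'"
  shows "loop_homotopic n X x0 (loop_concat f g) (loop_concat f' g')"
proof -
  let ?I = "{0..1::real}" and ?Q = "topspace (unit_cube n)"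
  let ?IQ = "prod_topology (top_of_set {0..1::real}) (unit_cube n)"
  obtain h where h: "continuous_map ?IQ X h" "\<And>x. x \<in> ?Q \<Longrightarrow> h (0, x) = f x" "\<And>x. x \<in> ?Q \<Longrightarrow> h (1, x) = f' x"
     "\<And>t x. \<lbrakk>t \<in> ?I; x \<in> cube_boundary n\<rbrakk> \<Longrightarrow> h (t, x) = x0"
    using assms(2) unfolding loop_homotopic_iff by blast
  obtain k where k: "continuous_map ?IQ X k" "\<And>x. x \<in> ?Q \<Longrightarrow> k (0, x) = g x" "\<And>x. x \<in> ?Q \<Longrightarrow> k (1, x) = g' x"
     "\<And>t x. \<lbrakk>t \<in> ?I; x \<in> cube_boundary n\<rbrakk> \<Longrightarrow> k (t, x) = x0"
    using assms(3) unfolding loop_homotopic_iff by blast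
  have left: "x(0 := 2 * x 0) \<in> ?Q" if "x \<in> ?Q" "x 0 \<le> 1 / 2" for x
    using that n by (auto simp: topspace_unit_cube)
  have right: "x(0 := 2 * x 0 - 1) \<in> ?Q" if "x \<in> ?Q" "1 / 2 \<le> x 0" for x
    using that n by (auto simp: topspace_unit_cube)
  have rescale: "continuous_on S (\<lambda>z. (fst z, (snd z)(0 := 2 * snd z 0 - c)))"
    for S :: "(real \<times> (nat \<Rightarrow> real)) set" and c
  proof (intro continuous_on_Pair continuous_on_coordinatewise_then_product)
    have snd: "continuous_on S (\<lambda>z. snd z i)" for i
      by (rule continuous_on_product_then_coordinatewise) (intro continuous_intros continuous_on_id)
    show "continuous_on S (\<lambda>z. ((snd z)(0 := 2 * snd z 0 - c)) i)" for i
      using snd[of i] snd[of 0] by (cases "i = 0") (auto intro!: continuous_on_diff continuous_on_mult)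
  qed (intro continuous_intros continuous_on_id)
  define H where "H z = (if snd z 0 \<le> 1 / 2 then h (fst z, (snd z)(0 := 2 * snd z 0))
      else k (fst z, (snd z)(0 := 2 * snd z 0 - 1)))" for z
  have "continuous_map ?IQ X H"
    unfolding H_def
  proof (rule continuous_map_cases_le)
    show "continuous_map ?IQ euclideanreal (\<lambda>z. snd z 0)"
      unfolding prod_interval_unit_cube
      by (simp, rule continuous_on_product_then_coordinatewise) (intro continuous_intros continuous_on_id)
    show "continuous_map ?IQ euclideanreal (\<lambda>z. 1 / 2)" by simp
    have "continuous_map (top_of_set (?I \<times> ?Q \<inter> {z. snd z 0 \<le> 1 / 2})) ?IQ (\<lambda>z. (fst z, (snd z)(0 := 2 * snd z 0)))"
      unfolding prod_interval_unit_cube using rescale[of _ 0] left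
      by (auto simp: continuous_map_in_subtopology)
    from continuous_map_compose[OF this h(1)]
    show "continuous_map (subtopology ?IQ {z \<in> topspace ?IQ. snd z 0 \<le> 1 / 2}) X
        (\<lambda>z. h (fst z, (snd z)(0 := 2 * snd z 0)))"
      unfolding prod_interval_unit_cube by (simp add: subtopology_subtopology o_def Int_def conj_ac)
    have "continuous_map (top_of_set (?I \<times> ?Q \<inter> {z. 1 / 2 \<le> snd z 0})) ?IQ (\<lambda>z. (fst z, (snd z)(0 := 2 * snd z 0 - 1)))"
      unfolding prod_interval_unit_cube using rescale[of _ 1] right
      by (auto simp: continuous_map_in_subtopology)
    from continuous_map_compose[OF this k(1)]
    show "continuous_map (subtopology ?IQ {z \<in> topspace ?IQ. 1 / 2 \<le> snd z 0}) X
        (\<lambda>z. k (fst z, (snd z)(0 := 2 * snd z 0 - 1)))"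
      unfolding prod_interval_unit_cube by (simp add: subtopology_subtopology o_def Int_def conj_ac)
    show "h (fst z, (snd z)(0 := 2 * snd z 0)) = k (fst z, (snd z)(0 := 2 * snd z 0 - 1))"
      if z: "z \<in> topspace ?IQ" "snd z 0 = 1 / 2" for z
    proof -
      obtain t x where tx: "z = (t, x)" "t \<in> ?I" "x \<in> ?Q" using z(1) by auto
      have x: "2 * x 0 = 1" using z(2) tx by simp
      have "x(0 := 1) \<in> cube_boundary n" "x(0 := 0) \<in> cube_boundary n"
        using left[OF tx(3)] right[OF tx(3)] x n by (auto simp: cube_boundary_def)
      then show ?thesis using h(4)[OF tx(2)] k(4)[OF tx(2)] by (simp add: tx x)
    qed
  qed
  moreover have "H (t, x) = x0" if t: "t \<in> ?I" and x: "x \<in> cube_boundary n" for t x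
  proof -
    have xQ: "x \<in> ?Q" using x by (simp add: cube_boundary_def)
    obtain i where i: "i < n" "x i = 0 \<or> x i = 1" using x by (auto simp: cube_boundary_def)
    show ?thesis
    proof (cases "x 0 \<le> 1 / 2")
      case True
      then have "x(0 := 2 * x 0) \<in> cube_boundary n"
        using left[OF xQ True] i by (auto simp: cube_boundary_def intro!: exI[of _ i])
      then show ?thesis using h(4)[OF t] True by (simp add: H_def)
    next
      case False
      then have "x(0 := 2 * x 0 - 1) \<in> cube_boundary n"
        using right[OF xQ] i by (auto simp: cube_boundary_def intro!: exI[of _ i])
      then show ?thesis using k(4)[OF t] False by (simp add: H_def)
    qed
  qed
  moreover have "H (0, x) = loop_concat f g x" "H (1, x) = loop_concat f' g' x" if "x \<in> ?Q" for x
    using left[OF that] right[OF that] h(2,3) k(2,3) by (simp_all add: H_def loop_concat_def)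
  ultimately show ?thesis
    unfolding loop_homotopic_iff by blast
qed

text \<open>
  Products in the homotopy group are saturated under homotopy; that they are again single classes is
  the compatibility of concatenation with homotopies.
\<close>
lemma homotopy_group_mult:
  assumes "n \<ge> 1" "f \<in> gen_loops n X x0" "g \<in> gen_loops n X x0"
  shows "Collect (loop_homotopic n X x0 f) \<otimes>\<^bsub>homotopy_group n X x0\<^esub> Collect (loop_homotopic n X x0 g)
       = Collect (loop_homotopic n X x0 (loop_concat f g))"
proof -
  have "loop_homotopic n X x0 (loop_concat f g) h"
    if "loop_homotopic n X x0 f f'" "loop_homotopic n X x0 g g'" "loop_homotopic n X x0 (loop_concat f' g') h"
    for f' g' h
    by (rule loop_homotopic_trans[OF loop_homotopic_concat[OF assms(1) that(1,2)] that(3)])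
  then show ?thesis
    using assms(2,3)[THEN loop_homotopic_refl] unfolding homotopy_group_def by auto
qed

lemma homotopy_group_map_class:
  assumes "continuous_map X Y m" "f \<in> gen_loops n X x0"
  shows "homotopy_group_map n Y m x0 (Collect (loop_homotopic n X x0 f))
       = Collect (loop_homotopic n Y (m x0) (m \<circ> f))"
proof -
  have "loop_homotopic n Y (m x0) (m \<circ> f) h"
    if "loop_homotopic n X x0 f g" "loop_homotopic n Y (m x0) (m \<circ> g) h" for g h
    by (rule loop_homotopic_trans[OF loop_homotopic_compose[OF that(1) assms(1)] that(2)])
  then show ?thesis
    using loop_homotopic_refl[OF assms(2)] unfolding homotopy_group_map_def by auto
qed

lemma compose_gen_loops:
  "\<lbrakk>continuous_map X Y m; f \<in> gen_loops n X x0\<rbrakk> \<Longrightarrow> m \<circ> f \<in> gen_loops n Y (m x0)"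
  by (auto simp: gen_loops_def intro: continuous_map_compose)

lemma homotopy_group_map_iso:
  assumes n: "n \<ge> 1" and m: "continuous_map X Y m"
    and surj: "\<And>g. g \<in> gen_loops n Y (m x0) \<Longrightarrow> \<exists>f\<in>gen_loops n X x0. loop_homotopic n Y (m x0) (m \<circ> f) g"
    and inj: "\<And>f g. \<lbrakk>f \<in> gen_loops n X x0; g \<in> gen_loops n X x0; loop_homotopic n Y (m x0) (m \<circ> f) (m \<circ> g)\<rbrakk>
       \<Longrightarrow> loop_homotopic n X x0 f g"
  shows "homotopy_group_map n Y m x0 \<in> iso (homotopy_group n X x0) (homotopy_group n Y (m x0))"
proof -
  let ?G = "homotopy_group n X x0" and ?H = "homotopy_group n Y (m x0)"
  let ?F = "homotopy_group_map n Y m x0"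
  have carrier: "carrier (homotopy_group n Z z) = (\<lambda>f. Collect (loop_homotopic n Z z f)) ` gen_loops n Z z" for Z z
    by (simp add: homotopy_group_def)
  note F = homotopy_group_map_class[OF m]
  note comp = compose_gen_loops[OF m]
  have concat: "loop_concat f g \<in> gen_loops n X x0" if "f \<in> gen_loops n X x0" "g \<in> gen_loops n X x0" for f g
    by (rule loop_homotopic_imp_gen_loops(1)[OF loop_homotopic_concat[OF n that[THEN loop_homotopic_refl]]])
  have "m \<circ> loop_concat f g = loop_concat (m \<circ> f) (m \<circ> g)" for f g
    by (auto simp: loop_concat_def)
  then have "?F (A \<otimes>\<^bsub>?G\<^esub> B) = ?F A \<otimes>\<^bsub>?H\<^esub> ?F B" if "A \<in> carrier ?G" "B \<in> carrier ?G" for A B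
    using that unfolding carrier
    by (auto simp: F comp concat homotopy_group_mult[OF n])
  moreover have "?F \<in> carrier ?G \<rightarrow> carrier ?H"
    unfolding carrier using F comp by auto
  ultimately have "?F \<in> hom ?G ?H"
    by (simp add: hom_def)
  moreover have "inj_on ?F (carrier ?G)"
    unfolding carrier using inj
    by (auto simp: inj_on_def F comp loop_class_eq_iff)
  moreover have "?F ` carrier ?G = carrier ?H"
  proof
    show "?F ` carrier ?G \<subseteq> carrier ?H"
      unfolding carrier using F comp by auto
    show "carrier ?H \<subseteq> ?F ` carrier ?G"
    proof
      fix B assume "B \<in> carrier ?H"
      then obtain g where g: "g \<in> gen_loops n Y (m x0)" "B = Collect (loop_homotopic n Y (m x0) g)"
        unfolding carrier by blast
      obtain f where f: "f \<in> gen_loops n X x0" "loop_homotopic n Y (m x0) (m \<circ> f) g"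
        using surj[OF g(1)] by blast
      have "B = ?F (Collect (loop_homotopic n X x0 f))"
        unfolding g(2) F[OF f(1)] using loop_class_eq_iff[OF comp[OF f(1)], THEN iffD2, OF f(2)] by (rule sym)
      then show "B \<in> ?F ` carrier ?G" unfolding carrier using f(1) by blast
    qed
  qed
  ultimately show ?thesis
    by (simp add: iso_def bij_betw_def)
qed

lemma path_components_map_bij:
  assumes m: "continuous_map X Y m"
    and surj: "\<And>y. y \<in> topspace Y \<Longrightarrow> \<exists>x\<in>topspace X. path_component_of Y (m x) y"
    and inj: "\<And>x x'. \<lbrakk>x \<in> topspace X; x' \<in> topspace X; path_component_of Y (m x) (m x')\<rbrakk> \<Longrightarrow> path_component_of X x x'"
  shows "bij_betw (path_components_map Y m) (path_components_of X) (path_components_of Y)"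
proof -
  have mY: "m x \<in> topspace Y" if "x \<in> topspace X" for x
    using m that by (auto simp: continuous_map_def)
  have pres: "path_component_of Y (m x) (m a)" if "path_component_of X x a" for x a
  proof -
    obtain g where g: "pathin X g" "g 0 = x" "g 1 = a" using \<open>path_component_of X x a\<close> by (auto simp: path_component_of_def)
    then have "pathin Y (m \<circ> g)" using m unfolding pathin_def by (blast intro: continuous_map_compose)
    then show ?thesis using g unfolding path_component_of_def by (intro exI[of _ "m \<circ> g"]) simp
  qed
  have pcX: "path_component_of_set X a = path_component_of_set X b \<longleftrightarrow> path_component_of X a b"
    if "b \<in> topspace X" for a b
    using that path_component_of_equiv[of X a b] path_component_of_refl[of X b] by (metis mem_Collect_eq)
  have pcY: "path_component_of_set Y a = path_component_of_set Y b \<longleftrightarrow> path_component_of Y a b"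
    if "b \<in> topspace Y" for a b
    using that path_component_of_equiv[of Y a b] path_component_of_refl[of Y b] by (metis mem_Collect_eq)
  have F: "path_components_map Y m (path_component_of_set X x) = path_component_of_set Y (m x)"
    if x: "x \<in> topspace X" for x
  proof -
    have "path_component_of_set Y (m a) = path_component_of_set Y (m x)"
      if "a \<in> path_component_of_set X x" for a
      using pres[of x a] that path_component_of_equiv[of Y "m x" "m a"] by simp
    then have "path_components_map Y m (path_component_of_set X x)
        = (\<Union>a\<in>path_component_of_set X x. path_component_of_set Y (m x))"
      unfolding path_components_map_def by (intro SUP_cong refl)
    moreover have "path_component_of_set X x \<noteq> {}"
      using x by (simp only: path_component_of_eq_empty not_not)
    ultimately show ?thesis by (simp only: UN_constant if_False)
  qed
  show ?thesis
    unfolding bij_betw_def path_components_of_def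
  proof (intro conjI)
    show "inj_on (path_components_map Y m) (path_component_of_set X ` topspace X)"
    proof (rule inj_onI, clarify)
      fix x x' assume x: "x \<in> topspace X" "x' \<in> topspace X"
        and "path_components_map Y m (path_component_of_set X x) = path_components_map Y m (path_component_of_set X x')"
      then have "path_component_of Y (m x) (m x')"
        using F[OF x(1)] F[OF x(2)] pcY[OF mY[OF x(2)]] by simp
      then show "path_component_of_set X x = path_component_of_set X x'"
        using inj[OF x] pcX[OF x(2)] by simp
    qed
    show "path_components_map Y m ` path_component_of_set X ` topspace X = path_component_of_set Y ` topspace Y"
    proof
      show "path_components_map Y m ` path_component_of_set X ` topspace X \<subseteq> path_component_of_set Y ` topspace Y"
        using F mY by auto
      show "path_component_of_set Y ` topspace Y \<subseteq> path_components_map Y m ` path_component_of_set X ` topspace X"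
      proof clarify
        fix y assume "y \<in> topspace Y"
        then obtain x where x: "x \<in> topspace X" "path_component_of Y (m x) y" using surj by blast
        then have "path_component_of_set Y y = path_components_map Y m (path_component_of_set X x)"
          using F[OF x(1)] pcY[OF \<open>y \<in> topspace Y\<close>, THEN iffD2, OF x(2)] by (simp only:)
        then show "path_component_of_set Y y \<in> path_components_map Y m ` path_component_of_set X ` topspace X"
          using x(1) by blast
      qed
    qed
  qed
qed

text \<open>
  McCord's theorem for finite posets. Surjectivity on homotopy classes is lifting of cubes, and
  injectivity is lifting of homotopies; path components are the case of the cube of dimension 0.
\<close>
lemma weak_homotopy_equivalence_to_finite_poset:
  assumes "finite_poset P r"
    and m: "continuous_map X (poset_topology P r) m"
    and down: "\<forall>e\<in>P. contractible_space (subtopology X {x \<in> topspace X. r (m x) e})"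
      "\<forall>e\<in>P. {x \<in> topspace X. r (m x) e} \<noteq> {}"
  shows "weak_homotopy_equivalence X (poset_topology P r) m"
proof -
  let ?Y = "poset_topology P r"
  note lift = lift_up_to_homotopy[OF assms]
  have "homotopy_group_map n ?Y m b \<in> iso (homotopy_group n X b) (homotopy_group n ?Y (m b))"
    if n: "n \<ge> 1" and b: "b \<in> topspace X" for n b
  proof (rule homotopy_group_map_iso[OF n m])
    fix g assume g: "g \<in> gen_loops n ?Y (m b)"
    have const: "continuous_map (top_of_set (cube_boundary n)) X (\<lambda>_. b)" using b by simp
    have cg: "continuous_map (unit_cube n) ?Y g" and gb: "\<And>x. x \<in> cube_boundary n \<Longrightarrow> m b = g x"
      using g by (auto simp: gen_loops_def)
    obtain f h where "continuous_map (unit_cube n) X f" "\<And>x. x \<in> cube_boundary n \<Longrightarrow> f x = b"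
      "continuous_map (prod_topology (top_of_set {0..1::real}) (unit_cube n)) ?Y h"
      "\<And>x. x \<in> topspace (unit_cube n) \<Longrightarrow> h (0, x) = m (f x)"
      "\<And>x. x \<in> topspace (unit_cube n) \<Longrightarrow> h (1, x) = g x"
      "\<And>t x. \<lbrakk>0 \<le> t; t \<le> 1; x \<in> cube_boundary n\<rbrakk> \<Longrightarrow> h (t, x) = g x"
      by (rule lift[OF const cg gb], assumption, rule that)
    then show "\<exists>f\<in>gen_loops n X b. loop_homotopic n ?Y (m b) (m \<circ> f) g"
      using gb unfolding loop_homotopic_iff gen_loops_def by (intro bexI[of _ f] exI[of _ h]) auto
  next
    fix f g assume "f \<in> gen_loops n X b" "g \<in> gen_loops n X b" "loop_homotopic n ?Y (m b) (m \<circ> f) (m \<circ> g)"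
    then show "loop_homotopic n X b f g"
      unfolding loop_homotopic_iff gen_loops_def using lift_homotopy[OF assms, of n f g b] b by auto
  qed
  moreover have "bij_betw (path_components_map ?Y m) (path_components_of X) (path_components_of ?Y)"
  proof (rule path_components_map_bij[OF m])
    have cb0: "cube_boundary 0 = {}" by (simp add: cube_boundary_def)
    have Q0: "(\<lambda>_. 0) \<in> topspace (unit_cube 0)" by (simp add: topspace_unit_cube)
    have slice: "pathin Z (\<lambda>t. h (t, \<lambda>_. 0))"
      if "continuous_map (prod_topology (top_of_set {0..1::real}) (unit_cube 0)) Z h" for Z :: "'z topology" and h
    proof -
      have "continuous_map (top_of_set {0..1}) (prod_topology (top_of_set {0..1::real}) (unit_cube 0)) (\<lambda>t. (t, \<lambda>_. 0))"
        using Q0 by (intro continuous_map_pairedI) auto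
      from continuous_map_compose[OF this that] show ?thesis by (simp add: pathin_def o_def)
    qed
    show "\<exists>x\<in>topspace X. path_component_of ?Y (m x) y" if y: "y \<in> topspace ?Y" for y
    proof -
      have 1: "continuous_map (top_of_set (cube_boundary 0)) X (\<lambda>_. undefined)" by (simp add: cb0)
      have 2: "continuous_map (unit_cube 0) ?Y (\<lambda>_. y)" using y by simp
      have 3: "m undefined = y" if "x \<in> cube_boundary 0" for x using that cb0 by simp
      obtain f h where fh: "continuous_map (unit_cube 0) X f"
        "continuous_map (prod_topology (top_of_set {0..1::real}) (unit_cube 0)) ?Y h"
        "\<And>x. x \<in> topspace (unit_cube 0) \<Longrightarrow> h (0, x) = m (f x)"
        "\<And>x. x \<in> topspace (unit_cube 0) \<Longrightarrow> h (1, x) = y"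
        by (rule lift[OF 1 2 3], assumption, rule that)
      have "f (\<lambda>_. 0) \<in> topspace X" using fh(1) Q0 by (auto simp: continuous_map_def)
      moreover have "path_component_of ?Y (m (f (\<lambda>_. 0))) y"
        unfolding path_component_of_def using slice[OF fh(2)] fh(3,4)[OF Q0] by blast
      ultimately show ?thesis by blast
    qed
    show "path_component_of X x x'"
      if x: "x \<in> topspace X" "x' \<in> topspace X" and p: "path_component_of ?Y (m x) (m x')" for x x'
    proof -
      obtain p where p: "pathin ?Y p" "p 0 = m x" "p 1 = m x'"
        using p by (auto simp: path_component_of_def)
      have h: "continuous_map (prod_topology (top_of_set {0..1::real}) (unit_cube 0)) ?Y (\<lambda>z. p (fst z))"
        using continuous_map_compose[OF continuous_map_fst p(1)[unfolded pathin_def]] by (simp add: o_def)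
      obtain k where "continuous_map (prod_topology (top_of_set {0..1::real}) (unit_cube 0)) X k"
         "\<forall>y\<in>topspace (unit_cube 0). k (0, y) = x" "\<forall>y\<in>topspace (unit_cube 0). k (1, y) = x'"
        using lift_homotopy[OF assms, of 0 "\<lambda>_. x" "\<lambda>_. x'" x "\<lambda>z. p (fst z)"] x p h by (auto simp: cb0)
      then show ?thesis
        unfolding path_component_of_def using slice Q0 by blast
    qed
  qed
  ultimately show ?thesis
    unfolding weak_homotopy_equivalence_def using m by blast
qed

section \<open>Gluing homotopies along proper maps\<close>

lemma homotopic_with_TrueI:
  assumes "continuous_map (prod_topology (top_of_set {0..1::real}) X) Y h"
    and "\<And>x. x \<in> topspace X \<Longrightarrow> h (0, x) = f x" "\<And>x. x \<in> topspace X \<Longrightarrow> h (1, x) = g x"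
  shows "homotopic_with (\<lambda>_. True) X Y f g"
  by (subst homotopic_with) (use assms in auto)

text \<open>
  A proper map stays proper, hence closed, after taking the product with a parameter space \<open>T\<close>, whereas
  a quotient map in general does not stay a quotient map. Therefore homotopies on a space with an
  attached cell can be defined separately on the space and on the disk.
\<close>
lemma glue_homotopy_along_proper_map:
  assumes q: "proper_map W X q" "continuous_map W X q" and A: "closedin X A"
    and cover: "topspace X \<subseteq> A \<union> q ` topspace W"
    and u: "continuous_map (prod_topology T (subtopology X A)) Z u"
    and v: "continuous_map (prod_topology T W) Z v"
    and compat: "\<And>t w. \<lbrakk>t \<in> topspace T; w \<in> topspace W; q w \<in> A\<rbrakk> \<Longrightarrow> v (t, w) = u (t, q w)"
    and inj: "inj_on q {w \<in> topspace W. q w \<notin> A}"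
  obtains h where "continuous_map (prod_topology T X) Z h"
    "\<And>t x. \<lbrakk>t \<in> topspace T; x \<in> A\<rbrakk> \<Longrightarrow> h (t, x) = u (t, x)"
    "\<And>t w. \<lbrakk>t \<in> topspace T; w \<in> topspace W\<rbrakk> \<Longrightarrow> h (t, q w) = v (t, w)"
proof -
  define B where "B = q ` topspace W"
  define s where "s x = (SOME w. w \<in> topspace W \<and> q w = x)" for x
  define g where "g z = v (fst z, s (snd z))" for z
  define h where "h z = (if z \<in> topspace T \<times> A then u z else v (fst z, s (snd z)))" for z
  have s: "s x \<in> topspace W \<and> q (s x) = x" if "x \<in> B" for x
    unfolding s_def by (rule someI_ex) (use that in \<open>auto simp: B_def\<close>)
  have hv: "h (t, q w) = v (t, w)" if "t \<in> topspace T" "w \<in> topspace W" for t w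
  proof (cases "q w \<in> A")
    case True
    then show ?thesis using compat that by (simp add: h_def)
  next
    case False
    have "s (q w) = w" using s[of "q w"] inj_onD[OF inj, of "s (q w)" w] that False by (auto simp: B_def)
    then show ?thesis using False by (simp add: h_def)
  qed
  have BX: "B \<subseteq> topspace X" using q(2) by (auto simp: B_def continuous_map_def)
  have closedB: "closedin X B"
    using q(1) unfolding B_def proper_map_def closed_map_def by blast
  let ?TX = "prod_topology T X"
  have "continuous_map (subtopology ?TX (topspace T \<times> A)) Z h"
  proof (rule continuous_map_eq)
    show "continuous_map (subtopology ?TX (topspace T \<times> A)) Z u"
      using u by (simp add: subtopology_Times)
  qed (auto simp: h_def)
  moreover have "continuous_map (subtopology ?TX (topspace T \<times> B)) Z h"
  proof -
    let ?q = "\<lambda>(t, w). (t, q w)"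
    have "proper_map W (subtopology X B) q"
      using q(1) by (rule proper_map_into_subtopology) (auto simp: B_def)
    then have "proper_map (prod_topology T W) (prod_topology T (subtopology X B)) (\<lambda>(t, w). (id t, q w))"
      by (simp only: proper_map_prod proper_map_id simp_thms)
    then have "closed_map (prod_topology T W) (prod_topology T (subtopology X B)) ?q"
      by (simp add: proper_imp_closed_map)
    moreover have "continuous_map (prod_topology T W) (prod_topology T (subtopology X B)) ?q"
    proof -
      have "continuous_map W (subtopology X B) q"
        using q(2) by (auto simp: continuous_map_in_subtopology B_def)
      then have "continuous_map (prod_topology T W) (subtopology X B) (q \<circ> snd)"
        by (rule continuous_map_compose[OF continuous_map_snd])
      then show ?thesis
        by (simp add: case_prod_unfold continuous_map_pairwise o_def continuous_map_fst)
    qed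
    moreover have "?q ` topspace (prod_topology T W) = topspace (prod_topology T (subtopology X B))"
      using BX by (auto simp: B_def image_iff)
    ultimately have "quotient_map (prod_topology T W) (prod_topology T (subtopology X B)) ?q"
      by (intro continuous_closed_imp_quotient_map)
    moreover have "continuous_map (prod_topology T W) Z (h \<circ> ?q)"
      by (rule continuous_map_eq[OF v]) (auto simp: hv)
    ultimately have "continuous_map (prod_topology T (subtopology X B)) Z h"
      by (rule continuous_compose_quotient_map)
    then show ?thesis by (simp add: subtopology_Times)
  qed
  ultimately have "continuous_map ?TX Z (\<lambda>z. if z \<in> topspace T \<times> A then h z else h z)"
    using cover
    by (intro continuous_map_if_closed[where B = "topspace T \<times> B"])
      (auto simp: closedin_prod_Times_iff A closedB B_def[symmetric])
  then have "continuous_map ?TX Z h" by simp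
  moreover have "h (t, x) = u (t, x)" if "t \<in> topspace T" "x \<in> A" for t x
    using that by (simp add: h_def)
  ultimately show ?thesis
    using hv by (rule that)
qed

lemma glue_along_proper_map:
  assumes q: "proper_map W X q" "continuous_map W X q" and A: "closedin X A"
    and cover: "topspace X \<subseteq> A \<union> q ` topspace W"
    and u: "continuous_map (subtopology X A) Z u"
    and v: "continuous_map W Z v"
    and compat: "\<And>w. \<lbrakk>w \<in> topspace W; q w \<in> A\<rbrakk> \<Longrightarrow> v w = u (q w)"
    and inj: "inj_on q {w \<in> topspace W. q w \<notin> A}"
  obtains h where "continuous_map X Z h" "\<And>x. x \<in> A \<Longrightarrow> h x = u x" "\<And>w. w \<in> topspace W \<Longrightarrow> h (q w) = v w"
proof -
  let ?T = "discrete_topology {()}"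
  have u': "continuous_map (prod_topology ?T (subtopology X A)) Z (u \<circ> snd)"
    by (rule continuous_map_compose[OF continuous_map_snd u])
  have v': "continuous_map (prod_topology ?T W) Z (v \<circ> snd)"
    by (rule continuous_map_compose[OF continuous_map_snd v])
  obtain h where h: "continuous_map (prod_topology ?T X) Z h"
    "\<And>t x. \<lbrakk>t \<in> topspace ?T; x \<in> A\<rbrakk> \<Longrightarrow> h (t, x) = (u \<circ> snd) (t, x)"
    "\<And>t w. \<lbrakk>t \<in> topspace ?T; w \<in> topspace W\<rbrakk> \<Longrightarrow> h (t, q w) = (v \<circ> snd) (t, w)"
    by (rule glue_homotopy_along_proper_map[OF q A cover u' v' _ inj])
      (use compat in auto)
  have "continuous_map X (prod_topology ?T X) (\<lambda>x. ((), x))"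
    by (simp add: continuous_map_pairwise o_def)
  from continuous_map_compose[OF this h(1)] have "continuous_map X Z (\<lambda>x. h ((), x))"
    by (simp add: o_def)
  then show ?thesis
    by (rule that) (use h(2,3) in auto)
qed

lemma continuous_map_top_of_setI:
  assumes "continuous_on S f" "\<And>x. x \<in> S \<Longrightarrow> f x \<in> T"
  shows "continuous_map (top_of_set S) (top_of_set T) f"
  using assms by (auto simp: continuous_map_in_subtopology)

section \<open>Disks\<close>

definition rnorm :: "nat \<Rightarrow> (nat \<Rightarrow> real) \<Rightarrow> real" where
  "rnorm n x = sqrt (\<Sum>i<n. (x i)\<^sup>2)"

definition dilate :: "real \<Rightarrow> (nat \<Rightarrow> real) \<Rightarrow> nat \<Rightarrow> real" where
  "dilate c x = (\<lambda>i. c * x i)"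

lemma rnorm_nonneg [simp]: "0 \<le> rnorm n x"
  by (simp add: rnorm_def sum_nonneg)

lemma rnorm_dilate [simp]: "rnorm n (dilate c x) = \<bar>c\<bar> * rnorm n x"
  by (simp add: rnorm_def dilate_def power_mult_distrib sum_distrib_left[symmetric] real_sqrt_mult)

lemma dilate_dilate [simp]: "dilate b (dilate c x) = dilate (b * c) x"
  by (simp add: dilate_def mult.assoc)

lemma dilate_1 [simp]: "dilate 1 x = x"
  by (simp add: dilate_def)

lemma dilate_inject: "c \<noteq> 0 \<Longrightarrow> dilate c x = dilate c y \<longleftrightarrow> x = y"
  by (auto simp: dilate_def fun_eq_iff)

lemma continuous_on_rnorm [continuous_intros]:
  assumes "continuous_on S f"
  shows "continuous_on S (\<lambda>x. rnorm n (f x))"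
  unfolding rnorm_def
  by (intro continuous_on_real_sqrt continuous_on_sum continuous_on_power
      continuous_on_product_then_coordinatewise[OF assms])

text \<open>
  As an introduction rule this would decompose every function-valued map into its coordinates,
  before the rule for dilations below can apply.
\<close>

declare continuous_on_coordinatewise_then_product [continuous_intros del]

lemma continuous_on_dilate [continuous_intros]:
  assumes "continuous_on S c" "continuous_on S f"
  shows "continuous_on S (\<lambda>x. dilate (c x) (f x))"
  unfolding dilate_def
  by (intro continuous_on_coordinatewise_then_product continuous_on_mult assms(1)
      continuous_on_product_then_coordinatewise[OF assms(2)])

lemma topspace_closed_disk: "topspace (closed_disk n) = {x. (\<forall>i\<ge>n. x i = 0) \<and> rnorm n x \<le> 1}"
  by (auto simp: closed_disk_def topspace_Euclidean_space rnorm_def)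

lemma topspace_open_disk: "topspace (open_disk n) = {x. (\<forall>i\<ge>n. x i = 0) \<and> rnorm n x < 1}"
  by (auto simp: open_disk_def topspace_Euclidean_space rnorm_def)

lemma topspace_disk_boundary: "topspace (disk_boundary n) = {x. (\<forall>i\<ge>n. x i = 0) \<and> rnorm n x = 1}"
  by (auto simp: disk_boundary_def topspace_Euclidean_space rnorm_def)

lemma closed_disk_eq_top_of_set: "closed_disk n = top_of_set (topspace (closed_disk n))"
  unfolding closed_disk_def Euclidean_space_eq_top_of_set by (simp add: subtopology_subtopology)

lemma disk_boundary_eq_top_of_set: "disk_boundary n = top_of_set (topspace (disk_boundary n))"
  unfolding disk_boundary_def Euclidean_space_eq_top_of_set by (simp add: subtopology_subtopology)

lemma disk_boundary_subset: "topspace (disk_boundary n) \<subseteq> topspace (closed_disk n)"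
  by (auto simp: topspace_closed_disk topspace_disk_boundary)

lemma dilate_in_closed_disk:
  "\<lbrakk>x \<in> topspace (closed_disk n); \<bar>c\<bar> * rnorm n x \<le> 1\<rbrakk> \<Longrightarrow> dilate c x \<in> topspace (closed_disk n)"
  by (simp add: topspace_closed_disk) (simp add: dilate_def)

lemma normalize_in_disk_boundary:
  "\<lbrakk>x \<in> topspace (closed_disk n); rnorm n x \<noteq> 0\<rbrakk> \<Longrightarrow> dilate (1 / rnorm n x) x \<in> topspace (disk_boundary n)"
  by (simp add: topspace_closed_disk topspace_disk_boundary) (simp add: dilate_def)

lemma prod_interval_closed_disk:
  "prod_topology (top_of_set {0..1::real}) (closed_disk n) = top_of_set ({0..1} \<times> topspace (closed_disk n))"
  using closed_disk_eq_top_of_set[of n] by (metis prod_topology_subtopology_eu)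

lemma contractible_closed_disk: "contractible_space (closed_disk n)"
  unfolding contractible_space_def
proof (rule exI, rule homotopic_with_TrueI)
  have "continuous_on ({0..1::real} \<times> topspace (closed_disk n)) (\<lambda>z. dilate (1 - fst z) (snd z))"
    by (intro continuous_intros continuous_on_id)
  moreover have "dilate (1 - t) x \<in> topspace (closed_disk n)" if "t \<in> {0..1}" "x \<in> topspace (closed_disk n)" for t x
    using that by (intro dilate_in_closed_disk) (auto simp: topspace_closed_disk intro: mult_le_one)
  ultimately show "continuous_map (prod_topology (top_of_set {0..1::real}) (closed_disk n)) (closed_disk n)
      (\<lambda>z. dilate (1 - fst z) (snd z))"
    unfolding prod_interval_closed_disk
    by (subst closed_disk_eq_top_of_set) (auto simp: continuous_map_in_subtopology)
qed (simp_all, simp add: dilate_def)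

text \<open>
  At time \<open>t\<close> the map \<open>V\<close> is squeezed into the disk of radius \<open>1 - t / 2\<close>, and the remaining collar is
  filled with the part of the homotopy \<open>G\<close> up to time \<open>t\<close>.
\<close>
lemma homotopy_extension_disk:
  assumes V: "continuous_map (closed_disk n) Y V"
    and G: "continuous_map (prod_topology (top_of_set {0..1::real}) (disk_boundary n)) Y G"
    and GV: "\<And>s. s \<in> topspace (disk_boundary n) \<Longrightarrow> G (0, s) = V s"
  obtains L where "continuous_map (prod_topology (top_of_set {0..1::real}) (closed_disk n)) Y L"
    "\<And>z. z \<in> topspace (closed_disk n) \<Longrightarrow> L (0, z) = V z"
    "\<And>t s. \<lbrakk>t \<in> {0..1}; s \<in> topspace (disk_boundary n)\<rbrakk> \<Longrightarrow> L (t, s) = G (t, s)"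
proof -
  let ?D = "topspace (closed_disk n)" and ?S = "topspace (disk_boundary n)" and ?I = "{0..1::real}"
  let ?ID = "prod_topology (top_of_set {0..1::real}) (closed_disk n)"
  define L where "L z = (if rnorm n (snd z) \<le> 1 - fst z / 2 then V (dilate (1 / (1 - fst z / 2)) (snd z))
      else G (2 * rnorm n (snd z) - 2 + fst z, dilate (1 / rnorm n (snd z)) (snd z)))" for z
  have "continuous_map ?ID Y L"
    unfolding L_def
  proof (rule continuous_map_cases_le)
    show "continuous_map ?ID euclideanreal (\<lambda>z. rnorm n (snd z))"
      "continuous_map ?ID euclideanreal (\<lambda>z. 1 - fst z / 2)"
      unfolding prod_interval_closed_disk by (auto intro!: continuous_intros continuous_on_id)
    let ?A = "?I \<times> ?D \<inter> {z. rnorm n (snd z) \<le> 1 - fst z / 2}"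
    have "continuous_on ?A (\<lambda>z. dilate (1 / (1 - fst z / 2)) (snd z))"
      by (intro continuous_intros continuous_on_id) auto
    moreover have "dilate (1 / (1 - fst z / 2)) (snd z) \<in> ?D" if "z \<in> ?A" for z
      using that by (intro dilate_in_closed_disk) (auto simp: field_simps)
    ultimately have "continuous_map (top_of_set ?A) (closed_disk n) (\<lambda>z. dilate (1 / (1 - fst z / 2)) (snd z))"
      by (subst closed_disk_eq_top_of_set) (auto simp: continuous_map_in_subtopology)
    from continuous_map_compose[OF this V]
    show "continuous_map (subtopology ?ID {z \<in> topspace ?ID. rnorm n (snd z) \<le> 1 - fst z / 2}) Y
        (\<lambda>z. V (dilate (1 / (1 - fst z / 2)) (snd z)))"
      unfolding prod_interval_closed_disk by (simp add: subtopology_subtopology o_def Int_def conj_ac)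
    let ?B = "?I \<times> ?D \<inter> {z. 1 - fst z / 2 \<le> rnorm n (snd z)}"
    have "continuous_on ?B (\<lambda>z. (2 * rnorm n (snd z) - 2 + fst z, dilate (1 / rnorm n (snd z)) (snd z)))"
      by (intro continuous_intros continuous_on_id) auto
    moreover have "(2 * rnorm n (snd z) - 2 + fst z, dilate (1 / rnorm n (snd z)) (snd z)) \<in> ?I \<times> ?S" if "z \<in> ?B" for z
    proof -
      have "rnorm n (snd z) \<noteq> 0" using that by auto
      moreover have "rnorm n (snd z) \<le> 1" using that by (auto simp: topspace_closed_disk)
      ultimately show ?thesis
        using that normalize_in_disk_boundary[of "snd z" n] by auto
    qed
    ultimately have "continuous_map (top_of_set ?B) (prod_topology (top_of_set ?I) (disk_boundary n))
        (\<lambda>z. (2 * rnorm n (snd z) - 2 + fst z, dilate (1 / rnorm n (snd z)) (snd z)))"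
      using disk_boundary_eq_top_of_set[of n] prod_topology_subtopology_eu[of ?I ?S]
      by (auto simp: continuous_map_in_subtopology)
    from continuous_map_compose[OF this G]
    show "continuous_map (subtopology ?ID {z \<in> topspace ?ID. 1 - fst z / 2 \<le> rnorm n (snd z)}) Y
        (\<lambda>z. G (2 * rnorm n (snd z) - 2 + fst z, dilate (1 / rnorm n (snd z)) (snd z)))"
      unfolding prod_interval_closed_disk by (simp add: subtopology_subtopology o_def Int_def conj_ac)
    show "V (dilate (1 / (1 - fst z / 2)) (snd z)) = G (2 * rnorm n (snd z) - 2 + fst z, dilate (1 / rnorm n (snd z)) (snd z))"
      if z: "z \<in> topspace ?ID" "rnorm n (snd z) = 1 - fst z / 2" for z
    proof -
      have "rnorm n (snd z) \<noteq> 0" using z by auto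
      then have "dilate (1 / rnorm n (snd z)) (snd z) \<in> ?S"
        using z(1) by (intro normalize_in_disk_boundary) auto
      then show ?thesis using GV unfolding z(2) by simp
    qed
  qed
  moreover have "L (0, z) = V z" if "z \<in> ?D" for z
    using that by (simp add: L_def topspace_closed_disk)
  moreover have "L (t, s) = G (t, s)" if "t \<in> ?I" "s \<in> ?S" for t s
    using that GV[OF that(2)] by (auto simp: L_def topspace_disk_boundary)
  ultimately show ?thesis by (rule that)
qed

section \<open>Attaching a cell along a homotopy equivalence\<close>

text \<open>
  Let \<open>M\<close> be the union of \<open>A\<close> with the outer half of the disk, which is the mapping cylinder of the
  attaching map \<open>q\<close>, and let \<open>\<iota>\<close> include the sphere as the inner end of \<open>M\<close>. As \<open>q\<close> is a
  homotopy equivalence with inverse \<open>g\<close>, the inclusion of \<open>M\<close> is homotopic to \<open>\<iota> \<circ> R\<close> for a map \<open>R\<close>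
  to the sphere with \<open>R \<circ> \<iota> = id\<close>. The homotopy runs through \<open>c\<close> (collapse \<open>M\<close> to \<open>A\<close>),
  \<open>q \<circ> g \<circ> c\<close>, and \<open>\<iota> \<circ> g \<circ> c\<close>. It need not be constant on the inner sphere, but by the homotopy
  extension property of the disk it extends over the inner disk in any case. The result is a
  homotopy from the identity to a map that factors through a disk, and the disk is contractible.
\<close>
lemma contractible_cell_attachment:
  assumes haus: "Hausdorff_space Y" and q: "continuous_map (closed_disk n) Y q"
    and A: "closedin Y A" and cover: "topspace Y \<subseteq> A \<union> q ` topspace (closed_disk n)"
    and q_boundary: "\<And>z. z \<in> topspace (closed_disk n) \<Longrightarrow> q z \<in> A \<longleftrightarrow> z \<in> topspace (disk_boundary n)"
    and q_inj_on: "inj_on q {z \<in> topspace (closed_disk n). q z \<notin> A}"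
    and equiv: "homotopy_equivalence_map (disk_boundary n) (subtopology Y A) q"
  shows "contractible_space Y"
proof -
  let ?D = "topspace (closed_disk n)" and ?S = "topspace (disk_boundary n)" and ?I = "{0..1::real}"
  obtain g where g: "continuous_map (subtopology Y A) (disk_boundary n) g"
    and gq: "homotopic_with (\<lambda>_. True) (disk_boundary n) (disk_boundary n) (g \<circ> q) id"
    and qg: "homotopic_with (\<lambda>_. True) (subtopology Y A) (subtopology Y A) (q \<circ> g) id"
    using equiv unfolding homotopy_equivalence_map_def by blast
  obtain G where G: "continuous_map (prod_topology (top_of_set ?I) (disk_boundary n)) (disk_boundary n) G"
    "\<And>s. G (0, s) = (g \<circ> q) s" "\<And>s. G (1, s) = id s"
    by (rule homotopic_with_TrueE[OF gq], rule that)
  have G0: "G (0, s) = g (q s)" and G1: "G (1, s) = s" for s using G(2,3) by simp_all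
  have q_inj: "z = z'" if "z \<in> ?D" "z' \<in> ?D" "q z = q z'" "q z \<notin> A" for z z'
    using inj_onD[OF q_inj_on, OF that(3)] that by auto
  have SD: "?S \<subseteq> ?D" by (rule disk_boundary_subset)
  have D1: "rnorm n z \<le> 1" if "z \<in> ?D" for z using that by (simp add: topspace_closed_disk)
  have S1: "rnorm n s = 1" if "s \<in> ?S" for s using that by (simp add: topspace_disk_boundary)
  have S_iff: "z \<in> ?S \<longleftrightarrow> rnorm n z = 1" if "z \<in> ?D" for z
    using that by (auto simp: topspace_closed_disk topspace_disk_boundary)

  \<comment> \<open>The mapping cylinder \<open>M\<close>; \<open>E\<close> is the part of the disk that it contains.\<close>
  define E where "E = ?D \<inter> {z. 1 / 2 \<le> rnorm n z}"
  define M where "M = A \<union> q ` E"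
  let ?M = "subtopology Y M" and ?E = "top_of_set E"
  have ED: "E \<subseteq> ?D" by (auto simp: E_def)
  have E0: "rnorm n z \<noteq> 0" "rnorm n z \<le> 1" "1 / 2 \<le> rnorm n z" if "z \<in> E" for z
    using that D1 by (auto simp: E_def)
  have compact_E: "compactin (closed_disk n) E"
  proof -
    have "closed {z. 1 / 2 \<le> rnorm n z}"
      by (intro closed_Collect_le continuous_intros continuous_on_id)
    then have "closedin (closed_disk n) E"
      unfolding E_def using closedin_closed_Int[of _ ?D] closed_disk_eq_top_of_set[of n] by metis
    then show ?thesis
      using compact_space_closed_disk closedin_compact_space by blast
  qed
  have "closedin Y (q ` E)"
    using haus image_compactin[OF compact_E q] by (rule compactin_imp_closedin)
  then have closedM: "closedin Y M" unfolding M_def using A by (intro closedin_Un)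
  have MY: "M \<subseteq> topspace Y" using closedM by (rule closedin_subset)
  have topM: "topspace ?M = M" using MY by auto
  have subE: "subtopology (closed_disk n) E = ?E"
    using ED by (subst closed_disk_eq_top_of_set) (simp add: subtopology_subtopology Int_absorb1)
  have qE: "continuous_map ?E ?M q"
    using continuous_map_from_subtopology[OF q, of E] unfolding subE
    by (auto simp: continuous_map_in_subtopology M_def)
  have properE: "proper_map ?E ?M q"
  proof (rule continuous_imp_proper_map[OF _ _ qE])
    show "compact_space ?E"
      using compact_E subE compact_space_subtopology by metis
    show "kc_space ?M"
      by (intro Hausdorff_imp_kc_space Hausdorff_space_subtopology haus)
  qed
  have closed_AM: "closedin ?M A"
    using A by (rule closedin_subset_topspace) (simp add: M_def)
  have coverM: "topspace ?M \<subseteq> A \<union> q ` topspace ?E" by (auto simp: M_def)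
  have subMA: "subtopology ?M A = subtopology Y A"
    by (simp add: subtopology_subtopology M_def Int_absorb1)
  have injM: "inj_on q {w \<in> topspace ?E. q w \<notin> A}"
    by (rule inj_on_subset[OF q_inj_on]) (use ED in auto)
  note glue_M = glue_homotopy_along_proper_map[OF properE qE closed_AM coverM, unfolded subMA, OF _ _ _ injM]
    and glue_M0 = glue_along_proper_map[OF properE qE closed_AM coverM, unfolded subMA, OF _ _ _ injM]
  have cont_E: "continuous_map (prod_topology (top_of_set ?I) ?E) (closed_disk n) f"
    if "continuous_on (?I \<times> E) f" "\<And>t z. \<lbrakk>t \<in> ?I; z \<in> E\<rbrakk> \<Longrightarrow> f (t, z) \<in> ?D" for f
    using that by (subst closed_disk_eq_top_of_set)
      (auto simp: continuous_map_in_subtopology prod_topology_subtopology_eu)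

  \<comment> \<open>The collapse of the cylinder to \<open>A\<close>.\<close>
  have radial: "continuous_map ?E (disk_boundary n) (\<lambda>z. dilate (1 / rnorm n z) z)"
  proof (subst disk_boundary_eq_top_of_set)
    have "continuous_on E (\<lambda>z. dilate (1 / rnorm n z) z)"
      by (intro continuous_intros continuous_on_id) (use E0(1) in auto)
    then show "continuous_map ?E (top_of_set ?S) (\<lambda>z. dilate (1 / rnorm n z) z)"
      using normalize_in_disk_boundary E0(1) ED by (auto simp: continuous_map_in_subtopology)
  qed
  have qS: "continuous_map (disk_boundary n) (subtopology Y A) q"
    using equiv by (simp add: homotopy_equivalence_map_def)
  obtain c where c: "continuous_map ?M (subtopology Y A) c" "\<And>a. a \<in> A \<Longrightarrow> c a = id a"
      "\<And>z. z \<in> topspace ?E \<Longrightarrow> c (q z) = (q \<circ> (\<lambda>z. dilate (1 / rnorm n z) z)) z"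
  proof (rule glue_M0)
    show "continuous_map (subtopology Y A) (subtopology Y A) id" by simp
    show "continuous_map ?E (subtopology Y A) (q \<circ> (\<lambda>z. dilate (1 / rnorm n z) z))"
      by (rule continuous_map_compose[OF radial qS])
    show "(q \<circ> (\<lambda>z. dilate (1 / rnorm n z) z)) w = id (q w)" if "w \<in> topspace ?E" "q w \<in> A" for w
      using that q_boundary[of w] ED S1[of w] by auto
  qed (rule that)
  have c_id: "homotopic_with (\<lambda>_. True) ?M Y id c"
  proof -
    let ?f = "\<lambda>z. dilate (1 - fst z + fst z / rnorm n (snd z)) (snd z)"
    have f: "continuous_map (prod_topology (top_of_set ?I) ?E) (closed_disk n) ?f"
    proof (rule cont_E)
      show "continuous_on (?I \<times> E) ?f"
        by (intro continuous_intros continuous_on_id) (use E0(1) in auto)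
      show "?f (t, z) \<in> ?D" if "t \<in> ?I" "z \<in> E" for t z
      proof (rule dilate_in_closed_disk)
        show "snd (t, z) \<in> ?D" using ED that by auto
        have "\<bar>1 - t + t / rnorm n z\<bar> * rnorm n z = (1 - t) * rnorm n z + t"
        proof -
          have "0 \<le> 1 - t + t / rnorm n z" using that by simp
          then show ?thesis
            using E0(1)[OF that(2)] by (simp add: abs_of_nonneg distrib_right)
        qed
        also have "\<dots> \<le> (1 - t) * 1 + t"
          using that E0(2)[OF that(2)] by (intro add_right_mono mult_left_mono) auto
        finally show "\<bar>1 - fst (t, z) + fst (t, z) / rnorm n (snd (t, z))\<bar> * rnorm n (snd (t, z)) \<le> 1" by simp
      qed
    qed
    have u: "continuous_map (prod_topology (top_of_set ?I) (subtopology Y A)) Y (id \<circ> snd)"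
      by (intro continuous_map_compose[OF continuous_map_snd]) (simp add: continuous_map_from_subtopology)
    obtain h where h: "continuous_map (prod_topology (top_of_set ?I) ?M) Y h"
      "\<And>t x. \<lbrakk>t \<in> topspace (top_of_set ?I); x \<in> A\<rbrakk> \<Longrightarrow> h (t, x) = (id \<circ> snd) (t, x)"
      "\<And>t w. \<lbrakk>t \<in> topspace (top_of_set ?I); w \<in> topspace ?E\<rbrakk> \<Longrightarrow> h (t, q w) = (q \<circ> ?f) (t, w)"
    proof (rule glue_M[OF u continuous_map_compose[OF f q]])
      show "(q \<circ> ?f) (t, w) = (id \<circ> snd) (t, q w)" if "w \<in> topspace ?E" "q w \<in> A" for t w
        using that q_boundary[of w] ED S1[of w] by auto
    qed (rule that)
    show ?thesis
    proof (rule homotopic_with_TrueI[OF h(1)])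
      show "h (0, x) = id x" if "x \<in> topspace ?M" for x
        using that h(2)[of 0 x] h(3)[of 0] unfolding topM M_def by auto
      show "h (1, x) = c x" if "x \<in> topspace ?M" for x
        using that h(2)[of 1 x] h(3)[of 1] c(2)[of x] c(3) unfolding topM M_def by auto
    qed
  qed

  \<comment> \<open>The dilation by \<open>1 / 2\<close> maps the sphere to the inner end of the cylinder.\<close>
  define \<iota> where "\<iota> z = q (dilate (1 / 2) z)" for z
  have \<iota>: "continuous_map (closed_disk n) Y \<iota>"
  proof -
    have "continuous_on ?D (dilate (1 / 2))"
      using continuous_on_dilate[OF continuous_on_const continuous_on_id, of ?D "1 / 2"] by simp
    moreover have "dilate (1 / 2) z \<in> ?D" if "z \<in> ?D" for z
      using D1[OF that] that by (intro dilate_in_closed_disk) auto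
    ultimately have "continuous_map (closed_disk n) (closed_disk n) (dilate (1 / 2))"
      by (subst (1 2) closed_disk_eq_top_of_set) (auto simp: continuous_map_in_subtopology)
    from continuous_map_compose[OF this q] show ?thesis by (simp add: \<iota>_def[abs_def] o_def)
  qed
  have half_D: "dilate (1 / 2) z \<in> ?D" if "z \<in> ?D" for z
    using D1[OF that] that by (intro dilate_in_closed_disk) auto
  have half_E: "dilate (1 / 2) s \<in> E" if "s \<in> ?S" for s
    using half_D SD that S1[OF that] by (auto simp: E_def)
  have \<iota>M: "\<iota> s \<in> M" if "s \<in> ?S" for s
    using half_E[OF that] by (auto simp: \<iota>_def M_def)
  have boundary_sub: "continuous_map (disk_boundary n) Z f" if "continuous_map (closed_disk n) Z f" for Z :: "'a topology" and f
  proof -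
    have "disk_boundary n = subtopology (closed_disk n) ?S"
      using SD by (subst disk_boundary_eq_top_of_set, subst closed_disk_eq_top_of_set)
        (simp add: subtopology_subtopology Int_absorb1)
    then show ?thesis using that continuous_map_from_subtopology by metis
  qed
  have \<iota>_S: "continuous_map (disk_boundary n) ?M \<iota>"
    using boundary_sub[OF \<iota>] \<iota>M by (auto simp: continuous_map_in_subtopology)
  have q_\<iota>: "homotopic_with (\<lambda>_. True) (disk_boundary n) Y q \<iota>"
  proof (rule homotopic_with_TrueI)
    let ?f = "\<lambda>z. dilate (1 - fst z / 2) (snd z)"
    have "continuous_on (?I \<times> ?S) ?f"
      by (intro continuous_intros continuous_on_id) simp
    moreover have "?f z \<in> ?D" if "z \<in> ?I \<times> ?S" for z
      using that SD S1 by (intro dilate_in_closed_disk) auto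
    ultimately have "continuous_map (prod_topology (top_of_set ?I) (disk_boundary n)) (closed_disk n) ?f"
      by (subst closed_disk_eq_top_of_set, subst disk_boundary_eq_top_of_set)
        (auto simp: continuous_map_in_subtopology prod_topology_subtopology_eu)
    from continuous_map_compose[OF this q]
    show "continuous_map (prod_topology (top_of_set ?I) (disk_boundary n)) Y (\<lambda>z. q (?f z))"
      by (simp add: o_def)
  qed (simp_all add: \<iota>_def)

  \<comment> \<open>On the cylinder coordinate \<open>R\<close> follows the homotopy \<open>G\<close> from \<open>g \<circ> q\<close> at the end \<open>A\<close> to the
    identity at the inner end. Running \<open>G\<close> only up to a fraction of that time deforms \<open>g \<circ> c\<close> to
    \<open>R\<close>.\<close>
  let ?f = "\<lambda>z. (2 - 2 * rnorm n z, dilate (1 / rnorm n z) z)"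
  have f: "continuous_map ?E (prod_topology (top_of_set ?I) (disk_boundary n)) ?f"
  proof (intro continuous_map_pairedI radial continuous_map_top_of_setI)
    show "continuous_on E (\<lambda>z. 2 - 2 * rnorm n z)"
      by (intro continuous_intros continuous_on_id)
    show "2 - 2 * rnorm n z \<in> ?I" if "z \<in> E" for z
      using E0(2,3)[OF that] by simp
  qed
  obtain R where R: "continuous_map ?M (disk_boundary n) R" "\<And>a. a \<in> A \<Longrightarrow> R a = g a"
      "\<And>z. z \<in> topspace ?E \<Longrightarrow> R (q z) = (G \<circ> ?f) z"
  proof (rule glue_M0[OF g continuous_map_compose[OF f G(1)]])
    show "(G \<circ> ?f) w = g (q w)" if "w \<in> topspace ?E" "q w \<in> A" for w
      using that q_boundary[of w] ED S1[of w] by (auto simp: G0)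
  qed (rule that)
  have gc_R: "homotopic_with (\<lambda>_. True) ?M (disk_boundary n) (g \<circ> c) R"
  proof -
    let ?k = "\<lambda>z. (fst z * (2 - 2 * rnorm n (snd z)), dilate (1 / rnorm n (snd z)) (snd z))"
    have k: "continuous_map (prod_topology (top_of_set ?I) ?E) (prod_topology (top_of_set ?I) (disk_boundary n)) ?k"
    proof (rule continuous_map_pairedI)
      show "continuous_map (prod_topology (top_of_set ?I) ?E) (top_of_set ?I) (\<lambda>z. fst z * (2 - 2 * rnorm n (snd z)))"
        unfolding prod_topology_subtopology_eu
      proof (rule continuous_map_top_of_setI)
        show "continuous_on (?I \<times> E) (\<lambda>z. fst z * (2 - 2 * rnorm n (snd z)))"
          by (intro continuous_intros continuous_on_id)
        show "fst z * (2 - 2 * rnorm n (snd z)) \<in> ?I" if "z \<in> ?I \<times> E" for z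
          using that E0(2,3)[of "snd z"] by (auto intro!: mult_le_one)
      qed
      show "continuous_map (prod_topology (top_of_set ?I) ?E) (disk_boundary n)
          (\<lambda>z. dilate (1 / rnorm n (snd z)) (snd z))"
        using continuous_map_compose[OF continuous_map_snd radial, of "top_of_set ?I"]
        unfolding o_def .
    qed
    have u: "continuous_map (prod_topology (top_of_set ?I) (subtopology Y A)) (disk_boundary n) (g \<circ> snd)"
      by (rule continuous_map_compose[OF continuous_map_snd g])
    obtain h where h: "continuous_map (prod_topology (top_of_set ?I) ?M) (disk_boundary n) h"
      "\<And>t x. \<lbrakk>t \<in> topspace (top_of_set ?I); x \<in> A\<rbrakk> \<Longrightarrow> h (t, x) = (g \<circ> snd) (t, x)"
      "\<And>t w. \<lbrakk>t \<in> topspace (top_of_set ?I); w \<in> topspace ?E\<rbrakk> \<Longrightarrow> h (t, q w) = (G \<circ> ?k) (t, w)"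
    proof (rule glue_M[OF u continuous_map_compose[OF k G(1)]])
      show "(G \<circ> ?k) (t, w) = (g \<circ> snd) (t, q w)" if "w \<in> topspace ?E" "q w \<in> A" for t w
        using that q_boundary[of w] ED S1[of w] by (auto simp: G0)
    qed (rule that)
    show ?thesis
    proof (rule homotopic_with_TrueI[OF h(1)])
      show "h (0, x) = (g \<circ> c) x" if "x \<in> topspace ?M" for x
        using that h(2)[of 0 x] h(3)[of 0] c(2)[of x] c(3) unfolding topM M_def by (auto simp: G0)
      show "h (1, x) = R x" if "x \<in> topspace ?M" for x
        using that h(2)[of 1 x] h(3)[of 1] R(2)[of x] R(3) unfolding topM M_def by auto
    qed
  qed
  have gc: "continuous_map ?M (disk_boundary n) (g \<circ> c)" by (rule continuous_map_compose[OF c(1) g])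
  have incl: "continuous_map (subtopology Y A) Y id" by (simp add: continuous_map_from_subtopology)
  have "homotopic_with (\<lambda>_. True) ?M Y (id \<circ> (id \<circ> c)) (id \<circ> ((q \<circ> g) \<circ> c))"
    by (rule homotopic_with_compose_continuous_map_left[OF
        homotopic_with_compose_continuous_map_right[OF homotopic_with_symD[OF qg] c(1)] incl]) auto
  then have 1: "homotopic_with (\<lambda>_. True) ?M Y c (q \<circ> (g \<circ> c))" by (simp add: o_assoc)
  have 2: "homotopic_with (\<lambda>_. True) ?M Y (q \<circ> (g \<circ> c)) (\<iota> \<circ> (g \<circ> c))"
    by (rule homotopic_with_compose_continuous_map_right[OF q_\<iota> gc]) simp
  have 3: "homotopic_with (\<lambda>_. True) ?M Y (\<iota> \<circ> (g \<circ> c)) (\<iota> \<circ> R)"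
    by (rule homotopic_with_compose_continuous_map_left[OF gc_R boundary_sub[OF \<iota>]]) simp
  have id_R: "homotopic_with (\<lambda>_. True) ?M Y id (\<iota> \<circ> R)"
    using c_id 1 2 3 homotopic_with_trans by blast
  obtain h where h: "continuous_map (prod_topology (top_of_set ?I) ?M) Y h"
    "\<And>x. h (0, x) = id x" "\<And>x. h (1, x) = (\<iota> \<circ> R) x"
    by (rule homotopic_with_TrueE[OF id_R], rule that)
  have R_\<iota>: "R (\<iota> s) = s" if "s \<in> ?S" for s
    using R(3)[of "dilate (1 / 2) s"] half_E[OF that] S1[OF that] G1 by (simp add: \<iota>_def)

  \<comment> \<open>Extension over the inner disk, which \<open>\<iota>\<close> parametrizes. At time 1 the result is \<open>L (1, _)\<close>
    composed with the map \<open>p\<close> to the disk.\<close>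
  let ?ID = "prod_topology (top_of_set ?I) (closed_disk n)"
  let ?IS = "prod_topology (top_of_set ?I) (disk_boundary n)"
  have "continuous_map ?IS (prod_topology (top_of_set ?I) ?M) (\<lambda>z. (fst z, \<iota> (snd z)))"
    using continuous_map_compose[OF continuous_map_snd \<iota>_S]
    by (intro continuous_map_pairedI continuous_map_fst) (simp add: o_def)
  from continuous_map_compose[OF this h(1)]
  have hS: "continuous_map ?IS Y (\<lambda>z. h (fst z, \<iota> (snd z)))" by (simp add: o_def)
  obtain L where L: "continuous_map ?ID Y L" "\<And>z. z \<in> ?D \<Longrightarrow> L (0, z) = \<iota> z"
    "\<And>t s. \<lbrakk>t \<in> ?I; s \<in> ?S\<rbrakk> \<Longrightarrow> L (t, s) = h (fst (t, s), \<iota> (snd (t, s)))"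
  proof (rule homotopy_extension_disk[OF \<iota> hS])
    show "h (fst (0, s), \<iota> (snd (0, s))) = \<iota> s" for s using h(2) by simp
  qed (rule that)
  have proper\<iota>: "proper_map (closed_disk n) Y \<iota>"
    using compact_space_closed_disk Hausdorff_imp_kc_space[OF haus] \<iota> by (rule continuous_imp_proper_map)
  have cover\<iota>: "topspace Y \<subseteq> M \<union> \<iota> ` ?D"
  proof
    fix y assume "y \<in> topspace Y"
    then consider "y \<in> A" | z where "z \<in> ?D" "y = q z" using cover by blast
    then show "y \<in> M \<union> \<iota> ` ?D"
    proof cases
      case (2 z)
      show ?thesis
      proof (cases "1 / 2 \<le> rnorm n z")
        case False
        then have "dilate 2 z \<in> ?D" using 2 by (intro dilate_in_closed_disk) auto
        moreover have "\<iota> (dilate 2 z) = y" using 2 by (simp add: \<iota>_def)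
        ultimately show ?thesis by blast
      qed (use 2 in \<open>auto simp: M_def E_def\<close>)
    qed (simp add: M_def)
  qed
  have half_A: "\<iota> z \<notin> A" if "z \<in> ?D" for z
    using q_boundary[OF half_D[OF that]] S1[of "dilate (1 / 2) z"] D1[OF that] by (auto simp: \<iota>_def)
  have \<iota>_M_iff: "z \<in> ?S" if zD: "z \<in> ?D" and zM: "\<iota> z \<in> M" for z
  proof -
    obtain w where w: "w \<in> E" "q (dilate (1 / 2) z) = q w"
      using zM half_A[OF zD] by (auto simp: M_def \<iota>_def)
    have "dilate (1 / 2) z = w"
      using q_inj[OF half_D[OF zD] _ w(2)] w(1) ED half_A[OF zD] by (auto simp: \<iota>_def)
    then have "rnorm n z = 1" using E0(3)[OF w(1)] D1[OF zD] by auto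
    then show ?thesis using S_iff[OF zD] by simp
  qed
  have inj\<iota>: "inj_on \<iota> {z \<in> ?D. \<iota> z \<notin> M}"
  proof (rule inj_onI, clarify)
    fix z z' assume z: "z \<in> ?D" "z' \<in> ?D" "\<iota> z = \<iota> z'"
    then have "dilate (1 / 2) z = dilate (1 / 2) z'"
      using q_inj[OF half_D[OF z(1)] half_D[OF z(2)]] half_A[OF z(1)] by (auto simp: \<iota>_def)
    then show "z = z'" by (simp add: dilate_inject)
  qed
  obtain k where k: "continuous_map (prod_topology (top_of_set ?I) Y) Y k"
    "\<And>t x. \<lbrakk>t \<in> topspace (top_of_set ?I); x \<in> M\<rbrakk> \<Longrightarrow> k (t, x) = h (t, x)"
    "\<And>t z. \<lbrakk>t \<in> topspace (top_of_set ?I); z \<in> ?D\<rbrakk> \<Longrightarrow> k (t, \<iota> z) = L (t, z)"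
  proof (rule glue_homotopy_along_proper_map[OF proper\<iota> \<iota> closedM cover\<iota> h(1) L(1) _ inj\<iota>])
    show "L (t, z) = h (t, \<iota> z)" if "t \<in> topspace (top_of_set ?I)" "z \<in> ?D" "\<iota> z \<in> M" for t z
      using L(3)[OF _ \<iota>_M_iff[OF that(2,3)]] that(1) by simp
  qed (rule that)
  have R_D: "continuous_map ?M (closed_disk n) R"
  proof -
    have "disk_boundary n = subtopology (closed_disk n) ?S"
      using SD by (subst disk_boundary_eq_top_of_set, subst closed_disk_eq_top_of_set)
        (simp add: subtopology_subtopology Int_absorb1)
    then show ?thesis using R(1) by (metis continuous_map_in_subtopology)
  qed
  obtain p where p: "continuous_map Y (closed_disk n) p" "\<And>x. x \<in> M \<Longrightarrow> p x = R x" "\<And>z. z \<in> ?D \<Longrightarrow> p (\<iota> z) = id z"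
  proof (rule glue_along_proper_map[OF proper\<iota> \<iota> closedM cover\<iota> R_D continuous_map_id _ inj\<iota>])
    show "id z = R (\<iota> z)" if "z \<in> ?D" "\<iota> z \<in> M" for z
      using R_\<iota>[OF \<iota>_M_iff[OF that]] by simp
  qed (rule that)
  have "continuous_map (closed_disk n) ?ID (\<lambda>z. (1, z))"
    by (simp add: continuous_map_pairwise o_def)
  from continuous_map_compose[OF this L(1)]
  have L1: "continuous_map (closed_disk n) Y (\<lambda>z. L (1, z))" by (simp add: o_def)
  have "homotopic_with (\<lambda>_. True) Y Y id ((\<lambda>z. L (1, z)) \<circ> p)"
  proof (rule homotopic_with_TrueI[OF k(1)])
    fix y assume y: "y \<in> topspace Y"
    then consider "y \<in> M" | z where "z \<in> ?D" "y = \<iota> z" using cover\<iota> by blast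
    then show "k (0, y) = id y"
      by cases (use k(2)[of 0] k(3)[of 0] h(2) L(2) in auto)
    show "k (1, y) = ((\<lambda>z. L (1, z)) \<circ> p) y"
    proof (cases "y \<in> M")
      case True
      have "R y \<in> ?S" using R(1) True topM by (auto simp: continuous_map_def)
      then have "L (1, R y) = \<iota> (R y)"
        using L(3)[of 1 "R y"] h(3)[of "\<iota> (R y)"] R_\<iota>[of "R y"] by simp
      then show ?thesis using True k(2)[of 1 y] h(3)[of y] p(2)[OF True] by simp
    next
      case False
      then obtain z where "z \<in> ?D" "y = \<iota> z" using y cover\<iota> by blast
      then show ?thesis using k(3)[of 1 z] p(3)[of z] by simp
    qed
  qed
  moreover obtain a where "homotopic_with (\<lambda>_. True) Y Y ((\<lambda>z. L (1, z)) \<circ> p) (\<lambda>_. a)"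
    using nullhomotopic_through_contractible_space[OF p(1) L1 contractible_closed_disk] by metis
  ultimately show ?thesis
    unfolding contractible_space_def by (blast intro: homotopic_with_trans)
qed

section \<open>Cells and their closures in an h-regular complex\<close>

lemma compactin_disk_boundary: "compactin (closed_disk n) (topspace (disk_boundary n))"
proof -
  have "topspace (disk_boundary n) = topspace (closed_disk n) \<inter> {z. rnorm n z = 1}"
    by (auto simp: topspace_closed_disk topspace_disk_boundary)
  moreover have "closed {z. rnorm n z = 1}"
    by (intro closed_Collect_eq continuous_intros continuous_on_id)
  ultimately have "closedin (closed_disk n) (topspace (disk_boundary n))"
    using closedin_closed_Int[of "{z. rnorm n z = 1}" "topspace (closed_disk n)"] closed_disk_eq_top_of_set[of n]
    by metis
  then show ?thesis
    using compact_space_closed_disk closedin_compact_space by blast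
qed

lemma topspace_closed_disk_Un: "topspace (closed_disk n) = topspace (open_disk n) \<union> topspace (disk_boundary n)"
  by (auto simp: topspace_closed_disk topspace_open_disk topspace_disk_boundary)

context cw_complex
begin

lemma cell_subset_topspace: "e \<in> C \<Longrightarrow> e \<subseteq> topspace X"
  using cells_cover by blast

lemma cell_unique: "\<lbrakk>e \<in> C; e' \<in> C; x \<in> e; x \<in> e'\<rbrakk> \<Longrightarrow> e = e'"
  using cells_disjoint by (metis disjointD disjoint_iff)

lemma char_map_boundary_lower:
  assumes "e \<in> C" "z \<in> topspace (disk_boundary (d e))"
  obtains e' where "e' \<in> C" "d e' < d e" "\<Phi> e z \<in> e'"
  using closure_finite[OF assms(1)] assms(2) by blast

lemma char_map_open_disk: "\<lbrakk>e \<in> C; z \<in> topspace (open_disk (d e))\<rbrakk> \<Longrightarrow> \<Phi> e z \<in> e"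
  using char_map_image_open_disk by blast

lemma char_map_boundary_notin:
  assumes "e \<in> C" "z \<in> topspace (disk_boundary (d e))"
  shows "\<Phi> e z \<notin> e"
  using char_map_boundary_lower[OF assms] cell_unique assms(1) by (metis less_irrefl)

lemma char_map_inj_on: "e \<in> C \<Longrightarrow> inj_on (\<Phi> e) (topspace (open_disk (d e)))"
  using char_map_interior homeomorphic_imp_injective_map by blast

lemma closure_of_cell:
  assumes e: "e \<in> C"
  shows "X closure_of e = \<Phi> e ` topspace (closed_disk (d e))"
proof
  show "X closure_of e \<subseteq> \<Phi> e ` topspace (closed_disk (d e))"
    using closure_of_cell_subset[OF e] char_map_image_open_disk[OF e]
    by (simp add: topspace_closed_disk_Un image_Un)
  have "\<Phi> e s \<in> X closure_of e" if s: "s \<in> topspace (disk_boundary (d e))" for s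
  proof -
    have n1: "rnorm (d e) s = 1" "s \<in> topspace (closed_disk (d e))"
      using s disk_boundary_subset by (auto simp: topspace_disk_boundary)
    have "continuous_on {0..1::real} (\<lambda>t. dilate t s)"
      by (intro continuous_on_dilate continuous_on_id continuous_on_const)
    moreover have "dilate t s \<in> topspace (closed_disk (d e))" if "t \<in> {0..1}" for t
      using that n1 by (intro dilate_in_closed_disk) auto
    ultimately have "continuous_map (top_of_set {0..1}) (closed_disk (d e)) (\<lambda>t. dilate t s)"
      by (subst closed_disk_eq_top_of_set) (rule continuous_map_top_of_setI)
    from continuous_map_compose[OF this char_map_continuous[OF e]]
    have cont: "continuous_map (top_of_set {0..1}) X (\<lambda>t. \<Phi> e (dilate t s))" by (simp add: o_def)
    have "1 \<in> top_of_set {0..1} closure_of {0..<1::real}"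
    proof -
      have "{0..1} \<inter> {0..<1} = {0..<1::real}" by auto
      then show ?thesis by (simp add: closure_of_subtopology)
    qed
    then have "\<Phi> e (dilate 1 s) \<in> X closure_of (\<lambda>t. \<Phi> e (dilate t s)) ` {0..<1}"
      using continuous_map_image_closure_subset[OF cont, of "{0..<1}"] by blast
    moreover have "(\<lambda>t. \<Phi> e (dilate t s)) ` {0..<1} \<subseteq> e"
    proof clarify
      fix t :: real assume "t \<in> {0..<1}"
      then have "dilate t s \<in> topspace (open_disk (d e))"
        using n1 by (simp add: topspace_open_disk topspace_closed_disk) (simp add: dilate_def)
      then show "\<Phi> e (dilate t s) \<in> e" by (rule char_map_open_disk[OF e])
    qed
    ultimately show ?thesis using closure_of_mono by (metis dilate_1 subsetD)
  qed
  moreover have "e \<subseteq> X closure_of e"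
    by (rule closure_of_subset[OF cell_subset_topspace[OF e]])
  ultimately show "\<Phi> e ` topspace (closed_disk (d e)) \<subseteq> X closure_of e"
    using char_map_image_open_disk[OF e] by (auto simp: topspace_closed_disk_Un)
qed

text \<open>
  This is where the hypothesis on the attaching maps enters.
\<close>
lemma closed_cell_contractible:
  assumes e: "e \<in> C" and reg: "h_regular X C d \<Phi>"
  shows "contractible_space (subtopology X (X closure_of e))"
proof (rule contractible_cell_attachment)
  let ?D = "topspace (closed_disk (d e))" and ?S = "topspace (disk_boundary (d e))"
  let ?Y = "subtopology X (X closure_of e)" and ?A = "\<Phi> e ` ?S"
  have A: "?A \<subseteq> X closure_of e"
    using closure_of_cell[OF e] disk_boundary_subset by blast
  have in_A: "\<Phi> e z \<in> ?A \<longleftrightarrow> z \<in> ?S" if "z \<in> ?D" for z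
  proof
    assume "\<Phi> e z \<in> ?A"
    then have "\<Phi> e z \<notin> e" using char_map_boundary_notin[OF e] by (elim imageE) simp
    then show "z \<in> ?S" using that char_map_open_disk[OF e, of z] unfolding topspace_closed_disk_Un by blast
  qed simp
  show "Hausdorff_space ?Y" by (rule Hausdorff_space_subtopology[OF hausdorff])
  show "continuous_map (closed_disk (d e)) ?Y (\<Phi> e)"
    using char_map_continuous[OF e] closure_of_cell[OF e] by (auto simp: continuous_map_in_subtopology)
  have "closedin X ?A"
    using hausdorff image_compactin[OF compactin_disk_boundary char_map_continuous[OF e]] by (rule compactin_imp_closedin)
  then show "closedin ?Y ?A" using A by (rule closedin_subset_topspace)
  show "topspace ?Y \<subseteq> ?A \<union> \<Phi> e ` ?D" using closure_of_cell[OF e] by auto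
  show "\<Phi> e z \<in> ?A \<longleftrightarrow> z \<in> ?S" if "z \<in> ?D" for z by (rule in_A[OF that])
  show "inj_on (\<Phi> e) {z \<in> ?D. \<Phi> e z \<notin> ?A}"
    by (rule inj_on_subset[OF char_map_inj_on[OF e]]) (auto simp: topspace_closed_disk_Un)
  have "subtopology ?Y ?A = subtopology X ?A"
    using A by (simp add: subtopology_subtopology Int_absorb1)
  then show "homotopy_equivalence_map (disk_boundary (d e)) (subtopology ?Y ?A) (\<Phi> e)"
    using reg e by (simp add: h_regular_def)
qed

text \<open>
  This is where the hypothesis that closed cells are subcomplexes enters.
\<close>
lemma meets_closure_imp_face:
  assumes reg: "h_regular X C d \<Phi>" and "e \<in> C" "e' \<in> C" "x \<in> e'" "x \<in> X closure_of e"
  shows "face_le X e' e"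
proof -
  have "subcomplex X C (X closure_of e)"
    using reg assms(2) by (simp add: h_regular_def)
  then obtain D where D: "D \<subseteq> C" "X closure_of e = \<Union>D" by (auto simp: subcomplex_def)
  have "x \<in> \<Union>D" using assms(5) by (simp only: D(2))
  then obtain e'' where e'': "e'' \<in> D" "x \<in> e''" by (rule UnionE)
  then have "e'' = e'" using D(1) assms(3,4) by (intro cell_unique[of e'' e' x]) auto
  then show ?thesis using e''(1) unfolding face_le_def D(2) by (intro Union_upper) simp
qed

lemma char_map_boundary_face:
  assumes reg: "h_regular X C d \<Phi>" and e: "e \<in> C" and z: "z \<in> topspace (disk_boundary (d e))"
  obtains e' where "e' \<in> C" "d e' < d e" "\<Phi> e z \<in> e'" "face_le X e' e"
proof -
  obtain e' where e': "e' \<in> C" "d e' < d e" "\<Phi> e z \<in> e'"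
    using char_map_boundary_lower[OF e z] .
  have "\<Phi> e z \<in> X closure_of e"
    using closure_of_cell[OF e] z disk_boundary_subset by blast
  then show ?thesis
    by (rule that[OF e' meets_closure_imp_face[OF reg e e'(1,3)]])
qed

section \<open>The radial cell map\<close>

text \<open>
  The inner half of a cell is labelled by the cell, and the outer half like its radial projection to
  the boundary. Thus the points labelled by faces of a cell \<open>e\<close> form an open neighbourhood of the
  closure of \<open>e\<close>.
\<close>
definition radial_cell_map :: "('a \<Rightarrow> 'a set) \<Rightarrow> bool" where
  "radial_cell_map m \<longleftrightarrow> (\<forall>e\<in>C. \<forall>z\<in>topspace (open_disk (d e)).
     m (\<Phi> e z) = (if rnorm (d e) z \<le> 1 / 2 then e else m (\<Phi> e (dilate (1 / rnorm (d e) z) z))))"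

text \<open>
  Well-founded recursion on the dimension, as the boundary of a cell lies in cells of lower dimension.
\<close>
lemma radial_cell_map_exists:
  obtains m where "radial_cell_map m"
proof -
  define cell where "cell x = (THE e. e \<in> C \<and> x \<in> e)" for x
  define coord where "coord x = inv_into (topspace (open_disk (d (cell x)))) (\<Phi> (cell x)) x" for x
  define F where "F m x = (let n = d (cell x); z = coord x in
      if rnorm n z \<le> 1 / 2 then cell x else m (\<Phi> (cell x) (dilate (1 / rnorm n z) z)))" for m :: "'a \<Rightarrow> 'a set" and x
  define R where "R = inv_image less_than (\<lambda>x. d (cell x))"
  define m where "m = wfrec R F"
  have cell: "cell x = e" if "e \<in> C" "x \<in> e" for x e
    unfolding cell_def by (rule the_equality) (use that cell_unique in \<open>simp, blast\<close>)
  show ?thesis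
  proof (rule that, unfold radial_cell_map_def, intro ballI)
    fix e z assume e: "e \<in> C" and z: "z \<in> topspace (open_disk (d e))"
    let ?x = "\<Phi> e z" and ?n = "d e"
    let ?y = "\<Phi> e (dilate (1 / rnorm ?n z) z)"
    have cx: "cell ?x = e" by (rule cell[OF e char_map_open_disk[OF e z]])
    have zx: "coord ?x = z"
      unfolding coord_def cx using inv_into_f_f[OF char_map_inj_on[OF e] z] .
    have "wf R" unfolding R_def by (intro wf_inv_image wf_less_than)
    then have "m ?x = F (cut m R ?x) ?x"
      unfolding m_def by (rule wfrec)
    also have "\<dots> = (if rnorm ?n z \<le> 1 / 2 then e else cut m R ?x ?y)"
      by (simp add: F_def cx zx)
    also have "\<dots> = (if rnorm ?n z \<le> 1 / 2 then e else m ?y)"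
    proof (cases "rnorm ?n z \<le> 1 / 2")
      case False
      then have "dilate (1 / rnorm ?n z) z \<in> topspace (disk_boundary ?n)"
        using z by (intro normalize_in_disk_boundary) (auto simp: topspace_closed_disk_Un)
      then obtain e' where "e' \<in> C" "d e' < d e" "?y \<in> e'"
        using char_map_boundary_lower[OF e] by blast
      then have "(?y, ?x) \<in> R" using cell cx by (simp add: R_def)
      then show ?thesis by (simp add: cut_apply)
    qed simp
    finally show "m ?x = (if rnorm ?n z \<le> 1 / 2 then e else m ?y)" .
  qed
qed

text \<open>
  If \<open>N\<close> meets an open cell in a collar over a part of the boundary, then pushing the collar out to
  the boundary deforms \<open>N\<close> into the rest \<open>A\<close> of \<open>N\<close>.
\<close>
lemma contractible_add_collar:
  assumes e: "e \<in> C" and closedA: "closedin (subtopology X N) A"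
    and bd: "\<Phi> e ` topspace (disk_boundary (d e)) \<inter> N \<subseteq> A" and AN: "A \<subseteq> N" and disj: "A \<inter> e = {}" and cover: "N \<subseteq> A \<union> e"
    and collar: "\<And>z. z \<in> topspace (open_disk (d e)) \<Longrightarrow>
        \<Phi> e z \<in> N \<longleftrightarrow> rnorm (d e) z > 1 / 2 \<and> \<Phi> e (dilate (1 / rnorm (d e) z) z) \<in> N"
    and contr: "contractible_space (subtopology X A)"
  shows "contractible_space (subtopology X N)"
proof -
  let ?n = "d e" and ?q = "\<Phi> e" and ?I = "{0..1::real}"
  let ?D = "topspace (closed_disk ?n)" and ?S = "topspace (disk_boundary ?n)"
  let ?Y = "subtopology X N"
  define W where "W = {z \<in> ?D. ?q z \<in> N}"
  let ?W = "subtopology (closed_disk ?n) W"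
  have WD: "W \<subseteq> ?D" by (auto simp: W_def)
  have W_eq: "?W = top_of_set W"
    using WD by (subst closed_disk_eq_top_of_set) (simp add: subtopology_subtopology Int_absorb1)
  have normW: "1 / 2 < rnorm ?n z" "rnorm ?n z \<le> 1" "?q (dilate (1 / rnorm ?n z) z) \<in> N" if "z \<in> W" for z
  proof -
    have z: "z \<in> ?D" "?q z \<in> N" using that by (auto simp: W_def)
    show "rnorm ?n z \<le> 1" using z(1) by (simp add: topspace_closed_disk)
    consider "z \<in> topspace (open_disk ?n)" | "z \<in> ?S" using z(1) by (auto simp: topspace_closed_disk_Un)
    then show "1 / 2 < rnorm ?n z" "?q (dilate (1 / rnorm ?n z) z) \<in> N"
      using collar[of z] z(2) by (cases; simp add: topspace_disk_boundary)+
  qed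
  have q: "continuous_map (closed_disk ?n) X ?q" by (rule char_map_continuous[OF e])
  have "proper_map (closed_disk ?n) X ?q"
    using compact_space_closed_disk Hausdorff_imp_kc_space[OF hausdorff] q by (rule continuous_imp_proper_map)
  then have proper: "proper_map ?W ?Y ?q"
    by (rule proper_map_restriction) (auto simp: W_def)
  have qW: "continuous_map ?W ?Y ?q"
    using continuous_map_from_subtopology[OF q, of W] by (auto simp: continuous_map_in_subtopology W_def)
  have q_cell: "?q ` topspace (open_disk ?n) = e" by (rule char_map_image_open_disk[OF e])
  have coverY: "topspace ?Y \<subseteq> A \<union> ?q ` topspace ?W"
  proof
    fix x assume "x \<in> topspace ?Y"
    then have x: "x \<in> N" by simp
    show "x \<in> A \<union> ?q ` topspace ?W"
    proof (cases "x \<in> A")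
      case False
      then have "x \<in> ?q ` topspace (open_disk ?n)" using cover x q_cell by blast
      then obtain z where "z \<in> topspace (open_disk ?n)" "x = ?q z" by blast
      then have "z \<in> topspace ?W" using x by (auto simp: W_def topspace_closed_disk_Un)
      then show ?thesis using \<open>x = ?q z\<close> by blast
    qed simp
  qed
  have inA: "z \<in> ?S" if "z \<in> ?D" "?q z \<in> A" for z
    using that disj char_map_open_disk[OF e, of z] unfolding topspace_closed_disk_Un by blast
  have inj: "inj_on ?q {w \<in> topspace ?W. ?q w \<notin> A}"
    by (rule inj_on_subset[OF char_map_inj_on[OF e]]) (use bd in \<open>auto simp: topspace_closed_disk_Un W_def image_subset_iff\<close>)
  let ?f = "\<lambda>z. dilate (1 - fst z + fst z / rnorm ?n (snd z)) (snd z)"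
  have f_in: "?f (t, z) \<in> W" if t: "t \<in> ?I" and z: "z \<in> W" for t z
  proof -
    define c where "c = 1 - t + t / rnorm ?n z"
    note nz = normW[OF z]
    have r0: "rnorm ?n z \<noteq> 0" using nz by auto
    have c0: "c > 0"
    proof -
      have "t \<le> t / rnorm ?n z" using t nz by (simp add: pos_le_divide_eq mult_left_le)
      then show ?thesis unfolding c_def by linarith
    qed
    have cr: "c * rnorm ?n z = (1 - t) * rnorm ?n z + t * 1"
      using r0 by (simp add: c_def distrib_right)
    have cr1: "c * rnorm ?n z \<le> 1"
      unfolding cr using t nz by (intro convex_bound_le) auto
    have cr2: "c * rnorm ?n z > 1 / 2"
    proof -
      have "(1 - t) * rnorm ?n z + t * 1 \<ge> (1 - t) * rnorm ?n z + t * rnorm ?n z"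
        using t nz by (intro add_left_mono mult_left_mono) auto
      then have "c * rnorm ?n z \<ge> rnorm ?n z" unfolding cr by (simp add: algebra_simps)
      then show ?thesis using nz by linarith
    qed
    have norm: "rnorm ?n (dilate c z) = c * rnorm ?n z" using c0 by simp
    have in_D: "dilate c z \<in> ?D"
      using z WD cr1 c0 by (intro dilate_in_closed_disk) auto
    have dir: "dilate (1 / rnorm ?n (dilate c z)) (dilate c z) = dilate (1 / rnorm ?n z) z"
      unfolding norm using c0 by simp
    have "?q (dilate c z) \<in> N"
    proof (cases "dilate c z \<in> topspace (open_disk ?n)")
      case True
      have "?q (dilate c z) \<in> N \<longleftrightarrow> rnorm ?n (dilate c z) > 1 / 2 \<and> ?q (dilate (1 / rnorm ?n z) z) \<in> N"
        using collar[OF True] by (simp only: dir)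
      then show ?thesis using cr2 nz(3) by (simp only: norm)
    next
      case False
      then have "rnorm ?n (dilate c z) = 1"
        using in_D by (auto simp: topspace_closed_disk_Un topspace_disk_boundary)
      then show ?thesis using dir nz(3) by simp
    qed
    then show ?thesis using in_D by (simp add: W_def c_def)
  qed
  have f: "continuous_map (prod_topology (top_of_set ?I) ?W) ?W ?f"
    unfolding W_eq prod_topology_subtopology_eu
  proof (rule continuous_map_top_of_setI)
    show "continuous_on (?I \<times> W) ?f"
    proof (intro continuous_intros continuous_on_id ballI)
      show "rnorm ?n (snd z) \<noteq> 0" if "z \<in> ?I \<times> W" for z
        using that normW(1)[of "snd z"] by auto
    qed
    show "?f z \<in> W" if "z \<in> ?I \<times> W" for z using f_in[of "fst z" "snd z"] that by auto
  qed
  have u: "continuous_map (prod_topology (top_of_set ?I) (subtopology ?Y A)) ?Y snd"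
    by (rule continuous_map_into_fulltopology[OF continuous_map_snd])
  obtain h where h: "continuous_map (prod_topology (top_of_set ?I) ?Y) ?Y h"
    "\<And>t x. \<lbrakk>t \<in> topspace (top_of_set ?I); x \<in> A\<rbrakk> \<Longrightarrow> h (t, x) = snd (t, x)"
    "\<And>t w. \<lbrakk>t \<in> topspace (top_of_set ?I); w \<in> topspace ?W\<rbrakk> \<Longrightarrow> h (t, ?q w) = (?q \<circ> ?f) (t, w)"
  proof (rule glue_homotopy_along_proper_map[OF proper qW closedA coverY u continuous_map_compose[OF f qW] _ inj])
    show "(?q \<circ> ?f) (t, w) = snd (t, ?q w)" if "w \<in> topspace ?W" "?q w \<in> A" for t w
      using inA[of w] that by (auto simp: topspace_disk_boundary)
  qed (rule that)
  define \<rho> where "\<rho> x = h (1, x)" for x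
  have h0: "h (0, x) = x" if "x \<in> topspace ?Y" for x
  proof -
    consider "x \<in> A" | w where "w \<in> topspace ?W" "x = ?q w" using coverY \<open>x \<in> topspace ?Y\<close> by blast
    then show ?thesis by cases (use h(2)[of 0] h(3)[of 0] in auto)
  qed
  have id_\<rho>: "homotopic_with (\<lambda>_. True) ?Y ?Y id \<rho>"
    by (rule homotopic_with_TrueI[OF h(1)]) (use h0 in \<open>auto simp: \<rho>_def\<close>)
  have \<rho>A: "\<rho> x \<in> A" if "x \<in> topspace ?Y" for x
  proof -
    consider "x \<in> A" | w where "w \<in> topspace ?W" "x = ?q w" using coverY \<open>x \<in> topspace ?Y\<close> by blast
    then show ?thesis
    proof cases
      case 1
      then show ?thesis using h(2)[of 1 x] by (simp add: \<rho>_def)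
    next
      case (2 w)
      then have w: "w \<in> W" by auto
      then have "dilate (1 / rnorm ?n w) w \<in> ?S"
        using normW(1)[OF w] WD by (intro normalize_in_disk_boundary) auto
      then show ?thesis using 2 h(3)[of 1 w] normW(3)[OF w] bd by (auto simp: \<rho>_def)
    qed
  qed
  have "continuous_map ?Y ?Y \<rho>"
    using homotopic_with_imp_continuous_maps[OF id_\<rho>] by blast
  then have \<rho>: "continuous_map ?Y (subtopology X A) \<rho>"
    using \<rho>A by (auto simp: continuous_map_in_subtopology)
  have "continuous_map (subtopology X A) ?Y id"
    using AN by (auto simp: continuous_map_in_subtopology continuous_map_from_subtopology)
  then obtain a where "homotopic_with (\<lambda>_. True) ?Y ?Y (id \<circ> \<rho>) (\<lambda>_. a)"
    using nullhomotopic_through_contractible_space[OF \<rho> _ contr] by metis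
  then show ?thesis
    using id_\<rho> unfolding contractible_space_def by (auto intro: homotopic_with_trans)
qed

lemma radial_cell_map_face:
  assumes reg: "h_regular X C d \<Phi>" and m: "radial_cell_map m"
  shows "\<lbrakk>e \<in> C; x \<in> e\<rbrakk> \<Longrightarrow> m x \<in> C \<and> face_le X (m x) e"
proof (induction "d e" arbitrary: e x rule: less_induct)
  case less
  obtain z where z: "z \<in> topspace (open_disk (d e))" "x = \<Phi> e z"
    using char_map_image_open_disk[OF less.prems(1)] less.prems(2) by blast
  have mx: "m x = (if rnorm (d e) z \<le> 1 / 2 then e else m (\<Phi> e (dilate (1 / rnorm (d e) z) z)))"
    using m less.prems(1) z unfolding radial_cell_map_def by blast
  show ?case
  proof (cases "rnorm (d e) z \<le> 1 / 2")
    case True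
    then show ?thesis using mx less.prems(1) face_le_refl by simp
  next
    case False
    then have "dilate (1 / rnorm (d e) z) z \<in> topspace (disk_boundary (d e))"
      using z by (intro normalize_in_disk_boundary) (auto simp: topspace_closed_disk_Un)
    then obtain e' where e': "e' \<in> C" "d e' < d e" "\<Phi> e (dilate (1 / rnorm (d e) z) z) \<in> e'" "face_le X e' e"
      by (rule char_map_boundary_face[OF reg less.prems(1)])
    then show ?thesis using less.hyps[OF e'(2,1,3)] False mx face_le_trans by auto
  qed
qed

lemma face_closed_Union:
  assumes reg: "h_regular X C d \<Phi>" and D: "finite D" "D \<subseteq> C"
    and faces: "\<And>e e'. \<lbrakk>e \<in> D; e' \<in> C; face_le X e' e\<rbrakk> \<Longrightarrow> e' \<in> D"
  shows "closedin X (\<Union>D)"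
proof -
  have "X closure_of e \<subseteq> \<Union>D" if "e \<in> D" for e
  proof
    fix x assume x: "x \<in> X closure_of e"
    then have "x \<in> \<Union>C" using closure_of_subset_topspace cells_cover by (metis subsetD)
    then obtain e' where e': "e' \<in> C" "x \<in> e'" by blast
    then have "face_le X e' e" using meets_closure_imp_face[OF reg _ e' x] that D(2) by blast
    then show "x \<in> \<Union>D" using faces[OF that e'(1)] e'(2) by blast
  qed
  moreover have "e \<subseteq> X closure_of e" if "e \<in> D" for e
    using that D(2) by (intro closure_of_subset cell_subset_topspace) auto
  ultimately have "\<Union>D = \<Union>((closure_of) X ` D)" by blast
  then show ?thesis using D(1) by (auto intro!: closedin_Union)
qed

text \<open>
  Induction on the subcomplex \<open>D\<close> containing \<open>e0\<close>. It starts with the faces of \<open>e0\<close>, whose union is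
  the closed cell and lies in \<open>N\<close>. Otherwise a cell \<open>e\<close> of maximal dimension among those that are
  not faces of \<open>e0\<close> is removed: this leaves a subcomplex, and in \<open>e\<close> the set \<open>N\<close> is the open collar
  over the part of the boundary of \<open>e\<close> that lies in \<open>N\<close>.
\<close>
lemma radial_neighbourhood:
  assumes reg: "h_regular X C d \<Phi>" and m: "radial_cell_map m" and "finite C" and e0: "e0 \<in> C"
  defines "N \<equiv> {x \<in> topspace X. face_le X (m x) e0}"
  shows "\<lbrakk>D \<subseteq> C; \<And>e e'. \<lbrakk>e \<in> D; e' \<in> C; face_le X e' e\<rbrakk> \<Longrightarrow> e' \<in> D; e0 \<in> D\<rbrakk> \<Longrightarrow>
    closedin X (\<Union>D - N) \<and> contractible_space (subtopology X (N \<inter> \<Union>D))"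
proof (induction "card D" arbitrary: D rule: less_induct)
  case less
  note DC = less.prems(1) and faces = less.prems(2)
  have finD: "finite D" using finite_subset[OF DC \<open>finite C\<close>] .
  have mface: "m x \<in> C" "face_le X (m x) e" if "e \<in> C" "x \<in> e" for e x
    using radial_cell_map_face[OF reg m that] by auto
  have closure_N: "X closure_of e0 \<subseteq> N"
  proof
    fix x assume x: "x \<in> X closure_of e0"
    then have xX: "x \<in> topspace X" using closure_of_subset_topspace by (metis subsetD)
    then obtain e where e: "e \<in> C" "x \<in> e" using cells_cover by blast
    then have "face_le X e e0" using meets_closure_imp_face[OF reg e0 e x] by blast
    then show "x \<in> N" using mface(2)[OF e] face_le_trans xX by (auto simp: N_def)
  qed
  show ?case
  proof (cases "\<forall>e\<in>D. face_le X e e0")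
    case True
    have "\<Union>D \<subseteq> X closure_of e0" using True by (auto simp: face_le_def)
    moreover have "X closure_of e0 \<subseteq> \<Union>D"
    proof
      fix x assume x: "x \<in> X closure_of e0"
      then have "x \<in> topspace X" using closure_of_subset_topspace by (metis subsetD)
      then obtain e where e: "e \<in> C" "x \<in> e" using cells_cover by blast
      then show "x \<in> \<Union>D" using meets_closure_imp_face[OF reg e0 e x] faces[OF less.prems(3) e(1)] by blast
    qed
    ultimately have D: "\<Union>D = X closure_of e0" by blast
    then have D': "\<Union>D - N = {}" "N \<inter> \<Union>D = X closure_of e0" using closure_N by auto
    show ?thesis unfolding D' using closed_cell_contractible[OF e0 reg] by simp
  next
    case False
    define B where "B = {e \<in> D. \<not> face_le X e e0}"
    have B: "finite B" "B \<noteq> {}" using finD False by (auto simp: B_def)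
    then have "Max (d ` B) \<in> d ` B" by (intro Max_in) auto
    then obtain e where e: "e \<in> B" "d e = Max (d ` B)" by auto
    have emax: "d e' \<le> d e" if "e' \<in> B" for e' using e(2) B(1) that by simp
    have eD: "e \<in> D" and ne: "\<not> face_le X e e0" and eC: "e \<in> C" using e(1) DC by (auto simp: B_def)
    define D' where "D' = D - {e}"
    have e0D': "e0 \<in> D'" using less.prems(3) ne face_le_refl[OF e0] by (auto simp: D'_def)
    have faces': "b \<in> D'" if "a \<in> D'" "b \<in> C" "face_le X b a" for a b
    proof -
      have aD: "a \<in> D" "a \<noteq> e" "a \<in> C" using that(1) DC by (auto simp: D'_def)
      have "b \<noteq> e"
      proof
        assume "b = e"
        then have "\<not> face_le X a e0" using ne that(3) face_le_trans by blast
        then have "d a \<le> d e" using emax aD by (simp add: B_def)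
        moreover have "d e < d a"
          using face_le_imp_eq_or_less[OF eC aD(3)] that(3) \<open>b = e\<close> aD(2) by auto
        ultimately show False by simp
      qed
      then show ?thesis using faces[OF aD(1) that(2,3)] by (simp add: D'_def)
    qed
    have D'C: "D' \<subseteq> C" using DC by (auto simp: D'_def)
    have "closedin X (\<Union>D' - N) \<and> contractible_space (subtopology X (N \<inter> \<Union>D'))"
    proof (rule less.hyps)
      show "card D' < card D" unfolding D'_def using finD eD by (rule card_Diff1_less)
      show "b \<in> D'" if "a \<in> D'" "b \<in> C" "face_le X b a" for a b using that by (rule faces')
    qed fact+
    then have IH: "closedin X (\<Union>D' - N)" "contractible_space (subtopology X (N \<inter> \<Union>D'))"
      by (rule conjunct1, rule conjunct2)
    have closedD': "closedin X (\<Union>D')"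
    proof (rule face_closed_Union[OF reg _ D'C])
      show "finite D'" using finD by (simp add: D'_def)
      show "b \<in> D'" if "a \<in> D'" "b \<in> C" "face_le X b a" for a b using that by (rule faces')
    qed
    have Un: "\<Union>D = \<Union>D' \<union> e" using eD by (auto simp: D'_def)
    have disj: "\<Union>D' \<inter> e = {}"
    proof -
      have "a \<inter> e = {}" if "a \<in> D'" for a
      proof -
        have "a \<in> C" "a \<noteq> e" using that D'C by (auto simp: D'_def)
        then show ?thesis using cell_unique[OF _ eC] by blast
      qed
      then show ?thesis by blast
    qed
    let ?n = "d e" and ?q = "\<Phi> e"
    have bd: "?q z \<in> \<Union>D'" if z: "z \<in> topspace (disk_boundary ?n)" for z
    proof -
      obtain e' where "e' \<in> C" "d e' < d e" "?q z \<in> e'" "face_le X e' e"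
        by (rule char_map_boundary_face[OF reg eC z])
      then have "e' \<in> D'" using faces[OF eD] by (auto simp: D'_def)
      then show ?thesis using \<open>?q z \<in> e'\<close> by blast
    qed
    have qX: "?q z \<in> topspace X" if "z \<in> topspace (closed_disk ?n)" for z
      using char_map_continuous[OF eC] that by (auto simp: continuous_map_def)
    have normal: "dilate (1 / rnorm ?n z) z \<in> topspace (disk_boundary ?n)"
      if "z \<in> topspace (closed_disk ?n)" "1 / 2 < rnorm ?n z \<or> 1 / 2 \<le> rnorm ?n z" for z
      using that by (intro normalize_in_disk_boundary) auto
    have collar: "?q z \<in> N \<longleftrightarrow> rnorm ?n z > 1 / 2 \<and> ?q (dilate (1 / rnorm ?n z) z) \<in> N"
      if z: "z \<in> topspace (open_disk ?n)" for z
    proof -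
      have zD: "z \<in> topspace (closed_disk ?n)" using z by (simp add: topspace_closed_disk_Un)
      have mz: "m (?q z) = (if rnorm ?n z \<le> 1 / 2 then e else m (?q (dilate (1 / rnorm ?n z) z)))"
        using m eC z unfolding radial_cell_map_def by blast
      show ?thesis
      proof (cases "rnorm ?n z \<le> 1 / 2")
        case False
        then have "?q (dilate (1 / rnorm ?n z) z) \<in> topspace X"
          using normal[OF zD] qX disk_boundary_subset by (meson linear subsetD not_le)
        then show ?thesis using False mz qX[OF zD] by (simp add: N_def)
      qed (use mz ne in \<open>simp add: N_def\<close>)
    qed
    have "contractible_space (subtopology X (N \<inter> \<Union>D))"
    proof (rule contractible_add_collar[OF eC])
      show "contractible_space (subtopology X (N \<inter> \<Union>D'))" by (fact IH(2))
      have "(N \<inter> \<Union>D) \<inter> \<Union>D' = N \<inter> \<Union>D'" using Un by blast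
      then show "closedin (subtopology X (N \<inter> \<Union>D)) (N \<inter> \<Union>D')"
        using closedin_subtopology_Int_closed[OF closedD', of "N \<inter> \<Union>D"] by simp
      show "?q z \<in> N \<inter> \<Union>D \<longleftrightarrow> rnorm ?n z > 1 / 2 \<and> ?q (dilate (1 / rnorm ?n z) z) \<in> N \<inter> \<Union>D"
        if z: "z \<in> topspace (open_disk ?n)" for z
      proof -
        have "z \<in> topspace (closed_disk ?n)" using z by (simp add: topspace_closed_disk_Un)
        then show ?thesis
          using collar[OF z] char_map_open_disk[OF eC z] bd[OF normal, of z] unfolding Un by auto
      qed
    qed (use Un disj bd in \<open>auto simp: N_def\<close>)
    moreover have "closedin X (\<Union>D - N)"
    proof -
      \<comment> \<open>The complement of \<open>N\<close> in the closed cell is the image of a compact set, namely the inner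
        disk \<open>Z\<close> together with the radii \<open>Q\<close> over boundary points outside \<open>N\<close>.\<close>
      define Z where "Z = topspace (closed_disk ?n) \<inter> {z. rnorm ?n z \<le> 1 / 2}"
      define E where "E = topspace (closed_disk ?n) \<inter> {z. 1 / 2 \<le> rnorm ?n z}"
      define Q where "Q = {z \<in> E. ?q (dilate (1 / rnorm ?n z) z) \<in> \<Union>D' - N}"
      have cl: "closedin (closed_disk ?n) (topspace (closed_disk ?n) \<inter> S)" if "closed S" for S
        using closedin_closed_Int[OF that, of "topspace (closed_disk ?n)"] closed_disk_eq_top_of_set[of ?n] by metis
      have Z: "closedin (closed_disk ?n) Z"
        unfolding Z_def by (intro cl closed_Collect_le continuous_intros continuous_on_id)
      have E: "closedin (closed_disk ?n) E"
        unfolding E_def by (intro cl closed_Collect_le continuous_intros continuous_on_id)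
      have subE: "subtopology (closed_disk ?n) E = top_of_set E"
        by (subst closed_disk_eq_top_of_set) (simp add: subtopology_subtopology E_def Int_absorb1)
      have "continuous_map (subtopology (closed_disk ?n) E) (closed_disk ?n) (\<lambda>z. dilate (1 / rnorm ?n z) z)"
        unfolding subE
      proof (subst closed_disk_eq_top_of_set, rule continuous_map_top_of_setI)
        show "continuous_on E (\<lambda>z. dilate (1 / rnorm ?n z) z)"
          by (intro continuous_intros continuous_on_id) (auto simp: E_def)
        show "dilate (1 / rnorm ?n z) z \<in> topspace (closed_disk ?n)" if "z \<in> E" for z
          using normal[of z] that disk_boundary_subset by (auto simp: E_def)
      qed
      from continuous_map_compose[OF this char_map_continuous[OF eC]]
      have "continuous_map (subtopology (closed_disk ?n) E) X (\<lambda>z. ?q (dilate (1 / rnorm ?n z) z))"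
        by (simp add: o_def)
      from closedin_continuous_map_preimage[OF this IH(1)]
      have "closedin (subtopology (closed_disk ?n) E) Q"
        unfolding Q_def by (simp add: subE)
      then have Q: "closedin (closed_disk ?n) Q" using E by (rule closedin_trans_full)
      have "compactin (closed_disk ?n) (Z \<union> Q)"
        using Z Q compact_space_closed_disk by (intro closedin_compact_space closedin_Un)
      then have "closedin X (?q ` (Z \<union> Q))"
        by (intro compactin_imp_closedin[OF hausdorff] image_compactin[OF _ char_map_continuous[OF eC]])
      moreover have "\<Union>D - N = (\<Union>D' - N) \<union> ?q ` (Z \<union> Q)"
      proof -
        have "x \<in> ?q ` (Z \<union> Q)" if x: "x \<in> e" "x \<notin> N" for x
        proof -
          obtain z where z: "z \<in> topspace (open_disk ?n)" "x = ?q z"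
            using char_map_image_open_disk[OF eC] x(1) by blast
          have zD: "z \<in> topspace (closed_disk ?n)" using z(1) by (simp add: topspace_closed_disk_Un)
          have "z \<in> Z \<union> Q"
          proof (cases "rnorm ?n z \<le> 1 / 2")
            case False
            then have "?q (dilate (1 / rnorm ?n z) z) \<in> \<Union>D' - N"
              using collar[OF z(1)] x(2) z(2) bd[OF normal[OF zD]] by auto
            then show ?thesis using zD False by (auto simp: Q_def E_def)
          qed (use zD in \<open>auto simp: Z_def\<close>)
          then show ?thesis using z(2) by blast
        qed
        moreover have "?q z \<in> \<Union>D - N" if z: "z \<in> Z \<union> Q" for z
        proof -
          have zD: "z \<in> topspace (closed_disk ?n)" using z by (auto simp: Z_def Q_def E_def)
          show ?thesis
          proof (cases "z \<in> topspace (open_disk ?n)")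
            case True
            then have "?q z \<notin> N" using collar[OF True] z by (auto simp: Z_def Q_def)
            then show ?thesis using char_map_open_disk[OF eC True] Un by auto
          next
            case False
            then have "rnorm ?n z = 1" using zD by (auto simp: topspace_closed_disk_Un topspace_disk_boundary)
            then have "?q z \<in> \<Union>D' - N" using z by (auto simp: Z_def Q_def)
            then show ?thesis using Un by auto
          qed
        qed
        ultimately show ?thesis unfolding Un by (auto simp: subset_iff)
      qed
      ultimately show ?thesis using IH(1) by (simp add: closedin_Un)
    qed
    ultimately show ?thesis by blast
  qed
qed

end

section \<open>The face poset as a finite model\<close>

text \<open>
  The intermediate spaces in the notion of weak homotopy equivalent spaces live on one fixed type, so
  McCord's theorem is needed for an isomorphic copy of the poset, with an arbitrary embedding \<open>\<iota>\<close>.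
\<close>
lemma finite_poset_embedding_weak_homotopy_equivalence:
  assumes P: "finite_poset P r" and Y: "finite_poset (\<iota> ` P) s"
    and order: "\<And>a b. \<lbrakk>a \<in> P; b \<in> P\<rbrakk> \<Longrightarrow> s (\<iota> a) (\<iota> b) \<longleftrightarrow> r a b"
    and m: "m \<in> topspace X \<rightarrow> P"
    and opn: "\<And>e. e \<in> P \<Longrightarrow> openin X {x \<in> topspace X. r (m x) e}"
    and contr: "\<And>e. e \<in> P \<Longrightarrow> contractible_space (subtopology X {x \<in> topspace X. r (m x) e})"
    and ne: "\<And>e. e \<in> P \<Longrightarrow> {x \<in> topspace X. r (m x) e} \<noteq> {}"
  shows "weak_homotopy_equivalence X (poset_topology (\<iota> ` P) s) (\<iota> \<circ> m)"
proof -
  interpret finite_poset P r by fact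
  have down: "{x \<in> topspace X. s ((\<iota> \<circ> m) x) (\<iota> e)} = {x \<in> topspace X. r (m x) e}" if "e \<in> P" for e
    using order m that by auto
  show ?thesis
  proof (rule weak_homotopy_equivalence_to_finite_poset[OF Y])
    show "continuous_map X (poset_topology (\<iota> ` P) s) (\<iota> \<circ> m)"
      unfolding continuous_map_def
    proof (intro conjI allI impI)
      show "\<iota> \<circ> m \<in> topspace X \<rightarrow> topspace (poset_topology (\<iota> ` P) s)"
        using m by auto
      fix U assume U: "openin (poset_topology (\<iota> ` P) s) U"
      have "{x \<in> topspace X. (\<iota> \<circ> m) x \<in> U} = (\<Union>e\<in>{e \<in> P. \<iota> e \<in> U}. {x \<in> topspace X. r (m x) e})"
      proof (intro equalityI subsetI)
        fix x assume "x \<in> {x \<in> topspace X. (\<iota> \<circ> m) x \<in> U}"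
        then show "x \<in> (\<Union>e\<in>{e \<in> P. \<iota> e \<in> U}. {x \<in> topspace X. r (m x) e})"
          using m refl by (intro UN_I[of "m x"]) auto
      next
        fix x assume "x \<in> (\<Union>e\<in>{e \<in> P. \<iota> e \<in> U}. {x \<in> topspace X. r (m x) e})"
        then obtain e where e: "e \<in> P" "\<iota> e \<in> U" "x \<in> topspace X" "r (m x) e" by blast
        then have "m x \<in> P" "s (\<iota> (m x)) (\<iota> e)" using m order by auto
        then have "\<iota> (m x) \<in> U" using U e(2) unfolding openin_poset_topology by blast
        then show "x \<in> {x \<in> topspace X. (\<iota> \<circ> m) x \<in> U}" using e(3) by simp
      qed
      moreover have "openin X (\<Union>e\<in>{e \<in> P. \<iota> e \<in> U}. {x \<in> topspace X. r (m x) e})"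
        using opn by (intro openin_Union) auto
      ultimately show "openin X {x \<in> topspace X. (\<iota> \<circ> m) x \<in> U}" by (simp only:)
    qed
    show "\<forall>y\<in>\<iota> ` P. contractible_space (subtopology X {x \<in> topspace X. s ((\<iota> \<circ> m) x) y})"
    proof (intro ballI, elim imageE)
      fix y e assume "y = \<iota> e" "e \<in> P"
      then show "contractible_space (subtopology X {x \<in> topspace X. s ((\<iota> \<circ> m) x) y})"
        using contr by (simp only: down)
    qed
    show "\<forall>y\<in>\<iota> ` P. {x \<in> topspace X. s ((\<iota> \<circ> m) x) y} \<noteq> {}"
    proof (intro ballI, elim imageE)
      fix y e assume "y = \<iota> e" "e \<in> P"
      then show "{x \<in> topspace X. s ((\<iota> \<circ> m) x) y} \<noteq> {}"
        using ne by (simp only: down not_False_eq_True)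
    qed
  qed
qed

theorem theorem4p7:
  fixes X :: "'a topology"
    and C :: "'a set set"
    and d :: "'a set \<Rightarrow> nat"
    and \<Phi> :: "'a set \<Rightarrow> (nat \<Rightarrow> real) \<Rightarrow> 'a"
  assumes "cw_complex X C d \<Phi>"
    and "finite C"
    and "h_regular X C d \<Phi>"
  shows "finite_model (face_poset X C) X"
proof -
  interpret cw_complex X C d \<Phi> by fact
  note fin = assms(2) and reg = assms(3)
  have poset: "finite_poset C (face_le X)"
    using fin face_le_refl face_le_antisym face_le_trans by unfold_locales blast+
  obtain m where m: "radial_cell_map m"
    by (rule radial_cell_map_exists)
  have mC: "m \<in> topspace X \<rightarrow> C"
    using radial_cell_map_face[OF reg m] cells_cover by blast
  let ?U = "\<lambda>e. {x \<in> topspace X. face_le X (m x) e}"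
  have nbhd: "openin X (?U e) \<and> contractible_space (subtopology X (?U e))" if e: "e \<in> C" for e
  proof -
    have "closedin X (\<Union>C - ?U e) \<and> contractible_space (subtopology X (?U e \<inter> \<Union>C))"
      by (rule radial_neighbourhood[OF reg m fin e subset_refl _ e])
    moreover have "?U e \<inter> \<Union>C = ?U e" unfolding cells_cover by blast
    ultimately show ?thesis
      unfolding openin_closedin_eq cells_cover by auto
  qed
  have nonempty: "?U e \<noteq> {}" if e: "e \<in> C" for e
    using radial_cell_map_face[OF reg m e] cell_nonempty[OF e] cell_subset_topspace[OF e] by blast
  \<comment> \<open>A copy of the face poset in the type of the intermediate spaces. Both the face poset and the
    complex map to it, so that the chain of intermediate spaces has length zero.\<close>
  define \<iota> :: "'a set \<Rightarrow> real \<Rightarrow> 'a set + 'a" where "\<iota> e = (\<lambda>_. Inl e)" for e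
  define s where "s p q \<longleftrightarrow> face_le X (projl (p 0)) (projl (q 0))" for p q :: "real \<Rightarrow> 'a set + 'a"
  have s: "s (\<iota> a) (\<iota> b) \<longleftrightarrow> face_le X a b" for a b by (simp add: s_def \<iota>_def)
  have poset': "finite_poset (\<iota> ` C) s"
  proof
    show "finite (\<iota> ` C)" using fin by simp
    show "p = q" if pq: "p \<in> \<iota> ` C" "q \<in> \<iota> ` C" "s p q" "s q p" for p q
    proof -
      obtain a b where "a \<in> C" "b \<in> C" "p = \<iota> a" "q = \<iota> b" using pq(1,2) by blast
      then show ?thesis using pq(3,4) face_le_antisym[of a b] by (simp add: s)
    qed
    show "s p u" if "s p q" "s q u" for p q u
      using that face_le_trans unfolding s_def by blast
  qed (use face_le_refl s in auto)
  have "weak_homotopy_equivalence X (poset_topology (\<iota> ` C) s) (\<iota> \<circ> m)"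
    using nbhd nonempty s mC by (intro finite_poset_embedding_weak_homotopy_equivalence[OF poset poset']) auto
  moreover have "weak_homotopy_equivalence (face_poset X C) (poset_topology (\<iota> ` C) s) (\<iota> \<circ> id)"
  proof (rule finite_poset_embedding_weak_homotopy_equivalence[OF poset poset'])
    show "s (\<iota> a) (\<iota> b) \<longleftrightarrow> face_le X a b" for a b by (rule s)
    fix e assume e: "e \<in> C"
    show "openin (face_poset X C) {x \<in> topspace (face_poset X C). face_le X (id x) e}"
      using face_le_trans by (auto simp: face_poset_def openin_poset_topology)
    show "contractible_space (subtopology (face_poset X C) {x \<in> topspace (face_poset X C). face_le X (id x) e})"
      using contractible_poset_down_set[of e C "face_le X"] e face_le_refl by (simp add: face_poset_def)
    show "{x \<in> topspace (face_poset X C). face_le X (id x) e} \<noteq> {}"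
      using e face_le_refl by (auto simp: face_poset_def)
  qed (simp add: face_poset_def)
  moreover have "equivclp R Z Z" for R :: "(real \<Rightarrow> 'a set + 'a) topology \<Rightarrow> _" and Z
    by (simp add: equivclp_def)
  ultimately have "weak_homotopy_equivalent_space (face_poset X C) X"
    unfolding weak_homotopy_equivalent_space_def by blast
  then show ?thesis
    using fin by (simp add: finite_model_def face_poset_def)
qed

end
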